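(* Suppose that the pair $(\hat\mu,\hat\mu_\partial)\in\mathcal{M}_+(Q_T\times\mathbf{Y}\times\mathbf{Z})\times\mathcal{M}_+(\partial Q_T\times\mathbf{Y}\times\mathbf{Z})$ satisfies the occupation-measure identities. Then the Young measure $\mu:(t,x)\mapsto\mu_{(t,x)}$ obtained from the disintegration $d\hat\mu(t,x,y,z)=d\mu_{(t,x)}(y,z)\,dx\,dt$ of $\hat\mu$ is an energy measure-valued (emv) solution to the PDE $\partial_t y-\Delta_x y=f(t,x,y)$ in $(0,T]\times\Omega$, $y=0$ on $[0,T]\times\partial\Omega$, $y(0,\cdot)=y_0$.
   Context: Setting. Let $n\ge 1$, $T>0$, and let $\Omega\subset\mathbb{R}^n$ be an open bounded domain with locally Lipschitz boundary. Fix a real $r$ with $r\ge 2$ and $r>n$. $W^{1,r}_0(\Omega)$ is the closure of $C_c^\infty(\Omega)$ in $W^{1,r}(\Omega)$, and $H^1_0(\Omega)=W^{1,2}_0(\Omega)$. Set $X_r=H^1(0,T;W^{1,r}_0(\Omega))=\{y\in L^2(0,T;W^{1,r}_0(\Omega)) : \partial_t y\in L^2(0,T;W^{1,r}_0(\Omega))\}$. Elements of $X_r$ are identified with their unique continuous representatives in $C([0,T]\times\overline{\Omega})$. Let $y_0\in W^{1,r}_0(\Omega)$. $\mathcal{M}_+(X)$ denotes the finite nonnegative Borel measures on $X$. Assumptions on $f:[0,T]\times\Omega\times\mathbb{R}\to\mathbb{R}$: $f$ is measurable in $(t,x)$; for almost all $(t,x)$, $y\mapsto f(t,x,y)$ is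 continuous on $\mathbb{R}$; for every compact $K\subset\mathbb{R}$ there is $M_K\ge 0$ with $\operatorname{ess\,sup}_{(t,x)\in[0,T]\times\Omega}\sup_{y\in K}|f(t,x,y)|\le M_K$; and for every compact $K\subset\mathbb{R}$ there is $L_K\ge0$ such that for almost all $(t,x)\in[0,T]\times\Omega$ and all $(u,v)\in K^2$, $(u-v)(f(t,x,u)-f(t,x,v))\le L_K(u-v)^2$. Weak solution: $y^*\in X_r$ is a weak solution to the PDE if $y^*(0,x)=y_0(x)$ for $x\in\Omega$ and, for all $v\in H^1_0(\Omega)$ and $\varphi\in C_c^\infty((0,T))$, $$\int_0^T\int_\Omega\varphi(t)\bigl[v(x)\partial_t y^*(t,x)+\nabla_x v(x)\cdot\nabla_x y^*(t,x)-v(x)f(t,x,y^*(t,x))\bigr]\,dx\,dt=0.$$ It is assumed that a (necessarily unique) weak solution $y^*\in X_r$ exists and that its time and space derivatives are bounded. $\mathbf{Y}\subset\mathbb{R}$ is a compact set containing $y^*([0,T]\times\overline{\Omega})$, and $\mathbf{Z}\subset\mathbb{R}\times\mathbb{R}^n$ is a compact set with $(\partial_t y^*(t,x),\nabla_x y^*(t,x))\in\mathbf{Z}$ for a.e. $(t,x)\in[0,T]\times\Omega$. Points of $\mathbf{Y}\times\mathbf{Z}$ are written $(y,z)$ with $z=(z_0,z_1,\dots,z_n)$ and $\overline{z}=(z_1,\dots,z_n)$. $C^1(\mathbf{Y})$ is the space of continuously differentiable functions on $\mathbf{Y}$ (restrictions to $\mathbf Y$ of $C^1$ functions on $\mathbb{R}$,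 together with their derivatives). Geometry: $Q_T=[0,T]\times\overline{\Omega}$; $\sigma$ is the surface measure on $\partial Q_T$ and $\eta=(\eta_0,\eta_1,\dots,\eta_n)$ the outward unit normal to $\partial Q_T$ ($\eta_0$ the time component). $\partial Q_1=\{0\}\times\overline{\Omega}$, $\partial Q_2=\{T\}\times\overline{\Omega}$, $\partial Q_3=[0,T]\times\partial\Omega$, and $\hat\mu_{\partial,i}$ is the restriction of $\hat\mu_\partial$ to $\partial Q_i\times\mathbf{Y}\times\mathbf{Z}$, so that $\hat\mu_\partial=\hat\mu_{\partial,1}+\hat\mu_{\partial,2}+\hat\mu_{\partial,3}$ when the $(t,x)$-marginal of $\hat\mu_\partial$ is $\sigma$. Occupation-measure identities: $(\hat\mu,\hat\mu_\partial)$ satisfies them if for every $\phi(t,x,y)=\varphi(t)v(x)\beta(y)$ with $\varphi\in C^\infty([0,T])$, $v\in H^1(\Omega)$, $\beta\in C^1(\mathbf{Y})$ the following hold (integrals over $Q_T\times\mathbf{Y}\times\mathbf{Z}$ for $\hat\mu$ and over $\partial Q_T\times\mathbf{Y}\times\mathbf{Z}$ for $\hat\mu_\partial$): (1) $\int[\partial_t\phi(t,x,y)+z_0\,\partial_y\phi(t,x,y)]\,d\hat\mu-\int\phi(t,x,y)\,\eta_0(t,x)\,d\hat\mu_\partial=0$; (2) for all $j\in\{1,\dots,n\}$, $\int[\partial_{x_j}\phi(t,x,y)+z_j\,\partial_y\phi(t,x,y)]\,d\hat\mu-\int\phi(t,x,y)\,\eta_j(t,x)\,d\hat\mu_\partial=0$;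 (3) $\int\bigl[\phi(t,x,y)(z_0-f(t,x,y))+\sum_{j=1}^n(\partial_{x_j}\phi(t,x,y)+z_j\,\partial_y\phi(t,x,y))z_j\bigr]\,d\hat\mu-\sum_{j=1}^n\int\phi(t,x,y)\,z_j\,\eta_j(t,x)\,d\hat\mu_\partial=0$; (4) $\int\bigl[\varphi(t)z_0^2-\tfrac12\varphi'(t)\|\overline{z}\|^2-\varphi(t)z_0f(t,x,y)\bigr]\,d\hat\mu+\int\tfrac12\varphi(t)\|\overline{z}\|^2\eta_0(t,x)\,d\hat\mu_\partial=0$; (5) $\int_{\partial Q_1\times\mathbf{Y}\times\mathbf{Z}}\phi(t,x,y)\,d\hat\mu_{\partial,1}=\int_\Omega\phi(0,x,y_0(x))\,dx$; (6) $\int_{\partial Q_3\times\mathbf{Y}\times\mathbf{Z}}\phi(t,x,y)\,d\hat\mu_{\partial,3}=\int_{[0,T]\times\partial\Omega}\phi(t,x,0)\,d\sigma(t,x)$; and (7) for all $\psi\in C^\infty(Q_T)$ and $i\in\{1,2,3\}$, $\int_{\partial Q_i\times\mathbf{Y}\times\mathbf{Z}}\psi(t,x)\,d\hat\mu_{\partial,i}=\int_{\partial Q_i}\psi\,d\sigma$. By (1), (2) and (7) the $(t,x)$-marginal of $\hat\mu$ is the Lebesgue measure on $Q_T$, so the disintegration theorem gives probability measures $\mu_{(t,x)}$ on $\mathbf{Y}\times\mathbf{Z}$, defined for a.e. $(t,x)\in Q_T$, with $d\hat\mu(t,x,y,z)=d\mu_{(t,x)}(y,z)\,dx\,dt$.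 Young measures: for $\mathbf{E}\subset\mathbb{R}^N$, a Young measure on $\mathbf{E}$ parametrized by $[0,T]\times\Omega$ is a map $(t,x)\mapsto\mu_{(t,x)}\in\mathcal{P}(\mathbf{E})$ (probability measures) such that for every bounded continuous $g:\mathbf{E}\to\mathbb{R}$ the map $(t,x)\mapsto\langle\mu_{(t,x)},g\rangle:=\int_{\mathbf{E}}g\,d\mu_{(t,x)}$ is measurable. For $p\ge1$ it has finite $p$-moments, written $\mu\in\mathcal{Y}^p([0,T]\times\Omega;\mathbf{E})$, if $(t,x)\mapsto\int_{\mathbf{E}}\|\xi\|^p\,d\mu_{(t,x)}(\xi)$ belongs to $L^1((0,T)\times\Omega)$. The bracket is extended to integrable $g$ and taken componentwise for vector-valued $g$; the $g$ may depend on $(t,x)$. Integration-by-parts formula: $\mu\in\mathcal{Y}^1$ satisfies it if for all $\beta\in C^1(\mathbf{Y})$ and $\psi\in C_c^\infty((0,T)\times\Omega)$, $$\int_0^T\!\!\int_\Omega\partial_t\psi\,\langle\mu_{(t,x)},\beta(y)\rangle\,dx\,dt=-\int_0^T\!\!\int_\Omega\psi\,\langle\mu_{(t,x)},z_0\beta'(y)\rangle\,dx\,dt,$$ $$\int_0^T\!\!\int_\Omega\nabla_x\psi\,\langle\mu_{(t,x)},\beta(y)\rangle\,dx\,dt=-\int_0^T\!\!\int_\Omega\psi\,\langle\mu_{(t,x)},\overline{z}\beta'(y)\rangle\,dx\,dt.$$ Moments: $m_1(t,x)=\langle\mu_{(t,x)},y\rangle$, $m_2(t,x)=\langle\mu_{(t,x)},y^2\rangle$,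 $m_f(t,x)=\langle\mu_{(t,x)},f(t,x,y)\rangle$, $\hat m_f(t,x)=2\langle\mu_{(t,x)},yf(t,x,y)\rangle-2\langle\mu_{(t,x)},\|\overline{z}\|^2\rangle$. If $\mu\in\mathcal{Y}^r$ satisfies the integration-by-parts formula, $m_1,m_2$ belong to $W^{1,r}((0,T)\times\Omega)$ and have representatives in $C([0,T];L^r(\Omega))\cap L^2(0,T;C(\overline{\Omega}))$, used for initial and boundary values. Emv solution: a Young measure $\mu\in\mathcal{Y}^r$ on $\mathbf{Y}\times(\mathbb{R}\times\mathbb{R}^n)$ (in particular one supported in $\mathbf{Y}\times\mathbf{Z}$, where $\mathbf{Z}\subset\mathbb{R}\times\mathbb{R}^n$ is the compact set with $(\partial_t y^*(t,x),\nabla_x y^*(t,x))\in\mathbf{Z}$ for a.e. $(t,x)\in[0,T]\times\Omega$) is an energy measure-valued (emv) solution if it satisfies the integration-by-parts formula and, for all $v\in H^1_0(\Omega)$ and $\varphi\in C_c^\infty((0,T))$: (a) $\int_0^T\int_\Omega\varphi(t)[v\,\partial_t m_1+\nabla_x v\cdot\nabla_x m_1-v\,m_f]\,dx\,dt=0$; $m_1(t,\cdot)=0$ on $\partial\Omega$ for a.e. $t\in[0,T]$; $m_1(0,\cdot)=y_0$ in $L^r(\Omega)$; (b) $\int_0^T\int_\Omega\varphi(t)[v\,\partial_t m_2+\nabla_x v\cdot\nabla_x m_2-v\,\hat m_f]\,dx\,dt=0$; $m_2(t,\cdot)=0$ on $\partial\Omega$ for a.e. $t\in[0,T]$; $m_2(0,\cdot)=y_0^2$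 in $L^r(\Omega)$; (c) $\int_0^T\int_\Omega\bigl(\varphi(t)\langle\mu_{(t,x)},z_0^2\rangle-\varphi'(t)\langle\mu_{(t,x)},\tfrac12\|\overline{z}\|^2\rangle-\varphi(t)\langle\mu_{(t,x)},z_0f(t,x,y)\rangle\bigr)\,dx\,dt=0$. *)

theory Defs
  imports "HOL-Analysis.Analysis"
begin

section \<open>Smooth functions and test functions\<close>

primrec Ck :: "nat \<Rightarrow> ('b::euclidean_space \<Rightarrow> real) \<Rightarrow> bool" where
  "Ck 0 f \<longleftrightarrow> continuous_on UNIV f"
| "Ck (Suc k) f \<longleftrightarrow> (\<forall>x. f differentiable (at x)) \<and>
     (\<forall>i\<in>Basis. Ck k (\<lambda>x. frechet_derivative f (at x) i))"

text \<open>Smooth functions on a closed set (an interval, or the space-time cylinder) are throughout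
  the restrictions of smooth functions on the whole space.\<close>

definition smooth :: "('b::euclidean_space \<Rightarrow> real) \<Rightarrow> bool" where
  "smooth f \<longleftrightarrow> (\<forall>k. Ck k f)"

definition test_fun :: "'b::euclidean_space set \<Rightarrow> ('b \<Rightarrow> real) \<Rightarrow> bool" where
  "test_fun U f \<longleftrightarrow>
     smooth f \<and> compact (closure {x. f x \<noteq> 0}) \<and> closure {x. f x \<noteq> 0} \<subseteq> U"

definition grad :: "('b::euclidean_space \<Rightarrow> real) \<Rightarrow> 'b \<Rightarrow> 'b" where
  "grad f x = (\<Sum>i\<in>Basis. frechet_derivative f (at x) i *\<^sub>R i)"


section \<open>Sobolev spaces\<close>

definition Lp :: "real \<Rightarrow> 'b::euclidean_space set \<Rightarrow> ('b \<Rightarrow> 'c::euclidean_space) \<Rightarrow> bool" where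
  "Lp p U u \<longleftrightarrow> u \<in> borel_measurable (lebesgue_on U) \<and>
     integrable (lebesgue_on U) (\<lambda>x. norm (u x) powr p)"

definition weak_gradient :: "'b::euclidean_space set \<Rightarrow> ('b \<Rightarrow> real) \<Rightarrow> ('b \<Rightarrow> 'b) \<Rightarrow> bool" where
  "weak_gradient U u G \<longleftrightarrow>
     (\<forall>K. compact K \<and> K \<subseteq> U \<longrightarrow> integrable (lebesgue_on K) u \<and> integrable (lebesgue_on K) G) \<and>
     (\<forall>\<psi> i. test_fun U \<psi> \<and> i \<in> Basis \<longrightarrow>
        (\<integral>x. (grad \<psi> x \<bullet> i) * u x \<partial>lebesgue_on U) = - (\<integral>x. \<psi> x * (G x \<bullet> i) \<partial>lebesgue_on U))"

text \<open>\<open>W1 p U u G\<close>: \<open>u\<close> lies in $W^{1,p}(U)$ and \<open>G\<close> is (a version of) its weak gradient;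
  \<open>W10 p U u G\<close>: the same with $W^{1,p}_0(U)$. Functions on space-time have type
  \<open>real \<times> 'a \<Rightarrow> real\<close>; the two components of their weak gradient are the time derivative and
  the spatial gradient.\<close>

definition W1 :: "real \<Rightarrow> 'b::euclidean_space set \<Rightarrow> ('b \<Rightarrow> real) \<Rightarrow> ('b \<Rightarrow> 'b) \<Rightarrow> bool" where
  "W1 p U u G \<longleftrightarrow> Lp p U u \<and> Lp p U G \<and> weak_gradient U u G"

definition W10 :: "real \<Rightarrow> 'b::euclidean_space set \<Rightarrow> ('b \<Rightarrow> real) \<Rightarrow> ('b \<Rightarrow> 'b) \<Rightarrow> bool" where
  "W10 p U u G \<longleftrightarrow> W1 p U u G \<and>
     (\<exists>\<psi>. (\<forall>k::nat. test_fun U (\<psi> k)) \<and>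
        (\<lambda>k. \<integral>x. \<bar>u x - \<psi> k x\<bar> powr p \<partial>lebesgue_on U) \<longlonglongrightarrow> 0 \<and>
        (\<lambda>k. \<integral>x. norm (G x - grad (\<psi> k) x) powr p \<partial>lebesgue_on U) \<longlonglongrightarrow> 0)"

definition sobolev_norm :: "real \<Rightarrow> 'b::euclidean_space set \<Rightarrow> ('b \<Rightarrow> real) \<Rightarrow> real" where
  "sobolev_norm p U u =
     (let G = (SOME G. weak_gradient U u G) in
      ((\<integral>x. \<bar>u x\<bar> powr p \<partial>lebesgue_on U) + (\<integral>x. norm (G x) powr p \<partial>lebesgue_on U)) powr (1 / p))"


section \<open>Domains, surface measure, outer normal, traces\<close>

definition lipschitz_boundary :: "'b::euclidean_space set \<Rightarrow> bool" where
  "lipschitz_boundary \<Omega> \<longleftrightarrow>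
     (\<forall>p\<in>frontier \<Omega>. \<exists>U e h L. open U \<and> p \<in> U \<and> norm e = 1 \<and> L-lipschitz_on UNIV (h :: 'b \<Rightarrow> real) \<and>
        \<Omega> \<inter> U = {x \<in> U. x \<bullet> e < h (x - (x \<bullet> e) *\<^sub>R e)})"

definition hausdorff_pre :: "nat \<Rightarrow> real \<Rightarrow> 'b::metric_space set \<Rightarrow> ennreal" where
  "hausdorff_pre s \<delta> A =
     (INF C\<in>{C :: nat \<Rightarrow> 'b set. A \<subseteq> (\<Union>k. C k) \<and> (\<forall>k. bounded (C k) \<and> diameter (C k) \<le> \<delta>)}.
        \<Sum>k. if C k = {} then 0 else ennreal (unit_ball_vol (real s) * (diameter (C k) / 2) ^ s))"

definition hausdorff_outer :: "nat \<Rightarrow> 'b::metric_space set \<Rightarrow> ennreal" where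
  "hausdorff_outer s A = (SUP \<delta>\<in>{0<..}. hausdorff_pre s \<delta> A)"

text \<open>The outer measure is a metric outer measure, hence countably additive on the Borel sets.
  With this normalisation the \<open>s\<close>-dimensional Hausdorff measure of a Lipschitz hypersurface
  (\<open>s\<close> one less than the dimension of the space) is its surface area; for \<open>s = 0\<close> it is
  the counting measure.\<close>

definition hausdorff_measure :: "nat \<Rightarrow> 'b::metric_space measure" where
  "hausdorff_measure s = measure_of UNIV (sets borel) (hausdorff_outer s)"

text \<open>Tangential approximation of \<open>A\<close> near \<open>p\<close> by the half-space with outer normal \<open>\<nu>\<close>.
  Where a boundary is the graph of a function, this amounts to differentiability of that function;
  for a Lipschitz boundary such a \<open>\<nu>\<close> exists at almost every boundary point.
  At the remaining points the normal field is set to \<open>0\<close>.\<close>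

definition is_outward_normal :: "'b::euclidean_space set \<Rightarrow> 'b \<Rightarrow> 'b \<Rightarrow> bool" where
  "is_outward_normal A p \<nu> \<longleftrightarrow> norm \<nu> = 1 \<and>
     (\<forall>\<epsilon>>0. \<exists>\<delta>>0. \<forall>q. dist q p < \<delta> \<longrightarrow>
        (\<nu> \<bullet> (q - p) > \<epsilon> * norm (q - p) \<longrightarrow> q \<notin> A) \<and>
        (\<nu> \<bullet> (q - p) < - \<epsilon> * norm (q - p) \<longrightarrow> q \<in> A))"

definition outward_normal :: "'b::euclidean_space set \<Rightarrow> 'b \<Rightarrow> 'b" where
  "outward_normal A p =
     (if \<exists>!\<nu>. is_outward_normal A p \<nu> then THE \<nu>. is_outward_normal A p \<nu> else 0)"

text \<open>\<open>H1_trace \<Omega> v G g\<close>: \<open>v\<close> lies in $H^1(\Omega)$ with weak gradient \<open>G\<close>, and \<open>g\<close> is a (Borel) version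
  of its boundary trace, the limit in $L^2(\partial\Omega)$ of the boundary values of smooth functions
  that converge to \<open>v\<close> in $H^1(\Omega)$.\<close>

definition H1_trace ::
  "'a::euclidean_space set \<Rightarrow> ('a \<Rightarrow> real) \<Rightarrow> ('a \<Rightarrow> 'a) \<Rightarrow> ('a \<Rightarrow> real) \<Rightarrow> bool" where
  "H1_trace \<Omega> v G g \<longleftrightarrow> W1 2 \<Omega> v G \<and> g \<in> borel_measurable borel \<and>
     (\<exists>u. (\<forall>k::nat. smooth (u k)) \<and>
        (\<lambda>k. \<integral>x. \<bar>v x - u k x\<bar> powr 2 \<partial>lebesgue_on \<Omega>) \<longlonglongrightarrow> 0 \<and>
        (\<lambda>k. \<integral>x. norm (G x - grad (u k) x) powr 2 \<partial>lebesgue_on \<Omega>) \<longlonglongrightarrow> 0 \<and>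
        (\<lambda>k. \<integral>\<^sup>+x. ennreal (\<bar>g x - u k x\<bar> powr 2) * indicator (frontier \<Omega>) x
           \<partial>hausdorff_measure (DIM('a) - 1)) \<longlonglongrightarrow> 0)"


section \<open>Bochner spaces\<close>

text \<open>\<open>bochner_L2 V N T u\<close>: \<open>u\<close> lies in $L^2(0,T;V)$, where \<open>V\<close> is a space of functions with
  norm \<open>N\<close>; the first conjunct is strong (Bochner) measurability.\<close>

definition bochner_L2 ::
  "(('a \<Rightarrow> real) \<Rightarrow> bool) \<Rightarrow> (('a \<Rightarrow> real) \<Rightarrow> real) \<Rightarrow> real \<Rightarrow> (real \<Rightarrow> 'a \<Rightarrow> real) \<Rightarrow> bool" where
  "bochner_L2 V N T u \<longleftrightarrow>
     (\<exists>s. (\<forall>k::nat. simple_function (lebesgue_on {0..T}) (s k) \<and> (\<forall>t\<in>{0..T}. V (s k t))) \<and>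
        (AE t in lebesgue_on {0..T}. V (u t) \<and> (\<lambda>k. N (\<lambda>x. s k t x - u t x)) \<longlonglongrightarrow> 0)) \<and>
     integrable (lebesgue_on {0..T}) (\<lambda>t. (N (u t))\<^sup>2)"

abbreviation L2_W10 ::
  "real \<Rightarrow> 'a::euclidean_space set \<Rightarrow> real \<Rightarrow> (real \<Rightarrow> 'a \<Rightarrow> real) \<Rightarrow> bool" where
  "L2_W10 T \<Omega> r \<equiv> bochner_L2 (\<lambda>w. \<exists>G. W10 r \<Omega> w G) (sobolev_norm r \<Omega>) T"

abbreviation L2_C ::
  "real \<Rightarrow> 'a::euclidean_space set \<Rightarrow> (real \<Rightarrow> 'a \<Rightarrow> real) \<Rightarrow> bool" where
  "L2_C T \<Omega> \<equiv> bochner_L2 (continuous_on (closure \<Omega>)) (\<lambda>w. SUP x\<in>closure \<Omega>. \<bar>w x\<bar>) T"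

definition C_Lp ::
  "real \<Rightarrow> 'a::euclidean_space set \<Rightarrow> real \<Rightarrow> (real \<Rightarrow> 'a \<Rightarrow> real) \<Rightarrow> bool" where
  "C_Lp T \<Omega> r m \<longleftrightarrow> (\<forall>t\<in>{0..T}. Lp r \<Omega> (m t)) \<and>
     (\<forall>s\<in>{0..T}. ((\<lambda>t. \<integral>x. \<bar>m t x - m s x\<bar> powr r \<partial>lebesgue_on \<Omega>) \<longlongrightarrow> 0) (at s within {0..T}))"

text \<open>\<open>X_space T \<Omega> r u G\<close>: \<open>u\<close> is the continuous representative of an element of
  $H^1(0,T;W^{1,r}_0(\Omega))$ and \<open>G\<close> is (a version of) its pair of time derivative and spatial
  gradient. The Bochner integrals in the definition of the weak time derivative are those of
  $L^r(\Omega)$-valued functions, hence can be evaluated at almost every \<open>x\<close>.\<close>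

definition X_space ::
  "real \<Rightarrow> 'a::euclidean_space set \<Rightarrow> real \<Rightarrow> (real \<times> 'a \<Rightarrow> real) \<Rightarrow> (real \<times> 'a \<Rightarrow> real \<times> 'a) \<Rightarrow> bool"
where
  "X_space T \<Omega> r u G \<longleftrightarrow>
     continuous_on ({0..T} \<times> closure \<Omega>) u \<and>
     G \<in> borel_measurable (lebesgue_on ({0..T} \<times> \<Omega>)) \<and>
     L2_W10 T \<Omega> r (\<lambda>t x. u (t, x)) \<and>
     L2_W10 T \<Omega> r (\<lambda>t x. fst (G (t, x))) \<and>
     (\<forall>\<phi>. test_fun {0<..<T} \<phi> \<longrightarrow>
        (AE x in lebesgue_on \<Omega>.
           (\<integral>t. deriv \<phi> t * u (t, x) \<partial>lebesgue_on {0..T}) =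
           - (\<integral>t. \<phi> t * fst (G (t, x)) \<partial>lebesgue_on {0..T}))) \<and>
     (AE t in lebesgue_on {0..T}. weak_gradient \<Omega> (\<lambda>x. u (t, x)) (\<lambda>x. snd (G (t, x))))"


section \<open>The PDE\<close>

text \<open>The suprema over \<open>K\<close> are essential in \<open>(t, x)\<close>, pointwise in the state variable.\<close>

definition admissible_rhs ::
  "real \<Rightarrow> 'a::euclidean_space set \<Rightarrow> (real \<Rightarrow> 'a \<Rightarrow> real \<Rightarrow> real) \<Rightarrow> bool" where
  "admissible_rhs T \<Omega> f \<longleftrightarrow>
     (\<forall>y. (\<lambda>(t, x). f t x y) \<in> borel_measurable (lebesgue_on ({0..T} \<times> \<Omega>))) \<and>
     (AE (t, x) in lebesgue_on ({0..T} \<times> \<Omega>). continuous_on UNIV (f t x)) \<and>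
     (\<forall>K. compact K \<longrightarrow> (\<exists>M\<ge>0. AE (t, x) in lebesgue_on ({0..T} \<times> \<Omega>). \<forall>y\<in>K. \<bar>f t x y\<bar> \<le> M)) \<and>
     (\<forall>K. compact K \<longrightarrow> (\<exists>L\<ge>0. AE (t, x) in lebesgue_on ({0..T} \<times> \<Omega>).
        \<forall>u\<in>K. \<forall>v\<in>K. (u - v) * (f t x u - f t x v) \<le> L * (u - v)\<^sup>2))"

definition weak_solution ::
  "real \<Rightarrow> 'a::euclidean_space set \<Rightarrow> real \<Rightarrow> (real \<Rightarrow> 'a \<Rightarrow> real \<Rightarrow> real) \<Rightarrow> ('a \<Rightarrow> real) \<Rightarrow>
   (real \<times> 'a \<Rightarrow> real) \<Rightarrow> (real \<times> 'a \<Rightarrow> real \<times> 'a) \<Rightarrow> bool" where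
  "weak_solution T \<Omega> r f y0 u G \<longleftrightarrow>
     X_space T \<Omega> r u G \<and> (\<forall>x\<in>\<Omega>. u (0, x) = y0 x) \<and>
     (\<forall>v Dv \<phi>. W10 2 \<Omega> v Dv \<and> test_fun {0<..<T} \<phi> \<longrightarrow>
        (\<integral>(t, x). \<phi> t * (v x * fst (G (t, x)) + Dv x \<bullet> snd (G (t, x)) - v x * f t x (u (t, x)))
           \<partial>lebesgue_on ({0..T} \<times> \<Omega>)) = 0)"


section \<open>Measures, Young measures, disintegration\<close>

text \<open>Measures on a closed subset \<open>E\<close> of a Euclidean space are represented by Borel measures on
  the whole space that vanish outside \<open>E\<close>.\<close>

definition finite_borel_measure_on :: "'b::topological_space set \<Rightarrow> 'b measure \<Rightarrow> bool" where
  "finite_borel_measure_on E M \<longleftrightarrow> sets M = sets borel \<and> finite_measure M \<and> emeasure M (- E) = 0"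

definition prob_measure_on :: "'b::topological_space set \<Rightarrow> 'b measure \<Rightarrow> bool" where
  "prob_measure_on E M \<longleftrightarrow> sets M = sets borel \<and> emeasure M UNIV = 1 \<and> emeasure M (- E) = 0"

definition young_measure ::
  "'b::euclidean_space set \<Rightarrow> 'c::euclidean_space set \<Rightarrow> ('b \<Rightarrow> 'c measure) \<Rightarrow> bool" where
  "young_measure D E \<mu> \<longleftrightarrow>
     (\<forall>p\<in>D. prob_measure_on E (\<mu> p)) \<and>
     (\<forall>g. continuous_on E g \<and> bounded (g ` E) \<longrightarrow>
        (\<lambda>p. \<integral>\<xi>\<in>E. (g \<xi> :: real) \<partial>\<mu> p) \<in> borel_measurable (lebesgue_on D))"

definition finite_moments ::
  "real \<Rightarrow> 'b::euclidean_space set \<Rightarrow> ('b \<Rightarrow> 'c::euclidean_space measure) \<Rightarrow> bool" where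
  "finite_moments p D \<mu> \<longleftrightarrow>
     (\<lambda>q. \<integral>\<^sup>+\<xi>. ennreal (norm \<xi> powr p) \<partial>\<mu> q) \<in> borel_measurable (lebesgue_on D) \<and>
     (\<integral>\<^sup>+q. (\<integral>\<^sup>+\<xi>. ennreal (norm \<xi> powr p) \<partial>\<mu> q) \<partial>lebesgue_on D) < \<infinity>"

text \<open>\<open>d M(p, \<xi>) = d (\<mu> p)(\<xi>) dp\<close>, where \<open>p\<close> ranges over \<open>D\<close> and the \<open>\<mu> p\<close> are
  probability measures on \<open>E\<close>. This is used with \<open>D = {0..T} \<times> \<Omega>\<close> for a measure on
  \<open>{0..T} \<times> closure \<Omega>\<close>; the boundary of \<open>\<Omega>\<close> is Lipschitz and therefore a null set.\<close>

definition disintegration ::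
  "'b::euclidean_space set \<Rightarrow> 'c::euclidean_space set \<Rightarrow> ('b \<times> 'c) measure \<Rightarrow> ('b \<Rightarrow> 'c measure) \<Rightarrow> bool"
where
  "disintegration D E M \<mu> \<longleftrightarrow>
     (\<forall>p\<in>D. prob_measure_on E (\<mu> p)) \<and>
     (\<forall>B\<in>sets borel. (\<lambda>p. emeasure (\<mu> p) B) \<in> borel_measurable (lebesgue_on D)) \<and>
     (\<forall>C\<in>sets borel. emeasure M C = (\<integral>\<^sup>+p. emeasure (\<mu> p) {\<xi>. (p, \<xi>) \<in> C} \<partial>lebesgue_on D))"


section \<open>Occupation-measure identities\<close>

abbreviation QT :: "real \<Rightarrow> 'a::euclidean_space set \<Rightarrow> (real \<times> 'a) set" where
  "QT T \<Omega> \<equiv> {0..T} \<times> closure \<Omega>"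

definition bdQ :: "nat \<Rightarrow> real \<Rightarrow> 'a::euclidean_space set \<Rightarrow> (real \<times> 'a) set" where
  "bdQ i T \<Omega> = (if i = 1 then {0} \<times> closure \<Omega> else if i = 2 then {T} \<times> closure \<Omega> else {0..T} \<times> frontier \<Omega>)"

text \<open>A state \<open>((t, x), y, z0, z)\<close> consists of the point \<open>(t, x)\<close>, the value \<open>y\<close>, and the
  derivatives \<open>z0\<close> (in time) and \<open>z\<close> (in space). In \<open>\<phi> t * w x * \<beta> y\<close> the function \<open>w\<close> is \<open>v\<close>
  inside the domain and its trace \<open>g\<close> on the boundary. Integrals are taken with respect to
  completed measures since \<open>v\<close>, its gradient and \<open>f\<close> are only Lebesgue measurable
  in \<open>(t, x)\<close>. The test functions \<open>\<beta>\<close> on the compact set of states are restrictions, together with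
  their derivatives, of C1 functions on the real line.\<close>

definition occupation_identities ::
  "real \<Rightarrow> 'a::euclidean_space set \<Rightarrow> (real \<Rightarrow> 'a \<Rightarrow> real \<Rightarrow> real) \<Rightarrow> ('a \<Rightarrow> real) \<Rightarrow>
   ((real \<times> 'a) \<times> real \<times> real \<times> 'a) measure \<Rightarrow> ((real \<times> 'a) \<times> real \<times> real \<times> 'a) measure \<Rightarrow> bool" where
  "occupation_identities T \<Omega> f y0 M Mb \<longleftrightarrow>
    (let \<sigma> = hausdorff_measure DIM('a) :: (real \<times> 'a) measure;
         \<eta> = outward_normal (QT T \<Omega>) in
     (\<forall>\<phi> v G g \<beta>. smooth \<phi> \<and> H1_trace \<Omega> v G g \<and> \<beta> C1_differentiable_on UNIV \<longrightarrow>
       (let w = (\<lambda>x. if x \<in> \<Omega> then v x else g x) in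
        (\<integral>((t, x), y, z0, z). deriv \<phi> t * w x * \<beta> y + z0 * (\<phi> t * w x * deriv \<beta> y) \<partial>completion M)
          - (\<integral>((t, x), y, z0, z). \<phi> t * w x * \<beta> y * fst (\<eta> (t, x)) \<partial>completion Mb) = 0 \<and>
        (\<forall>j\<in>Basis.
          (\<integral>((t, x), y, z0, z). \<phi> t * (G x \<bullet> j) * \<beta> y + (z \<bullet> j) * (\<phi> t * w x * deriv \<beta> y) \<partial>completion M)
            - (\<integral>((t, x), y, z0, z). \<phi> t * w x * \<beta> y * (snd (\<eta> (t, x)) \<bullet> j) \<partial>completion Mb) = 0) \<and>
        (\<integral>((t, x), y, z0, z). \<phi> t * w x * \<beta> y * (z0 - f t x y)
              + (\<Sum>j\<in>Basis. (\<phi> t * (G x \<bullet> j) * \<beta> y + (z \<bullet> j) * (\<phi> t * w x * deriv \<beta> y)) * (z \<bullet> j))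
              \<partial>completion M)
          - (\<Sum>j\<in>Basis. \<integral>((t, x), y, z0, z). \<phi> t * w x * \<beta> y * (z \<bullet> j) * (snd (\<eta> (t, x)) \<bullet> j)
              \<partial>completion Mb) = 0 \<and>
        (\<integral>((t, x), y, z0, z)\<in>bdQ 1 T \<Omega> \<times> UNIV. \<phi> t * w x * \<beta> y \<partial>completion Mb)
          = (\<integral>x. \<phi> 0 * v x * \<beta> (y0 x) \<partial>lebesgue_on \<Omega>) \<and>
        (\<integral>((t, x), y, z0, z)\<in>bdQ 3 T \<Omega> \<times> UNIV. \<phi> t * w x * \<beta> y \<partial>completion Mb)
          = (\<integral>(t, x)\<in>bdQ 3 T \<Omega>. \<phi> t * g x * \<beta> 0 \<partial>\<sigma>))) \<and>
     (\<forall>\<phi>. smooth \<phi> \<longrightarrow>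
        (\<integral>((t, x), y, z0, z). \<phi> t * z0\<^sup>2 - 1/2 * deriv \<phi> t * (norm z)\<^sup>2 - \<phi> t * z0 * f t x y \<partial>completion M)
          + (\<integral>((t, x), y, z0, z). 1/2 * \<phi> t * (norm z)\<^sup>2 * fst (\<eta> (t, x)) \<partial>completion Mb) = 0) \<and>
     (\<forall>\<psi>. smooth \<psi> \<longrightarrow> (\<forall>i\<in>{1,2,3}.
        (\<integral>(p, y, z0, z)\<in>bdQ i T \<Omega> \<times> UNIV. \<psi> p \<partial>completion Mb) = (\<integral>p\<in>bdQ i T \<Omega>. \<psi> p \<partial>\<sigma>))))"


section \<open>Energy measure-valued solutions\<close>

definition integration_by_parts ::
  "real \<Rightarrow> 'a::euclidean_space set \<Rightarrow> (real \<times> 'a \<Rightarrow> (real \<times> real \<times> 'a) measure) \<Rightarrow> bool" where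
  "integration_by_parts T \<Omega> \<mu> \<longleftrightarrow>
     (\<forall>\<beta> \<psi>. \<beta> C1_differentiable_on UNIV \<and> test_fun ({0<..<T} \<times> \<Omega>) \<psi> \<longrightarrow>
        (\<integral>p. fst (grad \<psi> p) * (\<integral>(y, z0, z). \<beta> y \<partial>\<mu> p) \<partial>lebesgue_on ({0..T} \<times> \<Omega>))
          = - (\<integral>p. \<psi> p * (\<integral>(y, z0, z). z0 * deriv \<beta> y \<partial>\<mu> p) \<partial>lebesgue_on ({0..T} \<times> \<Omega>)) \<and>
        (\<forall>j\<in>Basis.
          (\<integral>p. (snd (grad \<psi> p) \<bullet> j) * (\<integral>(y, z0, z). \<beta> y \<partial>\<mu> p) \<partial>lebesgue_on ({0..T} \<times> \<Omega>))
            = - (\<integral>p. \<psi> p * (\<integral>(y, z0, z). (z \<bullet> j) * deriv \<beta> y \<partial>\<mu> p) \<partial>lebesgue_on ({0..T} \<times> \<Omega>))))"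

text \<open>Initial and boundary values of \<open>m\<close>, read off from a representative in
  $C([0,T];L^r(\Omega)) \cap L^2(0,T;C(\overline\Omega))$: homogeneous Dirichlet boundary values and
  initial value \<open>w\<close>.\<close>

definition attains_data ::
  "real \<Rightarrow> 'a::euclidean_space set \<Rightarrow> real \<Rightarrow> (real \<times> 'a \<Rightarrow> real) \<Rightarrow> ('a \<Rightarrow> real) \<Rightarrow> bool" where
  "attains_data T \<Omega> r m w \<longleftrightarrow>
     (\<exists>m'. (AE (t, x) in lebesgue_on ({0..T} \<times> \<Omega>). m' t x = m (t, x)) \<and>
        C_Lp T \<Omega> r m' \<and> L2_C T \<Omega> m' \<and>
        (AE t in lebesgue_on {0..T}. \<forall>x\<in>frontier \<Omega>. m' t x = 0) \<and>
        (AE x in lebesgue_on \<Omega>. m' 0 x = w x))"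

definition moment_equation ::
  "real \<Rightarrow> 'a::euclidean_space set \<Rightarrow> real \<Rightarrow>
   (real \<times> 'a \<Rightarrow> real) \<Rightarrow> (real \<times> 'a \<Rightarrow> real) \<Rightarrow> ('a \<Rightarrow> real) \<Rightarrow> bool" where
  "moment_equation T \<Omega> r m h w \<longleftrightarrow>
     (\<exists>G. W1 r ({0<..<T} \<times> \<Omega>) m G \<and>
        (\<forall>v Dv \<phi>. W10 2 \<Omega> v Dv \<and> test_fun {0<..<T} \<phi> \<longrightarrow>
          (\<integral>(t, x). \<phi> t * (v x * fst (G (t, x)) + Dv x \<bullet> snd (G (t, x)) - v x * h (t, x))
             \<partial>lebesgue_on ({0..T} \<times> \<Omega>)) = 0)) \<and>
     attains_data T \<Omega> r m w"

definition emv_solution ::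
  "real \<Rightarrow> 'a::euclidean_space set \<Rightarrow> real \<Rightarrow> real set \<Rightarrow> (real \<Rightarrow> 'a \<Rightarrow> real \<Rightarrow> real) \<Rightarrow> ('a \<Rightarrow> real) \<Rightarrow>
   (real \<times> 'a \<Rightarrow> (real \<times> real \<times> 'a) measure) \<Rightarrow> bool" where
  "emv_solution T \<Omega> r Y f y0 \<mu> \<longleftrightarrow>
     young_measure ({0..T} \<times> \<Omega>) (Y \<times> UNIV) \<mu> \<and>
     finite_moments r ({0..T} \<times> \<Omega>) \<mu> \<and>
     integration_by_parts T \<Omega> \<mu> \<and>
     moment_equation T \<Omega> r
       (\<lambda>p. \<integral>(y, z0, z). y \<partial>\<mu> p)
       (\<lambda>(t, x). \<integral>(y, z0, z). f t x y \<partial>\<mu> (t, x)) y0 \<and>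
     moment_equation T \<Omega> r
       (\<lambda>p. \<integral>(y, z0, z). y\<^sup>2 \<partial>\<mu> p)
       (\<lambda>(t, x). 2 * (\<integral>(y, z0, z). y * f t x y \<partial>\<mu> (t, x)) - 2 * (\<integral>(y, z0, z). (norm z)\<^sup>2 \<partial>\<mu> (t, x)))
       (\<lambda>x. (y0 x)\<^sup>2) \<and>
     (\<forall>\<phi>. test_fun {0<..<T} \<phi> \<longrightarrow>
        (\<integral>(t, x). \<phi> t * (\<integral>(y, z0, z). z0\<^sup>2 \<partial>\<mu> (t, x))
            - deriv \<phi> t * (\<integral>(y, z0, z). 1/2 * (norm z)\<^sup>2 \<partial>\<mu> (t, x))
            - \<phi> t * (\<integral>(y, z0, z). z0 * f t x y \<partial>\<mu> (t, x)) \<partial>lebesgue_on ({0..T} \<times> \<Omega>)) = 0)"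

end

theory Submission
  imports Defs "HOL-Probability.Giry_Monad"
begin

text \<open>Integrating the fibre variables out of the occupation-measure identities turns them into weak
  equations for the fibre means \<open>\<langle>\<beta>(y)\<rangle>\<close>. In the interior this is immediate, and the substance of
  the proof is to read off initial and boundary values.

  With test functions that are compactly supported in time and space the boundary measure
  disappears, and the first two identities say that \<open>\<langle>\<beta>(y)\<rangle>\<close> has the weak gradient
  \<open>\<langle>(z0, z) \<beta>'(y)\<rangle>\<close>. The identities provide only products \<open>\<phi>(t) v(x)\<close> as test functions; these
  suffice, because a product of mollifiers is a mollifier and translated mollifiers determine a
  weak derivative (\<open>weak_gradient_from_tensor_products\<close>).

  The identity on the lateral boundary with \<open>\<beta>(y) = y\<^sup>2\<close> forces \<open>y = 0\<close> there
  (\<open>lateral_value_zero\<close>). So if \<open>\<beta>(0) = 0\<close>, the boundary terms vanish for every spatial test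
  function, whether or not it vanishes on the boundary of \<open>\<Omega>\<close>: the extension of \<open>\<langle>\<beta>(y)\<rangle>\<close> by zero
  has a bounded weak gradient on the whole strip \<open>(0,T) \<times> \<real>\<^sup>n\<close>. A function with bounded weak gradient
  on a convex open set has a Lipschitz representative
  (\<open>bounded_weak_gradient_lipschitz_representative\<close>). It is zero outside the closure of \<open>\<Omega>\<close>; since
  the boundary is Lipschitz, the exterior accumulates at each boundary point, and the boundary values
  are zero (\<open>mean_lipschitz_representative\<close>). The initial values come from the first identity with
  time factors concentrated near \<open>t = 0\<close>, whose boundary term is given by the fifth one
  (\<open>mean_initial_value\<close>).

  The third identity, applied with \<open>\<beta>'\<close> in place of \<open>\<beta>\<close>, is the equation satisfied by \<open>\<langle>\<beta>(y)\<rangle>\<close>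
  (\<open>mean_moment_equation\<close>); \<open>\<beta>(y) = y\<close> and \<open>\<beta>(y) = y\<^sup>2\<close> are the two moment equations. The energy
  identity is the fourth one, whose boundary term vanishes because the normal has no time component
  on the lateral boundary and the test function is zero at the initial and final times.

  All integrals against \<open>M\<close> are reduced to the fibres by \<open>integral_disintegration\<close>. The test
  functions and the right-hand side are only Lebesgue measurable in \<open>(t, x)\<close>, so the disintegration
  formula is needed for the completion of \<open>M\<close>.\<close>

section \<open>Smooth functions and mollifiers\<close>

lemma Ck_SucD: "Ck (Suc k) f \<Longrightarrow> Ck k f"
proof (induction k arbitrary: f)
  case 0
  then show ?case
    by (auto simp: continuous_at_imp_continuous_on differentiable_imp_continuous_within)
next
  case (Suc k)
  from Suc.prems have "\<forall>i\<in>Basis. Ck (Suc k) (\<lambda>x. frechet_derivative f (at x) i)"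
    by (subst (asm) Ck.simps) blast
  with Suc.IH have "\<forall>i\<in>Basis. Ck k (\<lambda>x. frechet_derivative f (at x) i)"
    by blast
  with Suc.prems show ?case by simp
qed

lemma Ck_SucI:
  assumes "\<And>x. (f has_derivative f' x) (at x)" and "\<And>i. i \<in> Basis \<Longrightarrow> Ck k (\<lambda>x. f' x i)"
  shows "Ck (Suc k) f"
proof -
  have "frechet_derivative f (at x) = f' x" for x
    using frechet_derivative_at[OF assms(1)] by metis
  with assms show ?thesis by (auto simp: differentiable_def)
qed

lemma Ck_Suc_has_derivative:
  "Ck (Suc k) f \<Longrightarrow> (f has_derivative frechet_derivative f (at x)) (at x)"
  by (simp add: frechet_derivative_works[symmetric])

lemma Ck_const: "Ck k (\<lambda>x. c)"
proof (induction k arbitrary: c)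
  case (Suc k)
  then show ?case
    by (intro Ck_SucI[where f'="\<lambda>x h. 0"]) auto
qed simp

lemma Ck_add: "Ck k f \<Longrightarrow> Ck k g \<Longrightarrow> Ck k (\<lambda>x. f x + g x)"
proof (induction k arbitrary: f g)
  case (Suc k)
  show ?case
    by (rule Ck_SucI[where f'="\<lambda>x h. frechet_derivative f (at x) h + frechet_derivative g (at x) h"])
       (use Suc in \<open>auto intro!: has_derivative_add Ck_Suc_has_derivative\<close>)
qed (auto intro: continuous_intros)

lemma Ck_mult: "Ck k f \<Longrightarrow> Ck k g \<Longrightarrow> Ck k (\<lambda>x. f x * g x)"
proof (induction k arbitrary: f g)
  case (Suc k)
  have "Ck k f" "Ck k g"
    using Suc.prems Ck_SucD by blast+
  moreover have "Ck k (\<lambda>x. frechet_derivative f (at x) i)" "Ck k (\<lambda>x. frechet_derivative g (at x) i)"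
    if "i \<in> Basis" for i
    using Suc.prems that by auto
  ultimately show ?case
    by (intro Ck_SucI[where f'="\<lambda>x h. f x * frechet_derivative g (at x) h + frechet_derivative f (at x) h * g x"]
              has_derivative_mult Ck_add Suc.IH)
       (use Suc.prems in \<open>auto intro!: Ck_Suc_has_derivative simp del: Ck.simps\<close>)
qed (auto intro: continuous_intros)

lemma Ck_sum: "(\<And>i. i \<in> I \<Longrightarrow> Ck k (f i)) \<Longrightarrow> Ck k (\<lambda>x. \<Sum>i\<in>I. f i x)"
  by (induction I rule: infinite_finite_induct) (auto intro!: Ck_add Ck_const simp del: Ck.simps)

lemma Ck_affine: "Ck k f \<Longrightarrow> Ck k (\<lambda>x. f (s *\<^sub>R x + c))"
proof (induction k arbitrary: f)
  case 0
  then show ?case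
    by (auto intro!: continuous_on_compose2[of UNIV f] continuous_intros)
next
  case (Suc k)
  have D: "((\<lambda>x. f (s *\<^sub>R x + c)) has_derivative
         (\<lambda>h. frechet_derivative f (at (s *\<^sub>R x + c)) (s *\<^sub>R h))) (at x)" for x
    by (rule has_derivative_compose[of "\<lambda>x. s *\<^sub>R x + c" "\<lambda>h. s *\<^sub>R h"])
       (auto intro!: derivative_eq_intros Ck_Suc_has_derivative[OF Suc.prems])
  have lin: "linear (frechet_derivative f (at x))" for x
    using Ck_Suc_has_derivative[OF Suc.prems] has_derivative_linear by blast
  show ?case
    apply (rule Ck_SucI[OF D])
    apply (subst linear_scale[OF lin])
    apply (simp only: real_scaleR_def)
    apply (rule Ck_mult[OF Ck_const])
    apply (rule Suc.IH)
    using Suc.prems by simp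
qed

lemma smooth_const: "smooth (\<lambda>x. c)"
  by (simp add: smooth_def Ck_const)

lemma smooth_mult: "smooth f \<Longrightarrow> smooth g \<Longrightarrow> smooth (\<lambda>x. f x * g x)"
  by (simp add: smooth_def Ck_mult)

lemma smooth_add: "smooth f \<Longrightarrow> smooth g \<Longrightarrow> smooth (\<lambda>x. f x + g x)"
  by (simp add: smooth_def Ck_add)

lemma smooth_diff:
  assumes "smooth f" "smooth g"
  shows "smooth (\<lambda>x. f x - g x)"
  using smooth_add[OF assms(1) smooth_mult[OF smooth_const[of "-1"] assms(2)]] by simp

lemma smooth_sum: "(\<And>i. i \<in> I \<Longrightarrow> smooth (f i)) \<Longrightarrow> smooth (\<lambda>x. \<Sum>i\<in>I. f i x)"
  by (auto simp add: smooth_def intro: Ck_sum)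

lemma smooth_translate: "smooth f \<Longrightarrow> smooth (\<lambda>x. f (x - c))"
  unfolding smooth_def using Ck_affine[of _ f 1 "-c"] by simp

lemma smooth_has_derivative:
  "smooth f \<Longrightarrow> (f has_derivative frechet_derivative f (at x)) (at x)"
  using Ck_Suc_has_derivative[of 0 f] by (auto simp: smooth_def simp del: Ck.simps)

lemma smooth_continuous_on: "smooth f \<Longrightarrow> continuous_on A f"
  using continuous_on_subset unfolding smooth_def by (metis Ck.simps(1) subset_UNIV)

lemma smooth_deriv_basis:
  assumes "smooth f" "i \<in> Basis"
  shows "smooth (\<lambda>x. frechet_derivative f (at x) i)"
  unfolding smooth_def
proof
  fix k
  from assms(1) have "Ck (Suc k) f" by (auto simp: smooth_def simp del: Ck.simps)
  then show "Ck k (\<lambda>x. frechet_derivative f (at x) i)" using assms(2) by simp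
qed

lemma frechet_derivative_eq_grad:
  assumes "f differentiable (at x)"
  shows "frechet_derivative f (at x) h = grad f x \<bullet> h"
proof -
  interpret linear "frechet_derivative f (at x)"
    using assms linear_frechet_derivative by blast
  have "frechet_derivative f (at x) h = frechet_derivative f (at x) (\<Sum>i\<in>Basis. (h \<bullet> i) *\<^sub>R i)"
    by (simp add: euclidean_representation)
  also have "\<dots> = grad f x \<bullet> h"
    by (simp add: sum scale grad_def inner_sum_right inner_commute mult.commute)
  finally show ?thesis .
qed

lemma smooth_has_grad: "smooth f \<Longrightarrow> (f has_derivative (\<lambda>h. grad f x \<bullet> h)) (at x)"
  using smooth_has_derivative[of f x] frechet_derivative_eq_grad[of f x]
  by (metis (no_types, lifting) differentiableI has_derivative_eq_rhs ext)

lemma has_derivative_imp_grad_eq: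
  assumes "(f has_derivative (\<lambda>h. g \<bullet> h)) (at x)"
  shows "grad f x = g"
  unfolding grad_def frechet_derivative_at[OF assms, symmetric] by (rule euclidean_representation)

lemma smooth_continuous_grad: "smooth f \<Longrightarrow> continuous_on A (grad f)"
  unfolding grad_def by (intro continuous_intros smooth_continuous_on smooth_deriv_basis)

lemma smooth_DERIV: "smooth (f :: real \<Rightarrow> real) \<Longrightarrow> (f has_real_derivative deriv f x) (at x)"
  using smooth_has_derivative[of f x]
  by (metis DERIV_deriv_iff_real_differentiable differentiableI)

lemma deriv_eq_frechet: "smooth (f :: real \<Rightarrow> real) \<Longrightarrow> deriv f x = frechet_derivative f (at x) 1"
  using smooth_DERIV[of f x] frechet_derivative_at
  by (metis has_field_derivative_def mult.right_neutral)

lemma smooth_deriv: "smooth (f :: real \<Rightarrow> real) \<Longrightarrow> smooth (deriv f)"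
  using smooth_deriv_basis[of f 1] by (simp add: deriv_eq_frechet[of f, symmetric])

lemma smooth_compose_real:
  assumes "smooth (g :: real \<Rightarrow> real)" "smooth f"
  shows "smooth (\<lambda>x. g (f x))"
proof -
  have "Ck k f \<Longrightarrow> smooth g \<Longrightarrow> Ck k (\<lambda>x. g (f x))" for k and g :: "real \<Rightarrow> real"
  proof (induction k arbitrary: g)
    case 0
    then show ?case
      by simp (metis continuous_on_compose2 smooth_continuous_on subset_UNIV)
  next
    case (Suc k)
    have "((\<lambda>x. g (f x)) has_derivative (\<lambda>h. frechet_derivative f (at x) h * deriv g (f x))) (at x)" for x
      using has_derivative_compose[OF Ck_Suc_has_derivative[OF Suc.prems(1)]
          smooth_DERIV[OF Suc.prems(2), unfolded has_field_derivative_def]]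
      by (simp add: mult.commute)
    then show ?case
      by (rule Ck_SucI)
         (use Suc in \<open>auto intro!: Ck_mult Suc.IH smooth_deriv Ck_SucD[OF Suc.prems(1)]\<close>)
  qed
  then show ?thesis
    using assms by (auto simp: smooth_def)
qed

text \<open>Differentiating \<open>exp (- 1 / s)\<close> produces powers of \<open>1 / s\<close>; the derivative of each member of this
  family is a combination of members, so that smoothness can be proved for all of them at once.\<close>

definition flat :: "nat \<Rightarrow> real \<Rightarrow> real" where
  "flat n s = (if s > 0 then exp (- 1 / s) / s ^ n else 0)"

text \<open>The exponential of \<open>1 / s\<close> dominates the term of order \<open>n + 1\<close> of its series. Since
  \<open>flat n h / h = flat (Suc n) h\<close>, the bound makes all difference quotients at \<open>0\<close> tend to \<open>0\<close>.\<close>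

lemma flat_bound: "\<bar>flat n s\<bar> \<le> fact (Suc n) * \<bar>s\<bar>"
proof (cases "s > 0")
  case True
  have "(\<Sum>k\<in>{Suc n}. inverse (fact k) * (1/s) ^ k) \<le> (\<Sum>k. inverse (fact k) * (1/s) ^ k)"
    using True by (intro sum_le_suminf summable_exp) auto
  then have "(1/s) ^ Suc n / fact (Suc n) \<le> exp (1 / s)"
    by (simp add: exp_def divide_inverse mult.commute del: power_Suc fact_Suc)
  then have "1 \<le> exp (1/s) * (fact (Suc n) * s ^ Suc n)"
    using True by (simp add: field_simps power_divide del: fact_Suc)
  then have "exp (-1/s) \<le> fact (Suc n) * s ^ Suc n"
    by (simp add: exp_minus field_simps del: fact_Suc power_Suc)
  then have "exp (-1/s) / s ^ n \<le> fact (Suc n) * s"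
    using True by (simp add: field_simps del: fact_Suc)
  then show ?thesis using True by (simp add: flat_def del: fact_Suc)
next
  case False
  moreover have "0 \<le> fact (Suc n) * \<bar>s\<bar>" by (intro mult_nonneg_nonneg) simp_all
  ultimately show ?thesis by (simp only: flat_def if_False abs_zero)
qed

lemma flat_DERIV: "(flat n has_real_derivative flat (n + 2) s - n * flat (Suc n) s) (at s)"
proof -
  consider "s > 0" | "s < 0" | "s = 0" by linarith
  then show ?thesis
  proof cases
    case 1
    have "((\<lambda>s. exp (- 1 / s) / s ^ n) has_real_derivative
        flat (n + 2) s - n * flat (Suc n) s) (at s)"
      using 1 by (auto intro!: derivative_eq_intros simp: flat_def field_simps power2_eq_square)
         (cases n; simp add: field_simps power_add power2_eq_square)
    then show ?thesis
      by (rule has_field_derivative_transform_within_open[where S="{0<..}"]) (use 1 in \<open>auto simp: flat_def\<close>)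
  next
    case 2
    have "((\<lambda>s. 0) has_real_derivative flat (n + 2) s - n * flat (Suc n) s) (at s)"
      using 2 by (simp add: flat_def)
    then show ?thesis
      by (rule has_field_derivative_transform_within_open[where S="{..<0}"]) (use 2 in \<open>auto simp: flat_def\<close>)
  next
    case 3
    have lim0: "((\<lambda>h. fact (Suc (Suc n)) * \<bar>h\<bar>) \<longlongrightarrow> (0::real)) (at 0)"
      by (auto intro!: tendsto_eq_intros)
    have quot: "flat n h / h = flat (Suc n) h" for h
      by (simp add: flat_def)
    have b: "norm (flat (Suc n) h) \<le> fact (Suc (Suc n)) * \<bar>h\<bar>" for h
      using flat_bound[of "Suc n" h] by (simp only: real_norm_def)
    have "(flat (Suc n) \<longlongrightarrow> 0) (at 0)"
      by (intro Lim_null_comparison[OF always_eventually[OF allI[OF b]] lim0])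
    then have "((\<lambda>h. flat n h / h) \<longlongrightarrow> 0) (at 0)"
      by (simp only: quot)
    then show ?thesis
      using 3 by (simp add: DERIV_def flat_def)
  qed
qed

lemma smooth_flat: "smooth (flat n)"
proof -
  have "Ck k (flat n)" for k
  proof (induction k arbitrary: n)
    case 0
    then show ?case
      using flat_DERIV by (auto intro!: continuous_at_imp_continuous_on DERIV_isCont)
  next
    case (Suc k)
    show ?case
    proof (rule Ck_SucI)
      show "(flat n has_derivative (*) (flat (n + 2) s - n * flat (Suc n) s)) (at s)" for s
        using flat_DERIV[of n s] by (simp add: has_field_derivative_def)
      have "Ck k (\<lambda>x. flat (n + 2) x + (- real n) * flat (Suc n) x)"
        by (intro Ck_add Ck_mult Ck_const Suc.IH)
      then show "i \<in> Basis \<Longrightarrow> Ck k (\<lambda>x. (flat (n + 2) x - real n * flat (Suc n) x) * i)" for i :: real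
        by simp
    qed
  qed
  then show ?thesis by (simp add: smooth_def)
qed

lemma smooth_inner_const: "smooth (\<lambda>x. x \<bullet> c)"
proof -
  have "Ck k (\<lambda>x. x \<bullet> c)" for k
  proof (cases k)
    case (Suc n)
    show ?thesis unfolding Suc
      by (rule Ck_SucI[where f'="\<lambda>x h. h \<bullet> c"]) (auto intro!: derivative_eq_intros Ck_const)
  qed (auto intro: continuous_intros)
  then show ?thesis by (simp add: smooth_def)
qed

lemma smooth_inner_self: "smooth (\<lambda>x. x \<bullet> x)"
proof -
  have "smooth (\<lambda>x::'a. \<Sum>b\<in>Basis. (x \<bullet> b) * (x \<bullet> b))"
    by (intro smooth_sum smooth_mult smooth_inner_const)
  then show ?thesis by (simp add: euclidean_inner[symmetric])
qed

definition mollifier :: "real \<Rightarrow> ('b::euclidean_space \<Rightarrow> real) \<Rightarrow> bool" where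
  "mollifier \<epsilon> K \<longleftrightarrow> smooth K \<and> (\<forall>x. 0 \<le> K x) \<and> (\<forall>x. \<epsilon> \<le> norm x \<longrightarrow> K x = 0) \<and>
     integrable lborel K \<and> integral\<^sup>L lborel K = 1"

lemma integrable_continuous_bounded_support:
  fixes f :: "'b::euclidean_space \<Rightarrow> 'c::{banach, second_countable_topology}"
  assumes "continuous_on UNIV f" and "\<And>x. R \<le> norm (x - c) \<Longrightarrow> f x = 0"
  shows "integrable lborel f"
proof -
  have "set_integrable lborel (cball c R) f"
    unfolding set_integrable_def
    by (rule borel_integrable_compact) (auto intro: continuous_on_subset[OF assms(1)])
  moreover have "(\<lambda>x. indicator (cball c R) x *\<^sub>R f x) = f"
    using assms(2) by (auto simp: fun_eq_iff indicator_def dist_norm norm_minus_commute)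
  ultimately show ?thesis by (simp add: set_integrable_def)
qed

lemma mollifier_exists:
  assumes "\<epsilon> > 0"
  shows "\<exists>K :: 'b::euclidean_space \<Rightarrow> real. mollifier \<epsilon> K"
proof -
  define g :: "'b \<Rightarrow> real" where "g = (\<lambda>x. flat 0 (\<epsilon>\<^sup>2 - x \<bullet> x))"
  have g: "smooth g"
    unfolding g_def
    by (rule smooth_compose_real[OF smooth_flat]) (intro smooth_diff smooth_const smooth_inner_self)
  have nn: "0 \<le> g x" for x
    by (simp add: g_def flat_def)
  have out: "g x = 0" if "\<epsilon> \<le> norm x" for x
    using that assms power_mono[of \<epsilon> "norm x" 2] by (simp add: g_def flat_def dot_square_norm not_less)
  have pos: "0 < g x" if "norm x < \<epsilon>" for x
    using that assms power_strict_mono[of "norm x" \<epsilon> 2] by (simp add: g_def flat_def dot_square_norm)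
  have int: "integrable lborel g"
    using integrable_continuous_bounded_support[of g \<epsilon> 0] g out by (auto intro: smooth_continuous_on)
  have "integral\<^sup>L lborel g \<noteq> 0"
  proof
    assume "integral\<^sup>L lborel g = 0"
    then have "AE x in lborel. g x = 0"
      using integral_nonneg_eq_0_iff_AE[OF int] nn by auto
    then have "AE x in lborel. x \<notin> ball (0::'b) \<epsilon>"
      by eventually_elim (metis pos mem_ball_0 less_irrefl)
    then have "ball (0::'b) \<epsilon> \<in> null_sets lborel"
      using AE_iff_null_sets[of "ball (0::'b) \<epsilon>" lborel] by simp
    then have "emeasure lborel (ball (0::'b) \<epsilon>) = 0" by auto
    then show False
      using assms open_not_negligible[of "ball (0::'b) \<epsilon>"]
      by (auto simp: negligible_iff_null_sets null_sets_def)
  qed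
  moreover have "integral\<^sup>L lborel g \<ge> 0" using nn by (simp add: integral_nonneg)
  ultimately have p: "integral\<^sup>L lborel g > 0" by simp
  have "mollifier \<epsilon> (\<lambda>x. inverse (integral\<^sup>L lborel g) * g x)"
    unfolding mollifier_def using p nn out int by (auto intro!: smooth_mult smooth_const g)
  then show ?thesis by blast
qed

lemma test_funI:
  assumes "smooth f" and sub: "\<And>x. f x \<noteq> 0 \<Longrightarrow> x \<in> C" and "compact C" "C \<subseteq> U"
  shows "test_fun U f"
proof -
  have sub': "closure {x. f x \<noteq> 0} \<subseteq> C"
    by (rule closure_minimal) (use sub compact_imp_closed[OF assms(3)] in auto)
  have "bounded (closure {x. f x \<noteq> 0})"
    by (rule bounded_subset[OF compact_imp_bounded[OF assms(3)] sub'])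
  then have "compact (closure {x. f x \<noteq> 0})"
    by (simp add: compact_eq_bounded_closed)
  with sub' show ?thesis
    using assms(1,4) unfolding test_fun_def by blast
qed

lemma mollifier_test_fun:
  assumes "mollifier \<epsilon> K" "cball p \<epsilon> \<subseteq> U"
  shows "test_fun U (\<lambda>q. K (q - p))"
proof (rule test_funI)
  show "smooth (\<lambda>q. K (q - p))"
    using assms by (simp add: mollifier_def smooth_translate)
  show "q \<in> cball p \<epsilon>" if "K (q - p) \<noteq> 0" for q
    using assms(1) that linear[of \<epsilon> "norm (q - p)"]
    by (auto simp: mollifier_def dist_norm norm_minus_commute)
qed (use assms in auto)

section \<open>Integration by parts and mollification\<close>

lemma lborel_integral_translate:
  fixes f :: "'b::euclidean_space \<Rightarrow> real"
  assumes [measurable]: "f \<in> borel_measurable borel"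
  shows "(\<integral>x. f (x + c) \<partial>lborel) = integral\<^sup>L lborel f"
    and "integrable lborel (\<lambda>x. f (x + c)) \<longleftrightarrow> integrable lborel f"
proof -
  have "integral\<^sup>L lborel f = integral\<^sup>L (distr lborel borel ((+) c)) f"
    by (simp add: lborel_distr_plus)
  also have "\<dots> = (\<integral>x. f (x + c) \<partial>lborel)"
    by (subst integral_distr) (auto simp: add.commute)
  finally show "(\<integral>x. f (x + c) \<partial>lborel) = integral\<^sup>L lborel f" ..
  have "integrable lborel f \<longleftrightarrow> integrable (distr lborel borel ((+) c)) f"
    by (simp add: lborel_distr_plus)
  also have "\<dots> \<longleftrightarrow> integrable lborel (\<lambda>x. f (x + c))"
    by (subst integrable_distr_eq) (auto simp: add.commute)
  finally show "integrable lborel (\<lambda>x. f (x + c)) \<longleftrightarrow> integrable lborel f" ..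
qed

lemma lborel_integral_reflect:
  fixes f :: "'b::euclidean_space \<Rightarrow> real"
  assumes [measurable]: "f \<in> borel_measurable borel"
  shows "(\<integral>x. f (c - x) \<partial>lborel) = integral\<^sup>L lborel f"
    and "integrable lborel (\<lambda>x. f (c - x)) \<longleftrightarrow> integrable lborel f"
proof -
  have D: "distr lborel borel (\<lambda>x. c - x) = (lborel :: 'b measure)"
    using lborel_affine[of "-1" c] by (simp add: density_1)
  have "integral\<^sup>L lborel f = integral\<^sup>L (distr lborel borel (\<lambda>x. c - x)) f"
    by (simp add: D)
  also have "\<dots> = (\<integral>x. f (c - x) \<partial>lborel)"
    by (subst integral_distr) auto
  finally show "(\<integral>x. f (c - x) \<partial>lborel) = integral\<^sup>L lborel f" ..
  have "integrable lborel f \<longleftrightarrow> integrable (distr lborel borel (\<lambda>x. c - x)) f"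
    by (simp add: D)
  also have "\<dots> \<longleftrightarrow> integrable lborel (\<lambda>x. f (c - x))"
    by (subst integrable_distr_eq) auto
  finally show "integrable lborel (\<lambda>x. f (c - x)) \<longleftrightarrow> integrable lborel f" ..
qed

lemma directional_derivative_shift:
  fixes f :: "'b::real_vector \<Rightarrow> real"
  assumes "\<And>p. ((\<lambda>s. f (p + s *\<^sub>R e)) has_real_derivative f' p) (at 0)"
  shows "((\<lambda>s. f (p + s *\<^sub>R e)) has_real_derivative f' (p + s *\<^sub>R e)) (at s)"
proof -
  have "((\<lambda>h. f ((p + s *\<^sub>R e) + h *\<^sub>R e)) has_real_derivative f' (p + s *\<^sub>R e)) (at 0)"
    by (rule assms)
  then show ?thesis
    using DERIV_shift[of "\<lambda>s. f (p + s *\<^sub>R e)" _ 0 s]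
    by (simp add: scaleR_add_left add.assoc add.commute[of "s *\<^sub>R e"])
qed

lemma directional_mvt_bound:
  fixes f :: "'b::real_vector \<Rightarrow> real"
  assumes "\<And>p. ((\<lambda>s. f (p + s *\<^sub>R e)) has_real_derivative f' p) (at 0)"
    and "\<And>t. t \<in> closed_segment 0 s \<Longrightarrow> \<bar>f' (p + t *\<^sub>R e)\<bar> \<le> B"
  shows "\<bar>f (p + s *\<^sub>R e) - f p\<bar> \<le> B * \<bar>s\<bar>"
  using field_differentiable_bound[of "closed_segment 0 s" "\<lambda>s. f (p + s *\<^sub>R e)" "\<lambda>t. f' (p + t *\<^sub>R e)" B s 0]
    assms(2) directional_derivative_shift[OF assms(1)]
  by (auto intro: has_field_derivative_at_within)

text \<open>By translation invariance all difference quotients of an integrable function have integral zero.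
  The bounds on the derivative and on the support allow passing to the limit. Applied to a product
  this is integration by parts.\<close>

lemma integral_directional_derivative_eq_0:
  fixes f f' :: "'b::euclidean_space \<Rightarrow> real"
  assumes f: "integrable lborel f"
    and D: "\<And>p. ((\<lambda>s. f (p + s *\<^sub>R e)) has_real_derivative f' p) (at 0)"
    and supp: "\<And>p. R \<le> norm p \<Longrightarrow> f p = 0"
    and bd: "\<And>p. \<bar>f' p\<bar> \<le> B"
  shows "integral\<^sup>L lborel f' = 0"
proof -
  define g where "g k p = (f (p + (1 / Suc k) *\<^sub>R e) - f p) / (1 / Suc k)" for k p
  have [measurable]: "f \<in> borel_measurable borel" using f by auto
  have [measurable]: "g k \<in> borel_measurable lborel" for k unfolding g_def by measurable
  have lim: "(\<lambda>k. g k p) \<longlonglongrightarrow> f' p" for p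
  proof -
    have "((\<lambda>h. (f (p + h *\<^sub>R e) - f p) / h) \<longlongrightarrow> f' p) (at 0)"
      using D[of p] by (simp add: DERIV_def)
    moreover have "filterlim (\<lambda>k. 1 / real (Suc k)) (at 0) sequentially"
      unfolding filterlim_at using LIMSEQ_inverse_real_of_nat by (auto simp: inverse_eq_divide)
    ultimately show ?thesis unfolding g_def by (rule filterlim_compose)
  qed
  \<comment> \<open>The shifts have length at most \<open>norm e\<close>, which enlarges the support accordingly.\<close>
  have gb: "\<bar>g k p\<bar> \<le> B * indicator (cball 0 (\<bar>R\<bar> + norm e)) p" for k p
  proof (cases "p \<in> cball 0 (\<bar>R\<bar> + norm e)")
    case True
    have "\<bar>f (p + (1 / Suc k) *\<^sub>R e) - f p\<bar> \<le> B * \<bar>1 / Suc k\<bar>"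
      by (rule directional_mvt_bound[OF D bd])
    then have "\<bar>f (p + (1 / Suc k) *\<^sub>R e) - f p\<bar> / \<bar>1 / Suc k\<bar> \<le> B"
      by (subst pos_divide_le_eq) auto
    then show ?thesis using True by (simp only: g_def abs_divide) simp
  next
    case False
    have "norm ((1 / Suc k) *\<^sub>R e) \<le> norm e" by (simp add: divide_le_eq mult_le_cancel_left1)
    moreover have "norm p \<le> norm (p + (1 / Suc k) *\<^sub>R e) + norm ((1 / Suc k) *\<^sub>R e)"
      using norm_triangle_ineq4[of "p + (1 / Suc k) *\<^sub>R e" "(1 / Suc k) *\<^sub>R e"] by simp
    moreover have "norm p > \<bar>R\<bar> + norm e" "0 \<le> norm e" using False by auto
    ultimately have "R \<le> norm (p + (1 / Suc k) *\<^sub>R e)" "R \<le> norm p"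
      by linarith+
    then have "f (p + (1 / Suc k) *\<^sub>R e) = 0" "f p = 0"
      by (auto intro!: supp)
    then show ?thesis using False by (simp add: g_def)
  qed
  have "(\<lambda>k. integral\<^sup>L lborel (g k)) \<longlonglongrightarrow> integral\<^sup>L lborel f'"
  proof (rule integral_dominated_convergence)
    show "f' \<in> borel_measurable lborel"
      by (rule borel_measurable_LIMSEQ_metric[of g]) (auto intro: lim)
    have "emeasure lborel (cball (0::'b) (\<bar>R\<bar> + norm e)) < \<infinity>"
      by (rule emeasure_bounded_finite) simp
    then show "integrable lborel (\<lambda>p. B * indicator (cball (0::'b) (\<bar>R\<bar> + norm e)) p :: real)"
      by (intro integrable_mult_right integrable_real_indicator) auto
  qed (use lim gb in auto)
  moreover have "integral\<^sup>L lborel (g k) = 0" for k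
  proof -
    have "integral\<^sup>L lborel (g k) = (\<integral>p. f (p + (1 / Suc k) *\<^sub>R e) - f p \<partial>lborel) / (1 / Suc k)"
      unfolding g_def by (rule integral_divide_zero)
    also have "(\<integral>p. f (p + (1 / Suc k) *\<^sub>R e) - f p \<partial>lborel) = 0"
      using f by (subst Bochner_Integration.integral_diff) (auto simp: lborel_integral_translate)
    finally show ?thesis by simp
  qed
  ultimately have "(\<lambda>k::nat. 0) \<longlonglongrightarrow> integral\<^sup>L lborel f'" by simp
  then show ?thesis by (simp add: LIMSEQ_const_iff)
qed

lemma bounded_of_continuous_bounded_support:
  fixes f :: "'b::euclidean_space \<Rightarrow> 'c::real_normed_vector"
  assumes "continuous_on UNIV f" and "\<And>x. R \<le> norm x \<Longrightarrow> f x = 0"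
  shows "\<exists>B\<ge>0. \<forall>x. norm (f x) \<le> B"
proof -
  have "compact (f ` cball 0 R)"
    by (intro compact_continuous_image continuous_on_subset[OF assms(1)]) auto
  then obtain B where B: "\<And>x. x \<in> cball 0 R \<Longrightarrow> norm (f x) \<le> B"
    using compact_imp_bounded bounded_iff by (metis imageI)
  have "norm (f x) \<le> max B 0" for x
    using B[of x] assms(2)[of x] by (cases "norm x \<le> R") auto
  then show ?thesis by (intro exI[of _ "max B 0"]) auto
qed

lemma grad_eq_0:
  assumes "open U" "x \<in> U" "\<And>y. y \<in> U \<Longrightarrow> f y = 0"
  shows "grad f x = 0"
proof (rule has_derivative_imp_grad_eq)
  have "((\<lambda>y. 0) has_derivative (\<lambda>h. 0 \<bullet> h)) (at x)" by simp
  then show "(f has_derivative (\<lambda>h. 0 \<bullet> h)) (at x)"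
    by (rule has_derivative_transform_within_open[OF _ assms(1,2)]) (simp add: assms(3))
qed

lemma grad_zero_outside:
  assumes "\<And>x. R \<le> norm x \<Longrightarrow> f x = 0" "R < norm x"
  shows "grad f x = 0"
  by (rule grad_eq_0[of "- cball 0 R"]) (use assms in auto)

lemma smooth_directional:
  assumes "smooth f"
  shows "((\<lambda>s. f (p + s *\<^sub>R e)) has_real_derivative grad f p \<bullet> e) (at 0)"
proof -
  have "((\<lambda>s. f (p + s *\<^sub>R e)) has_derivative (\<lambda>s. grad f (p + 0 *\<^sub>R e) \<bullet> (s *\<^sub>R e))) (at 0)"
    by (rule has_derivative_compose[of "\<lambda>s. p + s *\<^sub>R e" "\<lambda>s. s *\<^sub>R e"])
       (auto intro!: derivative_eq_intros smooth_has_grad assms)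
  moreover have "(\<lambda>s. grad f (p + 0 *\<^sub>R e) \<bullet> (s *\<^sub>R e)) = (*) (grad f p \<bullet> e)"
    by (auto simp: mult.commute)
  ultimately show ?thesis by (simp only: has_field_derivative_def)
qed

lemma mollifier_bounds:
  assumes "mollifier \<epsilon> K"
  obtains B where "B \<ge> 0" "\<And>x. \<bar>K x\<bar> \<le> B" "\<And>x. norm (grad K x) \<le> B"
proof -
  have s: "smooth K" and z: "\<And>x. \<epsilon> \<le> norm x \<Longrightarrow> K x = 0" using assms by (auto simp: mollifier_def)
  obtain B1 where "B1 \<ge> 0" "\<And>x. \<bar>K x\<bar> \<le> B1"
    using bounded_of_continuous_bounded_support[OF smooth_continuous_on[OF s] z] by auto
  moreover have "grad K x = 0" if "\<epsilon> + 1 \<le> norm x" for x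
    by (rule grad_zero_outside[OF z]) (use that in auto)
  then obtain B2 where "B2 \<ge> 0" "\<And>x. norm (grad K x) \<le> B2"
    using bounded_of_continuous_bounded_support[OF smooth_continuous_grad[OF s]] by metis
  ultimately show ?thesis
    by (intro that[of "max B1 B2"]) (auto simp: le_max_iff_disj)
qed

lemma mollifier_measurable:
  assumes "mollifier \<epsilon> K"
  shows "K \<in> borel_measurable borel" "grad K \<in> borel_measurable borel"
  using assms
  by (auto simp: mollifier_def intro!: borel_measurable_continuous_onI smooth_continuous_on smooth_continuous_grad)

text \<open>The derivative falls on the smooth kernel by dominated convergence. The kernel is evaluated at
  \<open>q - p\<close> rather than \<open>p - q\<close>, so that as a function of \<open>q\<close> it is a test function near \<open>p\<close>; this
  is the origin of the sign.\<close>

lemma has_derivative_convolution: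
  fixes F K :: "'b::euclidean_space \<Rightarrow> real"
  assumes F: "integrable lborel F" and K: "mollifier \<epsilon> K"
  shows "((\<lambda>s. \<integral>q. F q * K (q - (p + s *\<^sub>R e)) \<partial>lborel) has_real_derivative
          - (\<integral>q. F q * (grad K (q - p) \<bullet> e) \<partial>lborel)) (at 0)"
proof -
  note [measurable] = mollifier_measurable[OF K]
  have [measurable]: "F \<in> borel_measurable borel" using F by auto
  obtain B where B: "B \<ge> 0" "\<And>x. \<bar>K x\<bar> \<le> B" "\<And>x. norm (grad K x) \<le> B"
    using mollifier_bounds[OF K] by metis
  have sK: "smooth K" using K by (simp add: mollifier_def)
  have int: "integrable lborel (\<lambda>q. F q * K (q - a))" for a
    by (rule Bochner_Integration.integrable_bound[where f="\<lambda>q. B * F q"])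
       (use F B in \<open>auto simp: abs_mult mult.commute[of B] intro!: mult_left_mono\<close>)
  have gb: "\<bar>grad K a \<bullet> - e\<bar> \<le> B * norm e" for a
    using Cauchy_Schwarz_ineq2[of "grad K a" "-e"] mult_right_mono[OF B(3)[of a], of "norm e"] by simp
  have D: "((\<lambda>s. K (q - p + s *\<^sub>R (- e))) has_real_derivative grad K (q - p) \<bullet> (- e)) (at 0)" for q
    by (rule smooth_directional[OF sK])
  show ?thesis
    unfolding DERIV_def tendsto_at_iff_sequentially comp_def
  proof (intro allI impI)
    fix X :: "nat \<Rightarrow> real" assume X: "\<forall>i. X i \<in> UNIV - {0}" "X \<longlonglongrightarrow> 0"
    define G where "G i q = F q * ((K (q - p + X i *\<^sub>R (- e)) - K (q - p)) / X i)" for i q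
    have [measurable]: "G i \<in> borel_measurable borel" for i unfolding G_def by measurable
    have "(\<lambda>i. integral\<^sup>L lborel (G i)) \<longlonglongrightarrow> (\<integral>q. F q * (grad K (q - p) \<bullet> (- e)) \<partial>lborel)"
    proof (rule integral_dominated_convergence)
      show "integrable lborel (\<lambda>q. \<bar>F q\<bar> * (B * norm e))" using F by auto
      show "AE q in lborel. (\<lambda>i. G i q) \<longlonglongrightarrow> F q * (grad K (q - p) \<bullet> - e)"
      proof (intro AE_I2)
        fix q
        have "(\<lambda>i. (K (q - p + X i *\<^sub>R (- e)) - K (q - p)) / X i) \<longlonglongrightarrow> grad K (q - p) \<bullet> (- e)"
          using D[of q, unfolded DERIV_def tendsto_at_iff_sequentially comp_def] X by auto
        then show "(\<lambda>i. G i q) \<longlonglongrightarrow> F q * (grad K (q - p) \<bullet> - e)"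
          unfolding G_def by (intro tendsto_mult tendsto_const)
      qed
      show "AE q in lborel. norm (G i q) \<le> \<bar>F q\<bar> * (B * norm e)" for i
      proof (intro AE_I2)
        fix q
        have "\<bar>K (q - p + X i *\<^sub>R (- e)) - K (q - p)\<bar> \<le> (B * norm e) * \<bar>X i\<bar>"
          by (rule directional_mvt_bound[OF smooth_directional[OF sK]])
             (rule gb)
        then have "\<bar>(K (q - p + X i *\<^sub>R (- e)) - K (q - p)) / X i\<bar> \<le> B * norm e"
          using X(1) by (simp add: divide_le_eq)
        then show "norm (G i q) \<le> \<bar>F q\<bar> * (B * norm e)"
          by (simp only: G_def real_norm_def abs_mult mult_left_mono abs_ge_zero)
      qed
    qed simp_all
    moreover have "integral\<^sup>L lborel (G i) =
       ((\<integral>q. F q * K (q - (p + (0 + X i) *\<^sub>R e)) \<partial>lborel) - (\<integral>q. F q * K (q - (p + 0 *\<^sub>R e)) \<partial>lborel)) / X i" for i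
    proof -
      have "G i = (\<lambda>q. (F q * K (q - (p + X i *\<^sub>R e)) - F q * K (q - p)) / X i)"
        by (auto simp: G_def algebra_simps diff_divide_distrib)
      then show ?thesis by (simp add: int)
    qed
    ultimately show "(\<lambda>i. ((\<integral>q. F q * K (q - (p + (0 + X i) *\<^sub>R e)) \<partial>lborel)
        - (\<integral>q. F q * K (q - (p + 0 *\<^sub>R e)) \<partial>lborel)) / X i)
        \<longlonglongrightarrow> - (\<integral>q. F q * (grad K (q - p) \<bullet> e) \<partial>lborel)"
      by (simp add: inner_minus_right)
  qed
qed

lemma integrable_mollifier_translate:
  assumes "mollifier \<epsilon> K"
  shows "integrable lborel (\<lambda>p. K (q - p))" "(\<integral>p. K (q - p) \<partial>lborel) = 1"
        "integrable lborel (\<lambda>p. K (p - q))" "(\<integral>p. K (p - q) \<partial>lborel) = 1"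
  using lborel_integral_reflect[OF mollifier_measurable(1)[OF assms], of q]
    lborel_integral_translate[OF mollifier_measurable(1)[OF assms], of "-q"] assms
  by (auto simp: mollifier_def)

lemma integrable_bounded_mult:
  fixes F g :: "'b::euclidean_space \<Rightarrow> real"
  assumes "integrable lborel F" "g \<in> borel_measurable borel" "\<And>q. \<bar>g q\<bar> \<le> B"
  shows "integrable lborel (\<lambda>q. F q * g q)"
proof (rule Bochner_Integration.integrable_bound[where f="\<lambda>q. B * F q"])
  have "B \<ge> 0" using assms(3)[of 0] by linarith
  then show "AE q in lborel. norm (F q * g q) \<le> norm (B * F q)"
    using assms(3) by (auto simp: abs_mult mult.commute[of B] intro!: mult_left_mono)
qed (use assms in auto)

text \<open>Fubini moves the mollification from \<open>F\<close> to \<open>\<zeta>\<close>, and averages of \<open>\<zeta>\<close> over shrinking balls converge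
  at each point of continuity. A null set of discontinuities is admitted so that \<open>\<zeta>\<close> may be cut off
  by the indicator function of a box.\<close>

lemma mollification_weak_limit:
  fixes F \<zeta> :: "'b::euclidean_space \<Rightarrow> real" and K :: "nat \<Rightarrow> 'b \<Rightarrow> real"
  assumes F: "integrable lborel F"
    and K: "\<And>k. mollifier (\<epsilon> k) (K k)" and \<epsilon>: "\<epsilon> \<longlonglongrightarrow> 0"
    and \<zeta>[measurable]: "\<zeta> \<in> borel_measurable borel" and bd: "\<And>p. \<bar>\<zeta> p\<bar> \<le> B"
    and supp: "\<And>p. R \<le> norm p \<Longrightarrow> \<zeta> p = 0"
    and cont: "AE p in lborel. isCont \<zeta> p"
  shows "(\<lambda>k. \<integral>p. \<zeta> p * (\<integral>q. F q * K k (q - p) \<partial>lborel) \<partial>lborel) \<longlonglongrightarrow> (\<integral>p. \<zeta> p * F p \<partial>lborel)"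
proof -
  have [measurable]: "F \<in> borel_measurable borel" using F by auto
  note [measurable] = mollifier_measurable[OF K]
  have B0: "B \<ge> 0" using bd[of 0] by linarith
  have "emeasure lborel (cball (0::'b) \<bar>R\<bar>) < \<infinity>"
    by (rule emeasure_bounded_finite) simp
  then have iB: "integrable lborel (\<lambda>p. B * indicator (cball (0::'b) \<bar>R\<bar>) p)"
    by (intro integrable_mult_right integrable_real_indicator) auto
  have iz: "integrable lborel \<zeta>"
    by (rule Bochner_Integration.integrable_bound[OF iB])
       (use bd supp B0 in \<open>auto simp: indicator_def abs_mult\<close>)
  have swap: "(\<integral>p. \<zeta> p * (\<integral>q. F q * K k (q - p) \<partial>lborel) \<partial>lborel)
      = (\<integral>q. F q * (\<integral>p. \<zeta> p * K k (q - p) \<partial>lborel) \<partial>lborel)" for k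
  proof -
    obtain C where C: "C \<ge> 0" "\<And>x. \<bar>K k x\<bar> \<le> C" using mollifier_bounds[OF K] by metis
    have iC: "integrable (lborel \<Otimes>\<^sub>M lborel) (\<lambda>(p, q). C * (\<zeta> p * F q))"
      by (intro lborel_pair.Fubini_integrable) (auto simp: iz F abs_mult mult.assoc)
    have "\<bar>\<zeta> p * F q * K k (q - p)\<bar> \<le> \<bar>C * (\<zeta> p * F q)\<bar>" for p q
      using mult_right_mono[OF C(2)[of "q - p"], of "\<bar>\<zeta> p * F q\<bar>"] C(1) by (simp add: abs_mult mult_ac)
    then have "integrable (lborel \<Otimes>\<^sub>M lborel) (\<lambda>(p, q). \<zeta> p * F q * K k (q - p))"
      by (intro Bochner_Integration.integrable_bound[OF iC]) auto
    from lborel_pair.Fubini_integral[OF this]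
    have "(\<integral>q. (\<integral>p. \<zeta> p * F q * K k (q - p) \<partial>lborel) \<partial>lborel)
        = (\<integral>p. (\<integral>q. \<zeta> p * F q * K k (q - p) \<partial>lborel) \<partial>lborel)" .
    moreover have "(\<integral>q. \<zeta> p * F q * K k (q - p) \<partial>lborel) = \<zeta> p * (\<integral>q. F q * K k (q - p) \<partial>lborel)" for p
      by (simp only: mult.assoc integral_mult_right_zero)
    moreover have "(\<integral>p. \<zeta> p * F q * K k (q - p) \<partial>lborel) = F q * (\<integral>p. \<zeta> p * K k (q - p) \<partial>lborel)" for q
    proof -
      have "(\<lambda>p. \<zeta> p * F q * K k (q - p)) = (\<lambda>p. F q * (\<zeta> p * K k (q - p)))" by (simp add: mult_ac)
      then show ?thesis by (simp only: integral_mult_right_zero)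
    qed
    ultimately show ?thesis by simp
  qed
  have ii: "integrable lborel (\<lambda>p. \<zeta> p * K k (q - p))" for k q
    using integrable_bounded_mult[OF integrable_mollifier_translate(1)[OF K] \<zeta> bd]
    by (simp add: mult.commute)
  have inner_bd: "\<bar>(\<integral>p. \<zeta> p * K k (q - p) \<partial>lborel) - c\<bar> \<le> \<delta>"
    if "\<And>p. norm (q - p) < \<epsilon> k \<Longrightarrow> \<bar>\<zeta> p - c\<bar> \<le> \<delta>" for k q c \<delta>
  proof -
    note im = integrable_mollifier_translate(1,2)[OF K]
    have "(\<integral>p. \<zeta> p * K k (q - p) \<partial>lborel) - c = (\<integral>p. \<zeta> p * K k (q - p) - c * K k (q - p) \<partial>lborel)"
      by (subst Bochner_Integration.integral_diff) (auto simp: ii im)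
    also have "\<bar>\<dots>\<bar> \<le> (\<integral>p. \<delta> * K k (q - p) \<partial>lborel)"
    proof (rule integral_abs_bound_integral)
      show "integrable lborel (\<lambda>p. \<zeta> p * K k (q - p) - c * K k (q - p))"
        by (intro Bochner_Integration.integrable_diff ii integrable_mult_right im)
      show "integrable lborel (\<lambda>p. \<delta> * K k (q - p))" by (intro integrable_mult_right im)
      show "\<bar>\<zeta> p * K k (q - p) - c * K k (q - p)\<bar> \<le> \<delta> * K k (q - p)" for p
      proof (cases "norm (q - p) < \<epsilon> k")
        case True
        have "\<bar>\<zeta> p * K k (q - p) - c * K k (q - p)\<bar> = \<bar>\<zeta> p - c\<bar> * K k (q - p)"
          using K[of k] by (simp add: abs_mult mollifier_def left_diff_distrib[symmetric])
        also have "\<dots> \<le> \<delta> * K k (q - p)"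
          using K[of k] that[OF True] by (intro mult_right_mono) (auto simp: mollifier_def)
        finally show ?thesis .
      next
        case False
        then show ?thesis using K[of k] by (simp add: mollifier_def)
      qed
    qed
    also have "\<dots> = \<delta>" by (simp add: im)
    finally show ?thesis .
  qed
  have "(\<lambda>k. \<integral>q. F q * (\<integral>p. \<zeta> p * K k (q - p) \<partial>lborel) \<partial>lborel) \<longlonglongrightarrow> (\<integral>q. F q * \<zeta> q \<partial>lborel)"
  proof (rule integral_dominated_convergence)
    show "integrable lborel (\<lambda>q. B * \<bar>F q\<bar>)" using F by auto
    show "AE q in lborel. norm (F q * (\<integral>p. \<zeta> p * K k (q - p) \<partial>lborel)) \<le> B * \<bar>F q\<bar>" for k
      using inner_bd[of _ k 0 B] bd by (auto simp: abs_mult mult.commute[of B] intro!: AE_I2 mult_left_mono)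
    show "AE q in lborel. (\<lambda>k. F q * (\<integral>p. \<zeta> p * K k (q - p) \<partial>lborel)) \<longlonglongrightarrow> F q * \<zeta> q"
      using cont
    proof eventually_elim
      fix q assume q: "isCont \<zeta> q"
      have "(\<lambda>k. \<integral>p. \<zeta> p * K k (q - p) \<partial>lborel) \<longlonglongrightarrow> \<zeta> q"
      proof (rule LIMSEQ_I)
        fix r :: real assume "r > 0"
        then obtain d where d: "d > 0" "\<And>p. dist p q < d \<Longrightarrow> \<bar>\<zeta> p - \<zeta> q\<bar> < r / 2"
          using q unfolding continuous_at_eps_delta dist_real_def by (meson half_gt_zero)
        obtain N where N: "\<And>k. k \<ge> N \<Longrightarrow> \<epsilon> k < d"
          using LIMSEQ_D[OF \<epsilon> d(1)] by (force simp: abs_less_iff)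
        have "\<bar>(\<integral>p. \<zeta> p * K k (q - p) \<partial>lborel) - \<zeta> q\<bar> \<le> r / 2" if "k \<ge> N" for k
        proof (rule inner_bd)
          fix p assume "norm (q - p) < \<epsilon> k"
          then have "dist p q < d" using N[OF that] by (simp add: dist_norm norm_minus_commute)
          then show "\<bar>\<zeta> p - \<zeta> q\<bar> \<le> r / 2" using d(2) by (simp add: less_imp_le)
        qed
        then show "\<exists>N. \<forall>k\<ge>N. norm ((\<integral>p. \<zeta> p * K k (q - p) \<partial>lborel) - \<zeta> q) < r"
          using \<open>r > 0\<close> by (intro exI[of _ N]) force
      qed
      then show "(\<lambda>k. F q * (\<integral>p. \<zeta> p * K k (q - p) \<partial>lborel)) \<longlonglongrightarrow> F q * \<zeta> q"
        by (intro tendsto_mult tendsto_const)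
    qed
  qed measurable
  then show ?thesis by (simp add: swap mult.commute)
qed

lemma grad_translate:
  assumes "smooth f"
  shows "grad (\<lambda>q. f (q - p)) q = grad f (q - p)"
proof (rule has_derivative_imp_grad_eq)
  show "((\<lambda>q. f (q - p)) has_derivative (\<lambda>h. grad f (q - p) \<bullet> h)) (at q)"
    by (rule has_derivative_compose[of "\<lambda>q. q - p" "\<lambda>h. h"])
       (auto intro!: derivative_eq_intros smooth_has_grad assms)
qed

section \<open>Weak derivatives and Lipschitz representatives\<close>

lemma integral_mult_bound:
  fixes F g :: "'b::euclidean_space \<Rightarrow> real"
  assumes "integrable lborel F" "g \<in> borel_measurable borel" "\<And>q. \<bar>g q\<bar> \<le> B"
  shows "\<bar>\<integral>q. F q * g q \<partial>lborel\<bar> \<le> B * (\<integral>q. \<bar>F q\<bar> \<partial>lborel)"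
proof -
  have "\<bar>\<integral>q. F q * g q \<partial>lborel\<bar> \<le> (\<integral>q. B * \<bar>F q\<bar> \<partial>lborel)"
  proof (rule integral_abs_bound_integral)
    show "\<bar>F q * g q\<bar> \<le> B * \<bar>F q\<bar>" for q
      using mult_left_mono[OF assms(3)[of q], of "\<bar>F q\<bar>"] by (simp add: abs_mult mult.commute)
  qed (use assms integrable_bounded_mult[OF assms] in auto)
  then show ?thesis by simp
qed

lemma test_fun_bounds:
  assumes "test_fun D \<psi>" "open D"
  obtains B R \<delta> where "smooth \<psi>" "B \<ge> 0" "\<And>p. \<bar>\<psi> p\<bar> \<le> B" "\<And>p. norm (grad \<psi> p) \<le> B"
    "\<And>p. R \<le> norm p \<Longrightarrow> \<psi> p = 0" "\<And>p. R \<le> norm p \<Longrightarrow> grad \<psi> p = 0"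
    "\<delta> > 0" "\<And>p. \<psi> p \<noteq> 0 \<Longrightarrow> cball p \<delta> \<subseteq> D"
proof -
  let ?S = "closure {x. \<psi> x \<noteq> 0}"
  have s: "smooth \<psi>" and S: "compact ?S" "?S \<subseteq> D" using assms by (auto simp: test_fun_def)
  obtain \<delta> where \<delta>: "\<delta> > 0" "(\<Union>x\<in>?S. cball x \<delta>) \<subseteq> D"
    using compact_subset_open_imp_cball_epsilon_subset[OF S(1) assms(2) S(2)] .
  obtain R0 where R0: "\<And>x. x \<in> ?S \<Longrightarrow> norm x \<le> R0"
    using compact_imp_bounded[OF S(1)] unfolding bounded_iff by auto
  have z: "\<psi> p = 0" if "R0 + 1 \<le> norm p" for p
    using R0[of p] that closure_subset[of "{x. \<psi> x \<noteq> 0}"] by force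
  have gz: "grad \<psi> p = 0" if "R0 + 2 \<le> norm p" for p
    by (rule grad_zero_outside[of "R0 + 1", OF z]) (use that in auto)
  obtain B1 where B1: "B1 \<ge> 0" "\<And>x. \<bar>\<psi> x\<bar> \<le> B1"
    using bounded_of_continuous_bounded_support[OF smooth_continuous_on[OF s] z] by auto
  obtain B2 where B2: "B2 \<ge> 0" "\<And>x. norm (grad \<psi> x) \<le> B2"
    using bounded_of_continuous_bounded_support[OF smooth_continuous_grad[OF s] gz] by auto
  have "cball p \<delta> \<subseteq> D" if "\<psi> p \<noteq> 0" for p
    using \<delta>(2) that closure_subset[of "{x. \<psi> x \<noteq> 0}"] by blast
  then show ?thesis
    using that[of "max B1 B2" "R0 + 2" \<delta>] s B1 B2 \<delta>(1) z gz by (auto simp: le_max_iff_disj)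
qed

text \<open>Testing with the translates of one mollifier computes the classical derivative of the
  mollification of \<open>F\<close>: it is the mollification of \<open>H\<close>. Integrating by parts against \<open>\<psi>\<close> and letting
  the radius of the mollifier tend to zero gives the identity for \<open>\<psi>\<close>.\<close>

lemma weak_derivative_from_mollifiers:
  fixes F H \<psi> :: "'b::euclidean_space \<Rightarrow> real" and K :: "nat \<Rightarrow> 'b \<Rightarrow> real"
  assumes D: "open D" and F: "integrable lborel F" and H: "integrable lborel H"
    and K: "\<And>k. mollifier (\<epsilon> k) (K k)" and \<epsilon>: "\<epsilon> \<longlonglongrightarrow> 0"
    and id: "\<And>k p. cball p (\<epsilon> k) \<subseteq> D \<Longrightarrow>
        (\<integral>q. F q * (grad (K k) (q - p) \<bullet> e) \<partial>lborel) = - (\<integral>q. H q * K k (q - p) \<partial>lborel)"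
    and \<psi>: "test_fun D \<psi>"
  shows "(\<integral>p. (grad \<psi> p \<bullet> e) * F p \<partial>lborel) = - (\<integral>p. \<psi> p * H p \<partial>lborel)"
proof -
  obtain B R \<delta> where s: "smooth \<psi>" and B: "B \<ge> 0" "\<And>p. \<bar>\<psi> p\<bar> \<le> B" "\<And>p. norm (grad \<psi> p) \<le> B"
    and R: "\<And>p. R \<le> norm p \<Longrightarrow> \<psi> p = 0" "\<And>p. R \<le> norm p \<Longrightarrow> grad \<psi> p = 0"
    and \<delta>: "\<delta> > 0" "\<And>p. \<psi> p \<noteq> 0 \<Longrightarrow> cball p \<delta> \<subseteq> D"
    using test_fun_bounds[OF \<psi> D] by metis
  note [measurable] = mollifier_measurable[OF K]
  have [measurable]: "F \<in> borel_measurable borel" "H \<in> borel_measurable borel" using F H by auto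
  have [measurable]: "\<psi> \<in> borel_measurable borel" "grad \<psi> \<in> borel_measurable borel"
    by (auto intro!: borel_measurable_continuous_onI smooth_continuous_on smooth_continuous_grad s)
  define h where "h k p = (\<integral>q. F q * K k (q - p) \<partial>lborel)" for k p
  define dh where "dh k p = - (\<integral>q. F q * (grad (K k) (q - p) \<bullet> e) \<partial>lborel)" for k p
  have [measurable]: "h k \<in> borel_measurable borel" "dh k \<in> borel_measurable borel" for k
    unfolding h_def dh_def by measurable
  have ge: "\<bar>grad \<psi> p \<bullet> e\<bar> \<le> B * norm e" for p
    using Cauchy_Schwarz_ineq2[of "grad \<psi> p" e] mult_right_mono[OF B(3)[of p], of "norm e"] by simp
  have i\<psi>: "integrable lborel \<psi>"
    using integrable_continuous_bounded_support[of \<psi> R 0] s R by (auto intro: smooth_continuous_on)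
  have ig: "integrable lborel (\<lambda>p. grad \<psi> p \<bullet> e)"
    by (rule integrable_continuous_bounded_support[of _ R 0])
       (use R in \<open>auto intro!: continuous_intros smooth_continuous_grad s\<close>)
  have eq0: "(\<integral>p. (grad \<psi> p \<bullet> e) * h k p \<partial>lborel) + (\<integral>p. \<psi> p * dh k p \<partial>lborel) = 0" for k
  proof -
    obtain C where C: "C \<ge> 0" "\<And>x. \<bar>K k x\<bar> \<le> C" "\<And>x. norm (grad (K k) x) \<le> C"
      using mollifier_bounds[OF K] by metis
    have gK: "\<bar>grad (K k) a \<bullet> e\<bar> \<le> C * norm e" for a
      using Cauchy_Schwarz_ineq2[of "grad (K k) a" e] mult_right_mono[OF C(3)[of a], of "norm e"] by simp
    define I where "I = (\<integral>q. \<bar>F q\<bar> \<partial>lborel)"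
    have hb: "\<bar>h k p\<bar> \<le> C * I" for p
      unfolding h_def I_def by (rule integral_mult_bound[OF F]) (use C in auto)
    have dhb: "\<bar>dh k p\<bar> \<le> (C * norm e) * I" for p
      unfolding dh_def I_def abs_minus_cancel by (rule integral_mult_bound[OF F]) (use gK in auto)
    have i1: "integrable lborel (\<lambda>p. (grad \<psi> p \<bullet> e) * h k p)"
      by (rule integrable_bounded_mult[OF ig _ hb]) auto
    have i2: "integrable lborel (\<lambda>p. \<psi> p * dh k p)"
      by (rule integrable_bounded_mult[OF i\<psi> _ dhb]) auto
    have i3: "integrable lborel (\<lambda>p. \<psi> p * h k p)"
      by (rule integrable_bounded_mult[OF i\<psi> _ hb]) auto
    have "(\<integral>p. (grad \<psi> p \<bullet> e) * h k p + \<psi> p * dh k p \<partial>lborel) = 0"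
    proof (rule integral_directional_derivative_eq_0[OF i3])
      show "((\<lambda>s. \<psi> (p + s *\<^sub>R e) * h k (p + s *\<^sub>R e)) has_real_derivative
          grad \<psi> p \<bullet> e * h k p + \<psi> p * dh k p) (at 0)" for p
        using DERIV_mult[OF smooth_directional[OF s, of p e] has_derivative_convolution[OF F K[of k], of p e]]
        by (simp add: h_def dh_def mult.commute)
      show "\<psi> p * h k p = 0" if "R \<le> norm p" for p
        using R(1)[OF that] by simp
      show "\<bar>grad \<psi> p \<bullet> e * h k p + \<psi> p * dh k p\<bar> \<le> (B * norm e) * (C * I) + B * ((C * norm e) * I)" for p
      proof -
        have "\<bar>grad \<psi> p \<bullet> e\<bar> * \<bar>h k p\<bar> \<le> (B * norm e) * (C * I)"
          by (intro mult_mono ge hb) (use B in auto)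
        moreover have "\<bar>\<psi> p\<bar> * \<bar>dh k p\<bar> \<le> B * ((C * norm e) * I)"
          by (intro mult_mono dhb) (use B in auto)
        ultimately show ?thesis
          using abs_triangle_ineq[of "grad \<psi> p \<bullet> e * h k p" "\<psi> p * dh k p"] by (simp only: abs_mult)
      qed
    qed
    then show ?thesis using i1 i2 by simp
  qed
  have l1: "(\<lambda>k. \<integral>p. (grad \<psi> p \<bullet> e) * h k p \<partial>lborel) \<longlonglongrightarrow> (\<integral>p. (grad \<psi> p \<bullet> e) * F p \<partial>lborel)"
    unfolding h_def
  proof (rule mollification_weak_limit[OF F K \<epsilon> _ ge])
    show "grad \<psi> p \<bullet> e = 0" if "R \<le> norm p" for p using R(2)[OF that] by simp
    have "continuous_on UNIV (\<lambda>p. grad \<psi> p \<bullet> e)"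
      by (intro continuous_intros smooth_continuous_grad s)
    then show "AE p in lborel. isCont (\<lambda>p. grad \<psi> p \<bullet> e) p"
      by (simp add: continuous_on_eq_continuous_at)
  qed auto
  have l2: "(\<lambda>k. \<integral>p. \<psi> p * (\<integral>q. H q * K k (q - p) \<partial>lborel) \<partial>lborel) \<longlonglongrightarrow> (\<integral>p. \<psi> p * H p \<partial>lborel)"
  proof (rule mollification_weak_limit[OF H K \<epsilon> _ B(2) R(1)])
    show "AE p in lborel. isCont \<psi> p"
      using smooth_continuous_on[OF s, of UNIV] by (simp add: continuous_on_eq_continuous_at)
  qed auto
  obtain N where N: "\<And>k. k \<ge> N \<Longrightarrow> \<epsilon> k \<le> \<delta>"
    using LIMSEQ_D[OF \<epsilon> \<delta>(1)] by (force simp: abs_less_iff)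
  have loc: "\<psi> p * (\<integral>q. H q * K k (q - p) \<partial>lborel) = \<psi> p * dh k p" if "k \<ge> N" for k p
  proof (cases "\<psi> p = 0")
    case False
    have "cball p (\<epsilon> k) \<subseteq> cball p \<delta>" using N[OF that] by auto
    also note \<delta>(2)[OF False]
    finally show ?thesis unfolding dh_def by (subst id) auto
  qed simp
  have "eventually (\<lambda>k. (\<integral>p. \<psi> p * (\<integral>q. H q * K k (q - p) \<partial>lborel) \<partial>lborel)
      = - (\<integral>p. (grad \<psi> p \<bullet> e) * h k p \<partial>lborel)) sequentially"
  proof (rule eventually_sequentiallyI[of N])
    fix k assume "N \<le> k"
    then show "(\<integral>p. \<psi> p * (\<integral>q. H q * K k (q - p) \<partial>lborel) \<partial>lborel)
        = - (\<integral>p. (grad \<psi> p \<bullet> e) * h k p \<partial>lborel)"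
      using eq0[of k] by (simp only: loc)
  qed
  with l2 have "(\<lambda>k. - (\<integral>p. (grad \<psi> p \<bullet> e) * h k p \<partial>lborel)) \<longlonglongrightarrow> (\<integral>p. \<psi> p * H p \<partial>lborel)"
    by (rule Lim_transform_eventually)
  from LIMSEQ_unique[OF this tendsto_minus[OF l1]] show ?thesis by simp
qed

text \<open>The gradient of a mollification of \<open>F\<close> is an average of \<open>V\<close>, hence the mollifications \<open>h l\<close> are
  Lipschitz with the constant \<open>C\<close> away from the boundary of \<open>D\<close>. Averaging \<open>h l\<close> once more with the
  \<open>k\<close>-th kernel changes it by at most \<open>C * \<epsilon> k\<close>, and by weak convergence these averages tend to
  \<open>h k\<close> as \<open>l\<close> grows. Therefore \<open>h\<close> is a Cauchy sequence at each point. Its limit inherits the Lipschitz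
  bound and coincides with the weak limit \<open>F\<close> almost everywhere.\<close>

lemma bounded_weak_gradient_lipschitz_representative:
  fixes F :: "'b::euclidean_space \<Rightarrow> real" and V :: "'b \<Rightarrow> 'b"
  assumes D: "open D" "convex D" and F: "integrable lborel F" and FB: "\<And>q. \<bar>F q\<bar> \<le> B"
    and V[measurable]: "V \<in> borel_measurable borel" and VC: "\<And>q. norm (V q) \<le> C"
    and weak: "\<And>\<psi> i. test_fun D \<psi> \<Longrightarrow> i \<in> Basis \<Longrightarrow>
        (\<integral>p. (grad \<psi> p \<bullet> i) * F p \<partial>lborel) = - (\<integral>p. \<psi> p * (V p \<bullet> i) \<partial>lborel)"
  shows "\<exists>u. C-lipschitz_on D u \<and> u \<in> borel_measurable borel \<and> (AE x in lborel. x \<in> D \<longrightarrow> u x = F x)"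
proof -
  have C0: "C \<ge> 0" using VC[of 0] norm_ge_zero order_trans by blast
  define \<epsilon> where "\<epsilon> k = 1 / real (Suc k)" for k
  have \<epsilon>0: "\<epsilon> k > 0" for k by (simp add: \<epsilon>_def)
  have \<epsilon>: "\<epsilon> \<longlonglongrightarrow> 0" unfolding \<epsilon>_def using LIMSEQ_inverse_real_of_nat by (simp add: inverse_eq_divide)
  obtain K :: "nat \<Rightarrow> 'b \<Rightarrow> real" where K: "\<And>k. mollifier (\<epsilon> k) (K k)"
    using mollifier_exists[OF \<epsilon>0] by metis
  note [measurable] = mollifier_measurable[OF K]
  have [measurable]: "F \<in> borel_measurable borel" using F by auto
  define h where "h k p = (\<integral>q. F q * K k (q - p) \<partial>lborel)" for k p
  have [measurable]: "h k \<in> borel_measurable borel" for k unfolding h_def by measurable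
  have hB: "\<bar>h k p\<bar> \<le> B" for k p
  proof -
    have "\<bar>\<integral>q. K k (q - p) * F q \<partial>lborel\<bar> \<le> B * (\<integral>q. \<bar>K k (q - p)\<bar> \<partial>lborel)"
      by (rule integral_mult_bound) (use FB in \<open>auto simp: integrable_mollifier_translate[OF K]\<close>)
    also have "(\<lambda>q. \<bar>K k (q - p)\<bar>) = (\<lambda>q. K k (q - p))" using K[of k] by (auto simp: mollifier_def)
    finally show ?thesis by (simp add: h_def mult.commute integrable_mollifier_translate[OF K])
  qed
  define dh where "dh k e p = - (\<integral>q. F q * (grad (K k) (q - p) \<bullet> e) \<partial>lborel)" for k e p
  have dhC: "\<bar>dh k e p\<bar> \<le> C * norm e" if sub: "cball p (\<epsilon> k) \<subseteq> D" for k e p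
  proof -
    have gK: "grad (\<lambda>q. K k (q - p)) q = grad (K k) (q - p)" for q
      by (rule grad_translate) (use K[of k] in \<open>simp add: mollifier_def\<close>)
    obtain M where M: "M \<ge> 0" "\<And>x. norm (grad (K k) x) \<le> M" using mollifier_bounds[OF K] by metis
    have iK: "integrable lborel (\<lambda>q. K k (q - p) * (V q \<bullet> i))" for i
      by (rule integrable_bounded_mult[of _ _ "C * norm i"])
         (use Cauchy_Schwarz_ineq2 mult_right_mono[OF VC norm_ge_zero] order_trans in
            \<open>auto simp: integrable_mollifier_translate[OF K], blast\<close>)
    have iF: "integrable lborel (\<lambda>q. F q * (grad (K k) (q - p) \<bullet> i))" for i
      by (rule integrable_bounded_mult[OF F, of _ "M * norm i"])
         (use Cauchy_Schwarz_ineq2 mult_right_mono[OF M(2) norm_ge_zero] order_trans in \<open>auto, blast\<close>)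
    have id: "(\<integral>q. F q * (grad (K k) (q - p) \<bullet> i) \<partial>lborel) = - (\<integral>q. K k (q - p) * (V q \<bullet> i) \<partial>lborel)"
      if "i \<in> Basis" for i
      using weak[OF mollifier_test_fun[OF K sub] that] by (simp add: gK mult.commute)
    have "dh k e p = - (\<integral>q. (\<Sum>i\<in>Basis. (e \<bullet> i) * (F q * (grad (K k) (q - p) \<bullet> i))) \<partial>lborel)"
      unfolding dh_def
      by (subst euclidean_inner) (simp add: sum_distrib_left mult_ac)
    also have "\<dots> = - (\<Sum>i\<in>Basis. (e \<bullet> i) * (\<integral>q. F q * (grad (K k) (q - p) \<bullet> i) \<partial>lborel))"
      by (subst Bochner_Integration.integral_sum) (auto intro!: integrable_mult_right iF)
    also have "\<dots> = (\<Sum>i\<in>Basis. (e \<bullet> i) * (\<integral>q. K k (q - p) * (V q \<bullet> i) \<partial>lborel))"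
      by (simp add: id sum_negf)
    also have "\<dots> = (\<integral>q. (\<Sum>i\<in>Basis. (e \<bullet> i) * (K k (q - p) * (V q \<bullet> i))) \<partial>lborel)"
      by (subst Bochner_Integration.integral_sum) (auto intro!: integrable_mult_right iK)
    also have "\<dots> = (\<integral>q. K k (q - p) * (V q \<bullet> e) \<partial>lborel)"
      by (subst (2) euclidean_inner) (simp add: sum_distrib_left mult_ac)
    finally have "dh k e p = (\<integral>q. K k (q - p) * (V q \<bullet> e) \<partial>lborel)" .
    also have "\<bar>\<dots>\<bar> \<le> (C * norm e) * (\<integral>q. \<bar>K k (q - p)\<bar> \<partial>lborel)"
    proof (rule integral_mult_bound)
      show "\<bar>V q \<bullet> e\<bar> \<le> C * norm e" for q
        using Cauchy_Schwarz_ineq2[of "V q" e] mult_right_mono[OF VC[of q], of "norm e"] by simp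
    qed (auto simp: integrable_mollifier_translate[OF K])
    also have "(\<lambda>q. \<bar>K k (q - p)\<bar>) = (\<lambda>q. K k (q - p))" using K[of k] by (auto simp: mollifier_def)
    finally show ?thesis by (simp add: integrable_mollifier_translate[OF K])
  qed
  have lip: "\<bar>h k q - h k p\<bar> \<le> C * norm (q - p)"
    if "\<And>x. x \<in> closed_segment p q \<Longrightarrow> cball x (\<epsilon> k) \<subseteq> D" for k p q
  proof -
    have "\<bar>h k (p + 1 *\<^sub>R (q - p)) - h k p\<bar> \<le> (C * norm (q - p)) * \<bar>1\<bar>"
    proof (rule directional_mvt_bound)
      show "((\<lambda>s. h k (x + s *\<^sub>R (q - p))) has_real_derivative dh k (q - p) x) (at 0)" for x
        unfolding h_def dh_def by (rule has_derivative_convolution[OF F K])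
      show "\<bar>dh k (q - p) (p + t *\<^sub>R (q - p))\<bar> \<le> C * norm (q - p)" if "t \<in> closed_segment 0 1" for t
      proof (rule dhC, rule \<open>\<And>x. x \<in> closed_segment p q \<Longrightarrow> cball x (\<epsilon> k) \<subseteq> D\<close>)
        show "p + t *\<^sub>R (q - p) \<in> closed_segment p q"
          using that unfolding in_segment
          by (auto simp: closed_segment_eq_real_ivl algebra_simps intro!: exI[of _ t])
      qed
    qed
    then show ?thesis by simp
  qed
  have cauchy: "Cauchy (\<lambda>l. h l p)" if "p \<in> D" for p
  proof -
    obtain \<rho> where \<rho>: "\<rho> > 0" "cball p \<rho> \<subseteq> D"
      using D(1) \<open>p \<in> D\<close> open_contains_cball by blast
    \<comment> \<open>The average of \<open>h l\<close> with the \<open>k\<close>-th kernel is within \<open>C * \<epsilon> k\<close> of \<open>h l p\<close> and tends to \<open>h k p\<close>.\<close>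
    have close: "eventually (\<lambda>l. \<bar>h l p - h k p\<bar> \<le> C * \<epsilon> k + \<eta>) sequentially"
      if k: "\<epsilon> k \<le> \<rho> / 2" and \<eta>: "\<eta> > 0" for k \<eta>
    proof -
      obtain M where M: "\<And>x. \<bar>K k x\<bar> \<le> M" using mollifier_bounds[OF K] by metis
      have "(\<lambda>l. \<integral>q. K k (q - p) * h l q \<partial>lborel) \<longlonglongrightarrow> (\<integral>q. K k (q - p) * F q \<partial>lborel)"
        unfolding h_def
      proof (rule mollification_weak_limit[OF F K \<epsilon> _ M])
        show "K k (q - p) = 0" if "norm p + \<epsilon> k \<le> norm q" for q
          using K[of k] that norm_triangle_sub[of q p] by (auto simp: mollifier_def)
        have "continuous_on UNIV (\<lambda>q. K k (q - p))"
          using K[of k] by (intro smooth_continuous_on smooth_translate) (simp add: mollifier_def)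
        then show "AE q in lborel. isCont (\<lambda>q. K k (q - p)) q"
          by (simp add: continuous_on_eq_continuous_at)
      qed auto
      also have "(\<integral>q. K k (q - p) * F q \<partial>lborel) = h k p" by (simp add: h_def mult.commute)
      finally have lim: "(\<lambda>l. \<integral>q. K k (q - p) * h l q \<partial>lborel) \<longlonglongrightarrow> h k p" .
      have e1: "eventually (\<lambda>l. \<bar>(\<integral>q. K k (q - p) * h l q \<partial>lborel) - h k p\<bar> < \<eta>) sequentially"
        using tendstoD[OF lim \<eta>] by (simp add: dist_real_def)
      have e2: "eventually (\<lambda>l. \<epsilon> l < \<rho> / 2) sequentially"
        using order_tendstoD(2)[OF \<epsilon>, of "\<rho> / 2"] \<rho>(1) by simp
      from e1 e2 show ?thesis
      proof eventually_elim
        fix l assume l: "\<bar>(\<integral>q. K k (q - p) * h l q \<partial>lborel) - h k p\<bar> < \<eta>" "\<epsilon> l < \<rho> / 2"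
        have near: "\<bar>h l q - h l p\<bar> \<le> C * \<epsilon> k" if q: "norm (q - p) < \<epsilon> k" for q
        proof -
          have "cball x (\<epsilon> l) \<subseteq> D" if "x \<in> closed_segment p q" for x
          proof
            fix z assume "z \<in> cball x (\<epsilon> l)"
            moreover have "norm (x - p) \<le> norm (q - p)"
              using segment_bound[OF that] by (simp add: norm_minus_commute)
            ultimately have "dist p z \<le> \<rho>"
              using q k l(2) dist_triangle[of p z x] by (simp add: dist_norm norm_minus_commute)
            then show "z \<in> D" using \<rho>(2) by auto
          qed
          then have "\<bar>h l q - h l p\<bar> \<le> C * norm (q - p)" by (rule lip)
          also have "\<dots> \<le> C * \<epsilon> k" using q C0 by (intro mult_left_mono) auto
          finally show ?thesis .
        qed
        note im = integrable_mollifier_translate[OF K]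
        have i1: "integrable lborel (\<lambda>q. K k (q - p) * h l q)"
          by (rule integrable_bounded_mult[OF im(3) _ hB]) auto
        have i2: "integrable lborel (\<lambda>q. K k (q - p) * h l p)"
          by (intro integrable_mult_left im)
        have "(\<integral>q. K k (q - p) * h l q \<partial>lborel) - h l p = (\<integral>q. K k (q - p) * h l q - K k (q - p) * h l p \<partial>lborel)"
          using i1 i2 by (simp add: im)
        also have "\<bar>\<dots>\<bar> \<le> (\<integral>q. (C * \<epsilon> k) * K k (q - p) \<partial>lborel)"
        proof (rule integral_abs_bound_integral)
          show "\<bar>K k (q - p) * h l q - K k (q - p) * h l p\<bar> \<le> C * \<epsilon> k * K k (q - p)" for q
          proof (cases "norm (q - p) < \<epsilon> k")
            case True
            have "\<bar>K k (q - p) * h l q - K k (q - p) * h l p\<bar> = \<bar>h l q - h l p\<bar> * K k (q - p)"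
              using K[of k] by (simp add: abs_mult mollifier_def flip: right_diff_distrib)
            also have "\<dots> \<le> C * \<epsilon> k * K k (q - p)"
              using K[of k] near[OF True] by (intro mult_right_mono) (auto simp: mollifier_def)
            finally show ?thesis .
          next
            case False
            then show ?thesis using K[of k] by (simp add: mollifier_def)
          qed
        qed (use i1 i2 im in auto)
        also have "\<dots> = C * \<epsilon> k" by (simp add: im)
        finally show "\<bar>h l p - h k p\<bar> \<le> C * \<epsilon> k + \<eta>" using l(1) by linarith
      qed
    qed
    show ?thesis
    proof (rule metric_CauchyI)
      fix r :: real assume r: "r > 0"
      have "(\<lambda>k. C * \<epsilon> k) \<longlonglongrightarrow> C * 0" by (intro tendsto_mult tendsto_const \<epsilon>)
      then have "eventually (\<lambda>k. C * \<epsilon> k < r / 4) sequentially"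
        using r by (intro order_tendstoD(2)) auto
      moreover have "eventually (\<lambda>k. \<epsilon> k < \<rho> / 2) sequentially"
        using order_tendstoD(2)[OF \<epsilon>, of "\<rho> / 2"] \<rho>(1) by simp
      ultimately obtain k where k: "C * \<epsilon> k < r / 4" "\<epsilon> k < \<rho> / 2"
        using eventually_conj eventually_happens'[OF sequentially_bot] by (metis (mono_tags, lifting))
      obtain N where N: "\<And>l. l \<ge> N \<Longrightarrow> \<bar>h l p - h k p\<bar> \<le> C * \<epsilon> k + r / 8"
        using close[of k "r / 8"] k r by (auto simp: eventually_sequentially)
      have "dist (h m p) (h n p) < r" if "m \<ge> N" "n \<ge> N" for m n
        using N[OF that(1)] N[OF that(2)] k(1) r by (simp add: dist_real_def)
      then show "\<exists>M. \<forall>m\<ge>M. \<forall>n\<ge>M. dist (h m p) (h n p) < r" by blast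
    qed
  qed
  define u where "u p = lim (\<lambda>l. h l p)" for p
  have u: "(\<lambda>l. h l p) \<longlonglongrightarrow> u p" if "p \<in> D" for p
    unfolding u_def using cauchy[OF that] by (simp add: Cauchy_convergent_iff convergent_LIMSEQ_iff)
  have [measurable]: "u \<in> borel_measurable borel"
    unfolding u_def by (rule borel_measurable_lim_metric) measurable
  have uB: "\<bar>u p\<bar> \<le> B" if "p \<in> D" for p
    using LIMSEQ_le_const2[OF tendsto_rabs[OF u[OF that]]] hB by blast
  have ulip: "C-lipschitz_on D u"
  proof (rule lipschitz_onI)
    fix p q assume pq: "p \<in> D" "q \<in> D"
    then have "closed_segment p q \<subseteq> D" using D(2) closed_segment_subset by blast
    then obtain \<delta> where \<delta>: "\<delta> > 0" "(\<Union>x\<in>closed_segment p q. cball x \<delta>) \<subseteq> D"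
      using compact_subset_open_imp_cball_epsilon_subset[OF compact_segment D(1)] by metis
    have "eventually (\<lambda>l. \<epsilon> l < \<delta>) sequentially"
      using order_tendstoD(2)[OF \<epsilon>, of \<delta>] \<delta>(1) by simp
    then have "eventually (\<lambda>l. \<bar>h l q - h l p\<bar> \<le> C * norm (q - p)) sequentially"
    proof eventually_elim
      fix l assume l: "\<epsilon> l < \<delta>"
      show "\<bar>h l q - h l p\<bar> \<le> C * norm (q - p)"
      proof (rule lip)
        fix x assume x: "x \<in> closed_segment p q"
        have "cball x (\<epsilon> l) \<subseteq> cball x \<delta>" using l by auto
        then show "cball x (\<epsilon> l) \<subseteq> D" using \<delta>(2) x by blast
      qed
    qed
    moreover have "(\<lambda>l. \<bar>h l q - h l p\<bar>) \<longlonglongrightarrow> \<bar>u q - u p\<bar>"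
      by (intro tendsto_rabs tendsto_diff u pq)
    ultimately have "\<bar>u q - u p\<bar> \<le> C * norm (q - p)"
      using tendsto_upperbound trivial_limit_sequentially by blast
    then show "dist (u p) (u q) \<le> C * dist p q"
      by (simp add: dist_norm norm_minus_commute abs_minus_commute)
  qed (rule C0)
  \<comment> \<open>On a box in \<open>D\<close> both \<open>u\<close> and \<open>F\<close> are weak limits of the mollifications.\<close>
  have box: "AE x in lborel. x \<in> cbox a b \<longrightarrow> u x = F x" if sub: "cbox a b \<subseteq> D" for a b
  proof -
    let ?b = "\<lambda>p. indicator (cbox a b) p :: real"
    obtain R where R: "\<And>p. p \<in> cbox a b \<Longrightarrow> norm p < R"
      using bounded_cbox[of a b] unfolding bounded_pos_less by auto
    have orth: "(\<integral>p. (?b p * \<zeta> p) * (u p - F p) \<partial>lborel) = 0"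
      if cz: "continuous_on UNIV \<zeta>" and bz: "\<And>p. \<bar>\<zeta> p\<bar> \<le> 1" for \<zeta> :: "'b \<Rightarrow> real"
    proof -
      have [measurable]: "\<zeta> \<in> borel_measurable borel" by (rule borel_measurable_continuous_onI[OF cz])
      have bb: "\<bar>?b p * \<zeta> p\<bar> \<le> 1" for p using bz by (auto simp: indicator_def)
      have Rz: "?b p * \<zeta> p = 0" if "R \<le> norm p" for p using R[of p] that by (auto simp: indicator_def)
      have "(\<lambda>l. \<integral>p. (?b p * \<zeta> p) * h l p \<partial>lborel) \<longlonglongrightarrow> (\<integral>p. (?b p * \<zeta> p) * F p \<partial>lborel)"
        unfolding h_def
      proof (rule mollification_weak_limit[OF F K \<epsilon> _ bb Rz])
        have "frontier (cbox a b) \<in> null_sets lborel"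
          using negligible_convex_frontier[OF convex_box(1)[of a b]]
          by (subst null_sets_completion_iff[symmetric]) (simp_all add: negligible_iff_null_sets)
        then have "AE p in lborel. p \<notin> frontier (cbox a b)" by (rule AE_not_in)
        then show "AE p in lborel. isCont (\<lambda>p. ?b p * \<zeta> p) p"
        proof eventually_elim
          fix p assume p: "p \<notin> frontier (cbox a b)"
          have "isCont \<zeta> p" using cz by (simp add: continuous_on_eq_continuous_at)
          moreover have "isCont ?b p"
            using p by (simp add: isCont_indicator)
          ultimately show "isCont (\<lambda>p. ?b p * \<zeta> p) p" by (intro continuous_mult)
        qed
      qed auto
      moreover have "(\<lambda>l. \<integral>p. (?b p * \<zeta> p) * h l p \<partial>lborel) \<longlonglongrightarrow> (\<integral>p. (?b p * \<zeta> p) * u p \<partial>lborel)"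
      proof (rule integral_dominated_convergence)
        show "integrable lborel (\<lambda>p. B * ?b p)"
          by (intro integrable_mult_right integrable_real_indicator) (auto simp: emeasure_lborel_cbox_eq)
        show "AE p in lborel. (\<lambda>l. (?b p * \<zeta> p) * h l p) \<longlonglongrightarrow> (?b p * \<zeta> p) * u p"
          using u sub by (intro AE_I2) (auto simp: indicator_def intro!: tendsto_mult_left)
        show "AE p in lborel. norm ((?b p * \<zeta> p) * h l p) \<le> B * ?b p" for l
          using mult_mono[OF bz hB[of l]] by (intro AE_I2) (auto simp: indicator_def abs_mult)
      qed auto
      ultimately have eq: "(\<integral>p. (?b p * \<zeta> p) * u p \<partial>lborel) = (\<integral>p. (?b p * \<zeta> p) * F p \<partial>lborel)"
        by (rule LIMSEQ_unique[rotated])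
      have iB: "integrable lborel (\<lambda>p. B * ?b p)"
        by (intro integrable_mult_right integrable_real_indicator) (auto simp: emeasure_lborel_cbox_eq)
      have "B \<ge> 0" using FB[of 0] by linarith
      then have nb: "norm ((?b p * \<zeta> p) * u p) \<le> norm (B * ?b p)"
          "norm ((?b p * \<zeta> p) * F p) \<le> norm (B * ?b p)" for p
        using mult_mono[OF bz uB, of p p] mult_mono[OF bz FB, of p p] sub
        by (auto simp: indicator_def abs_mult)
      have "integrable lborel (\<lambda>p. (?b p * \<zeta> p) * u p)" "integrable lborel (\<lambda>p. (?b p * \<zeta> p) * F p)"
        by (rule Bochner_Integration.integrable_bound[OF iB], measurable, rule AE_I2, rule nb)+
      then show ?thesis using eq by (simp add: right_diff_distrib)
    qed
    \<comment> \<open>The sign of \<open>u - F\<close> is not continuous, but it is an almost everywhere limit of bounded continuous functions.\<close>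
    define w where "w p = sgn (u p - F p)" for p
    have "w \<in> borel_measurable lebesgue"
      unfolding w_def by (intro measurable_completion) measurable
    then have "w measurable_on UNIV" by (rule lebesgue_measurable_imp_measurable_on) auto
    then obtain N g where N: "negligible N" and gc: "\<And>n. continuous_on UNIV (g n)"
      and gl: "\<And>x. x \<notin> N \<Longrightarrow> (\<lambda>n. g n x) \<longlonglongrightarrow> w x"
      unfolding measurable_on_def by auto
    define z where "z n p = max (-1) (min 1 (g n p))" for n p
    have zc: "continuous_on UNIV (z n)" for n
      unfolding z_def by (intro continuous_intros gc)
    have [measurable]: "z n \<in> borel_measurable borel" for n by (rule borel_measurable_continuous_onI[OF zc])
    have z1: "\<bar>z n p\<bar> \<le> 1" for n p by (auto simp: z_def)
    have "AE p in lborel. p \<notin> N"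
      using AE_not_in[of N lebesgue] N by (simp add: negligible_iff_null_sets AE_completion_iff)
    then have zl: "AE p in lborel. (\<lambda>n. z n p) \<longlonglongrightarrow> w p"
    proof eventually_elim
      fix p assume "p \<notin> N"
      then have "(\<lambda>n. z n p) \<longlonglongrightarrow> max (-1) (min 1 (w p))"
        unfolding z_def by (intro tendsto_max tendsto_min tendsto_const gl)
      then show "(\<lambda>n. z n p) \<longlonglongrightarrow> w p" by (simp add: w_def sgn_if split: if_splits)
    qed
    have i2B: "integrable lborel (\<lambda>p. (2 * B) * ?b p)"
      by (intro integrable_mult_right integrable_real_indicator) (auto simp: emeasure_lborel_cbox_eq)
    have uF: "\<bar>u p - F p\<bar> \<le> 2 * B" if "p \<in> cbox a b" for p
      using uB[of p] FB[of p] that sub by auto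
    have "(\<lambda>n. \<integral>p. (?b p * z n p) * (u p - F p) \<partial>lborel) \<longlonglongrightarrow> (\<integral>p. (?b p * w p) * (u p - F p) \<partial>lborel)"
    proof (rule integral_dominated_convergence[OF _ _ i2B])
      show "AE p in lborel. (\<lambda>n. (?b p * z n p) * (u p - F p)) \<longlonglongrightarrow> (?b p * w p) * (u p - F p)"
        using zl by eventually_elim (intro tendsto_mult tendsto_const)
      show "AE p in lborel. norm ((?b p * z n p) * (u p - F p)) \<le> (2 * B) * ?b p" for n
        using mult_mono[OF z1 uF] by (intro AE_I2) (auto simp: indicator_def abs_mult)
    qed (auto simp: w_def)
    moreover have "(\<integral>p. (?b p * z n p) * (u p - F p) \<partial>lborel) = 0" for n
      by (rule orth[OF zc z1])
    ultimately have "(\<integral>p. (?b p * w p) * (u p - F p) \<partial>lborel) = 0"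
      by (simp add: LIMSEQ_const_iff)
    moreover have "(?b p * w p) * (u p - F p) = ?b p * \<bar>u p - F p\<bar>" for p
      by (simp add: w_def sgn_mult_self_eq abs_sgn mult.commute)
    ultimately have "(\<integral>p. ?b p * \<bar>u p - F p\<bar> \<partial>lborel) = 0" by simp
    moreover have "integrable lborel (\<lambda>p. ?b p * \<bar>u p - F p\<bar>)"
      by (rule Bochner_Integration.integrable_bound[OF i2B])
         (use order_trans[OF uF abs_ge_self] in \<open>auto simp: indicator_def intro!: AE_I2\<close>)
    ultimately have "AE p in lborel. ?b p * \<bar>u p - F p\<bar> = 0"
      by (subst (asm) integral_nonneg_eq_0_iff_AE) auto
    then show ?thesis by eventually_elim (auto simp: indicator_def)
  qed
  obtain \<D> where \<D>: "countable \<D>" "\<D> \<subseteq> Pow D" "\<And>X. X \<in> \<D> \<Longrightarrow> \<exists>a b. X = cbox a b" "\<Union>\<D> = D"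
    by (rule open_countable_Union_open_cbox[OF D(1)]) blast
  have "AE x in lborel. x \<in> X \<longrightarrow> u x = F x" if X: "X \<in> \<D>" for X
  proof -
    obtain a b where "X = cbox a b" using \<D>(3)[OF X] by blast
    then show ?thesis using box[of a b] \<D>(2) X by auto
  qed
  then have "AE x in lborel. \<forall>X\<in>\<D>. x \<in> X \<longrightarrow> u x = F x"
    by (rule AE_ball_countable'[OF _ \<D>(1)])
  then have "AE x in lborel. x \<in> D \<longrightarrow> u x = F x"
    by eventually_elim (use \<D>(4) in blast)
  with ulip show ?thesis by (intro exI[of _ u]) simp
qed

section \<open>Tensor-product test functions\<close>

lemma smooth_compose_linear:
  assumes A: "bounded_linear A" and f: "smooth f"
  shows "smooth (\<lambda>x. f (A x))"
proof -
  have "Ck k f \<Longrightarrow> Ck k (\<lambda>x. f (A x))" for k f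
  proof (induction k arbitrary: f)
    case 0
    then show ?case
      using continuous_on_compose2[of UNIV f UNIV A] linear_continuous_on[OF A] by auto
  next
    case (Suc k)
    note D0 = Ck_Suc_has_derivative[OF Suc.prems]
    have D: "((\<lambda>x. f (A x)) has_derivative (\<lambda>h. frechet_derivative f (at (A x)) (A h))) (at x)" for x
      using has_derivative_compose[OF bounded_linear_imp_has_derivative[OF A] D0] .
    have E: "frechet_derivative f (at y) h = (\<Sum>j\<in>Basis. (h \<bullet> j) * frechet_derivative f (at y) j)" for y h
    proof -
      have "frechet_derivative f (at y) h = grad f y \<bullet> h"
        using frechet_derivative_eq_grad D0 differentiableI by blast
      then show ?thesis by (simp add: grad_def inner_sum_left inner_sum_right inner_commute mult.commute)
    qed
    show ?case
    proof (rule Ck_SucI[OF D])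
      show "Ck k (\<lambda>x. frechet_derivative f (at (A x)) (A i))" for i
        by (subst E) (use Suc in \<open>auto intro!: Ck_sum Ck_mult Ck_const\<close>)
    qed
  qed
  then show ?thesis using f by (auto simp: smooth_def)
qed

lemma integrable_lborel_product:
  fixes a :: "'a::euclidean_space \<Rightarrow> real" and b :: "'b::euclidean_space \<Rightarrow> real"
  assumes a: "integrable lborel a" and b: "integrable lborel b"
  shows "integrable lborel (\<lambda>p. a (fst p) * b (snd p))"
    and "(\<integral>p. a (fst p) * b (snd p) \<partial>lborel) = integral\<^sup>L lborel a * integral\<^sup>L lborel b"
proof -
  have [measurable]: "a \<in> borel_measurable borel" "b \<in> borel_measurable borel" using a b by auto
  have i: "integrable (lborel \<Otimes>\<^sub>M lborel) (\<lambda>p. a (fst p) * b (snd p))"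
    by (intro lborel_pair.Fubini_integrable) (auto simp: a b abs_mult)
  then show "integrable lborel (\<lambda>p. a (fst p) * b (snd p))" by (simp add: lborel_prod)
  show "(\<integral>p. a (fst p) * b (snd p) \<partial>lborel) = integral\<^sup>L lborel a * integral\<^sup>L lborel b"
    using lborel_pair.integral_fst'[OF i] by (simp add: lborel_prod)
qed

lemma mollifier_tensor:
  assumes a: "mollifier \<epsilon> a" and b: "mollifier \<epsilon> b"
  shows "mollifier (2 * \<epsilon>) (\<lambda>p. a (fst p) * b (snd p))"
proof -
  have "a (fst p) * b (snd p) = 0" if "2 * \<epsilon> \<le> norm p" for p
  proof -
    have "norm p \<le> norm (fst p) + norm (snd p)" using norm_Pair_le[of "fst p" "snd p"] by simp
    then have "\<epsilon> \<le> norm (fst p) \<or> \<epsilon> \<le> norm (snd p)" using that by linarith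
    then show ?thesis using a b by (auto simp: mollifier_def)
  qed
  moreover have "smooth (\<lambda>p. a (fst p) * b (snd p))"
    using a b unfolding mollifier_def
    by (intro smooth_mult smooth_compose_linear[OF bounded_linear_fst] smooth_compose_linear[OF bounded_linear_snd]) auto
  ultimately show ?thesis
    using a b integrable_lborel_product[of a b] unfolding mollifier_def by auto
qed

lemma grad_tensor:
  assumes a: "smooth (a :: real \<Rightarrow> real)" and b: "smooth b"
  shows "grad (\<lambda>p. a (fst p) * b (snd p)) p = (deriv a (fst p) * b (snd p), a (fst p) *\<^sub>R grad b (snd p))"
proof (rule has_derivative_imp_grad_eq)
  have A: "((\<lambda>p. a (fst p)) has_derivative (\<lambda>h. deriv a (fst p) * fst h)) (at p)"
    by (rule has_derivative_compose[OF has_derivative_fst[OF has_derivative_ident]])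
       (rule smooth_DERIV[OF a, unfolded has_field_derivative_def])
  have B: "((\<lambda>p. b (snd p)) has_derivative (\<lambda>h. grad b (snd p) \<bullet> snd h)) (at p)"
    by (rule has_derivative_compose[OF has_derivative_snd[OF has_derivative_ident] smooth_has_grad[OF b]])
  show "((\<lambda>p. a (fst p) * b (snd p)) has_derivative
        (\<lambda>h. (deriv a (fst p) * b (snd p), a (fst p) *\<^sub>R grad b (snd p)) \<bullet> h)) (at p)"
    using has_derivative_mult[OF A B]
    by (rule has_derivative_eq_rhs) (auto simp: fun_eq_iff inner_prod_def algebra_simps)
qed

lemma deriv_translate:
  assumes "smooth (f :: real \<Rightarrow> real)"
  shows "deriv (\<lambda>t. f (t - s)) t = deriv f (t - s)"
proof (rule DERIV_imp_deriv)
  have "((\<lambda>t. t - s) has_real_derivative 1) (at t)" by (auto intro!: derivative_eq_intros)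
  from DERIV_chain2[OF smooth_DERIV[OF assms] this]
  show "((\<lambda>t. f (t - s)) has_real_derivative deriv f (t - s)) (at t)" by simp
qed

text \<open>The product of a mollifier in time and a mollifier in space is a mollifier on space-time, so the
  translated mollifiers that determine a weak derivative can be chosen as products.\<close>

lemma weak_gradient_from_tensor_products:
  fixes F :: "real \<times> 'a::euclidean_space \<Rightarrow> real" and H :: "real \<times> 'a \<Rightarrow> real \<times> 'a"
  assumes W: "open W" and F: "integrable lborel F" and H: "integrable lborel H"
    and time: "\<And>\<phi> v. test_fun {a<..<b} \<phi> \<Longrightarrow> test_fun W v \<Longrightarrow>
      (\<integral>p. F p * (deriv \<phi> (fst p) * v (snd p)) \<partial>lborel) = - (\<integral>p. fst (H p) * (\<phi> (fst p) * v (snd p)) \<partial>lborel)"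
    and space: "\<And>\<phi> v j. test_fun {a<..<b} \<phi> \<Longrightarrow> test_fun W v \<Longrightarrow> j \<in> Basis \<Longrightarrow>
      (\<integral>p. F p * (\<phi> (fst p) * (grad v (snd p) \<bullet> j)) \<partial>lborel) = - (\<integral>p. (snd (H p) \<bullet> j) * (\<phi> (fst p) * v (snd p)) \<partial>lborel)"
    and \<psi>: "test_fun ({a<..<b} \<times> W) \<psi>" and i: "i \<in> Basis"
  shows "(\<integral>p. (grad \<psi> p \<bullet> i) * F p \<partial>lborel) = - (\<integral>p. \<psi> p * (H p \<bullet> i) \<partial>lborel)"
proof -
  define \<epsilon> where "\<epsilon> k = 1 / real (Suc k)" for k
  have \<epsilon>0: "\<epsilon> k > 0" for k by (simp add: \<epsilon>_def)
  have "\<epsilon> \<longlonglongrightarrow> 0" unfolding \<epsilon>_def using LIMSEQ_inverse_real_of_nat by (simp add: inverse_eq_divide)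
  from tendsto_mult_left[OF this, of 2] have \<epsilon>: "(\<lambda>k. 2 * \<epsilon> k) \<longlonglongrightarrow> 0" by simp
  obtain A :: "nat \<Rightarrow> real \<Rightarrow> real" where A: "\<And>k. mollifier (\<epsilon> k) (A k)"
    using mollifier_exists[OF \<epsilon>0] by metis
  obtain B :: "nat \<Rightarrow> 'a \<Rightarrow> real" where B: "\<And>k. mollifier (\<epsilon> k) (B k)"
    using mollifier_exists[OF \<epsilon>0] by metis
  have sA: "smooth (A k)" and sB: "smooth (B k)" for k using A[of k] B[of k] by (auto simp: mollifier_def)
  show ?thesis
  proof (rule weak_derivative_from_mollifiers[OF _ F _ mollifier_tensor[OF A B] \<epsilon> _ \<psi>])
    show "open ({a<..<b} \<times> W)" using W by (intro open_Times) auto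
    show "integrable lborel (\<lambda>p. H p \<bullet> i)" using H by simp
    fix k p assume sub: "cball p (2 * \<epsilon> k) \<subseteq> {a<..<b} \<times> W"
    obtain s y where p: "p = (s, y)" by (cases p)
    have "cball s (\<epsilon> k) \<times> cball y (\<epsilon> k) \<subseteq> cball p (2 * \<epsilon> k)"
    proof safe
      fix t x assume "t \<in> cball s (\<epsilon> k)" "x \<in> cball y (\<epsilon> k)"
      then show "(t, x) \<in> cball p (2 * \<epsilon> k)"
        using norm_Pair_le[of "s - t" "y - x"] by (simp add: p dist_norm)
    qed
    with sub have sub': "cball s (\<epsilon> k) \<times> cball y (\<epsilon> k) \<subseteq> {a<..<b} \<times> W" by blast
    have "cball s (\<epsilon> k) \<noteq> {}" "cball y (\<epsilon> k) \<noteq> {}" using \<epsilon>0[of k] by auto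
    with sub' have "cball s (\<epsilon> k) \<subseteq> {a<..<b}" "cball y (\<epsilon> k) \<subseteq> W" by (auto simp: times_subset_iff)
    then have t: "test_fun {a<..<b} (\<lambda>t. A k (t - s))" "test_fun W (\<lambda>x. B k (x - y))"
      using mollifier_test_fun A B by blast+
    from i consider "i = (1, 0)" | j where "j \<in> Basis" "i = (0, j)" by (auto simp: Basis_prod_def)
    then show "(\<integral>q. F q * (grad (\<lambda>p. A k (fst p) * B k (snd p)) (q - p) \<bullet> i) \<partial>lborel)
        = - (\<integral>q. (H q \<bullet> i) * (A k (fst (q - p)) * B k (snd (q - p))) \<partial>lborel)"
    proof cases
      case 1
      then show ?thesis
        using time[OF t] by (simp add: grad_tensor[OF sA sB] deriv_translate[OF sA] p inner_prod_def)
    next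
      case 2
      then show ?thesis
        using space[OF t 2(1)] by (simp add: grad_tensor[OF sA sB] grad_translate[OF sB] p inner_prod_def)
    qed
  qed
qed

section \<open>Disintegration over Lebesgue measure\<close>

text \<open>Integrands that are merely Lebesgue measurable in the base variable are measurable for the
  completion of \<open>M\<close> but not for \<open>M\<close>. The defining formula of a disintegration, which speaks of Borel
  sets, is therefore extended to the measurable space \<open>lebesgue \<Otimes>\<^sub>M borel\<close>.\<close>

locale disintegrated_measure =
  fixes S :: "'b::euclidean_space set" and E :: "'c::euclidean_space set"
    and M :: "('b \<times> 'c) measure" and \<mu> :: "'b \<Rightarrow> 'c measure"
  assumes S: "S \<in> sets borel" "S \<noteq> {}" and E: "E \<in> sets borel"
    and M: "sets M = sets borel" "finite_measure M"
    and dis: "disintegration S E M \<mu>"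
begin

abbreviation "LS \<equiv> lebesgue_on S"

lemma prob: "p \<in> S \<Longrightarrow> prob_space (\<mu> p)" "p \<in> S \<Longrightarrow> sets (\<mu> p) = sets borel" "p \<in> S \<Longrightarrow> space (\<mu> p) = UNIV"
proof -
  assume p: "p \<in> S"
  then have *: "prob_measure_on E (\<mu> p)" using dis by (simp add: disintegration_def)
  then show s: "sets (\<mu> p) = sets borel" by (simp add: prob_measure_on_def)
  show "space (\<mu> p) = UNIV" using sets_eq_imp_space_eq[OF s] by simp
  then show "prob_space (\<mu> p)" using * by (intro prob_spaceI) (simp add: prob_measure_on_def)
qed

lemma AE_support: "p \<in> S \<Longrightarrow> AE \<xi> in \<mu> p. \<xi> \<in> E"
proof -
  assume p: "p \<in> S"
  then have "emeasure (\<mu> p) (- E) = 0" using dis by (simp add: disintegration_def prob_measure_on_def)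
  moreover have "- E \<in> sets (\<mu> p)" using E prob(2)[OF p] by auto
  ultimately have "- E \<in> null_sets (\<mu> p)" by auto
  from AE_not_in[OF this] show ?thesis by simp
qed

lemma kernel: "\<mu> \<in> LS \<rightarrow>\<^sub>M subprob_algebra borel"
proof (rule measurable_subprob_algebra)
  show "subprob_space (\<mu> a)" if "a \<in> space LS" for a
    using prob(1) that by (intro prob_space_imp_subprob_space) (auto simp: space_restrict_space)
qed (use dis prob in \<open>auto simp: disintegration_def space_restrict_space\<close>)

lemma measure_M: "C \<in> sets borel \<Longrightarrow> emeasure M C = (\<integral>\<^sup>+p. emeasure (\<mu> p) {\<xi>. (p, \<xi>) \<in> C} \<partial>LS)"
  using dis by (simp add: disintegration_def)

lemma AE_LS:
  assumes "AE p in lebesgue. P p"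
  shows "AE p in LS. P p"
proof -
  have "S \<inter> space lebesgue \<in> sets lebesgue" using S by auto
  from AE_restrict_space_iff[OF this] show ?thesis using assms by (auto elim: eventually_mono)
qed

text \<open>A Lebesgue null set is contained in a Borel null set, and the disintegration formula shows that
  the cylinder over the latter is a null set of \<open>M\<close>.\<close>

lemma AE_base:
  assumes "AE p in LS. P p"
  shows "AE x in M. fst x \<in> S \<and> P (fst x)"
proof -
  have SL: "S \<in> sets lebesgue" using S by auto
  from assms obtain N where N: "{p \<in> space LS. \<not> P p} \<subseteq> N" "emeasure LS N = 0" "N \<in> sets LS"
    by (rule AE_E)
  have NS: "N \<subseteq> S" using sets.sets_into_space[OF N(3)] by (simp add: space_restrict_space)
  have "N \<in> null_sets lebesgue"
    using N SL NS by (auto simp: null_sets_def emeasure_restrict_space sets_restrict_space_iff)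
  then obtain N' where N': "N' \<in> null_sets lborel" "N \<subseteq> N'"
    unfolding null_sets_completion_iff2 by auto
  let ?C = "(N' \<union> - S) \<times> (UNIV :: 'c set)"
  have C: "?C \<in> sets borel" using null_setsD2[OF N'(1)] S by (intro borel_Times) auto
  have "emeasure M ?C = (\<integral>\<^sup>+p. emeasure (\<mu> p) {\<xi>. (p, \<xi>) \<in> ?C} \<partial>LS)" by (rule measure_M[OF C])
  also have "\<dots> = (\<integral>\<^sup>+p. 0 \<partial>LS)"
  proof (rule nn_integral_cong_AE)
    have "N' \<in> null_sets lebesgue" using N'(1) by (rule null_sets_completionI)
    then have "AE p in lebesgue. p \<notin> N'" by (rule AE_not_in)
    then have "AE p in LS. p \<notin> N'" by (rule AE_LS)
    with AE_space show "AE p in LS. emeasure (\<mu> p) {\<xi>. (p, \<xi>) \<in> ?C} = 0"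
      by eventually_elim (simp add: space_restrict_space)
  qed
  finally have "?C \<in> null_sets M" using C M by (auto simp: null_sets_def)
  from AE_not_in[OF this] show ?thesis
  proof eventually_elim
    case (elim x)
    then have "fst x \<in> S" "fst x \<notin> N'" by (auto simp: mem_Times_iff)
    then show ?case using N(1) N'(2) by (auto simp: space_restrict_space)
  qed
qed

lemma measurable_pairing: "(\<lambda>x. x) \<in> completion M \<rightarrow>\<^sub>M lebesgue \<Otimes>\<^sub>M borel"
proof (rule measurable_pair)
  have m: "fst \<in> completion M \<rightarrow>\<^sub>M lborel" "snd \<in> completion M \<rightarrow>\<^sub>M borel"
    using M by (auto intro!: measurable_completion simp: borel_prod[symmetric] cong: measurable_cong_sets)
  show "snd \<circ> (\<lambda>x. x) \<in> completion M \<rightarrow>\<^sub>M borel" using m(2) by (simp add: comp_def)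
  have "fst \<in> completion M \<rightarrow>\<^sub>M lebesgue"
  proof (rule complete_measure.measurable_completion2[OF completion.complete_measure_axioms m(1)])
    show "null_sets lborel \<subseteq> null_sets (distr (completion M) lborel fst)"
    proof
      fix N :: "'b set" assume N: "N \<in> null_sets lborel"
      then have "AE p in lebesgue. p \<notin> N" by (intro AE_not_in null_sets_completionI)
      then have "AE p in LS. p \<notin> N" by (rule AE_LS)
      from AE_base[OF this] have "AE x in M. x \<notin> fst -` N" by eventually_elim auto
      moreover have "fst -` N \<in> sets M"
        using null_setsD2[OF N] M borel_Times[of N UNIV] by (simp add: vimage_fst)
      ultimately have "fst -` N \<in> null_sets M"
        by (simp add: AE_iff_null_sets)
      then show "N \<in> null_sets (distr (completion M) lborel fst)"
        using N m(1) M sets_eq_imp_space_eq[OF M(1)] by (auto simp: null_sets_def emeasure_distr)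
    qed
  qed
  then show "fst \<circ> (\<lambda>x. x) \<in> completion M \<rightarrow>\<^sub>M lebesgue" by (simp add: comp_def)
qed

lemma measurable_restricted_base:
  "(\<lambda>x. x) \<in> LS \<Otimes>\<^sub>M borel \<rightarrow>\<^sub>M lebesgue \<Otimes>\<^sub>M (borel :: 'c measure)"
proof (rule measurable_pair)
  have "(\<lambda>x. x) \<in> LS \<rightarrow>\<^sub>M lebesgue" by (rule measurable_restrict_space1) simp
  from measurable_compose[OF measurable_fst this]
  show "fst \<circ> (\<lambda>x. x) \<in> LS \<Otimes>\<^sub>M (borel :: 'c measure) \<rightarrow>\<^sub>M lebesgue" by (simp add: comp_def)
qed (simp add: comp_def)

lemma kernel_pair: "(\<lambda>p. distr (\<mu> p) (lebesgue \<Otimes>\<^sub>M borel) (Pair p)) \<in> LS \<rightarrow>\<^sub>M subprob_algebra (lebesgue \<Otimes>\<^sub>M borel)"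
proof (rule measurable_distr2[OF _ kernel])
  show "case_prod Pair \<in> LS \<Otimes>\<^sub>M (borel :: 'c measure) \<rightarrow>\<^sub>M lebesgue \<Otimes>\<^sub>M borel"
    using measurable_restricted_base by (simp add: id_def)
qed

lemma measurable_Pair_fiber:
  assumes "p \<in> S"
  shows "Pair p \<in> \<mu> p \<rightarrow>\<^sub>M lebesgue \<Otimes>\<^sub>M borel"
  using measurable_Pair1'[of p lebesgue borel] prob(2)[OF assms] by (simp cong: measurable_cong_sets)

text \<open>It suffices to compare finite measures on products of a Lebesgue set and a Borel set. The
  Lebesgue set may be replaced by a Borel set up to a null set, which both sides ignore. As a bind of
  kernels the measure obeys the iterated integral formula of the Giry monad.\<close>

lemma distr_eq_bind:
  "distr (completion M) (lebesgue \<Otimes>\<^sub>M borel) (\<lambda>x. x) = LS \<bind> (\<lambda>p. distr (\<mu> p) (lebesgue \<Otimes>\<^sub>M borel) (Pair p))"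
  (is "?L = ?R")
proof (rule measure_eqI_generator_eq[OF Int_stable_pair_measure_generator[of lebesgue borel], of UNIV _ _ "\<lambda>_. UNIV"])
  let ?G = "{a \<times> b |a b. a \<in> sets (lebesgue :: 'b measure) \<and> b \<in> sets (borel :: 'c measure)}"
  have sp: "space LS \<noteq> {}" using S by (simp add: space_restrict_space)
  have SL: "S \<in> sets lebesgue" using S by auto
  show "?G \<subseteq> Pow UNIV" by simp
  show "sets ?L = sigma_sets UNIV ?G"
    by (simp add: sets_pair_measure)
  show "sets ?R = sigma_sets UNIV ?G"
    using sets_bind[OF sets_kernel[OF kernel_pair] sp] by (simp add: sets_pair_measure)
  show "range (\<lambda>_::nat. UNIV) \<subseteq> ?G"
  proof (rule image_subsetI)
    show "(UNIV :: ('b \<times> 'c) set) \<in> ?G"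
      by (intro CollectI exI[of _ UNIV] conjI) auto
  qed
  show "(\<Union>i::nat. UNIV) = UNIV" by simp
  interpret M: finite_measure M by (rule M)
  have U: "UNIV \<in> sets (lebesgue \<Otimes>\<^sub>M (borel :: 'c measure) :: ('b \<times> 'c) measure)"
    using sets.top[of "lebesgue \<Otimes>\<^sub>M (borel :: 'c measure) :: ('b \<times> 'c) measure"] by (simp add: space_pair_measure)
  have "emeasure ?L UNIV = emeasure (completion M) UNIV"
    using sets_eq_imp_space_eq[OF M(1)] by (subst emeasure_distr[OF measurable_pairing U]) simp
  also have "\<dots> = emeasure M UNIV" using M(1) by simp
  finally show "emeasure ?L UNIV \<noteq> \<infinity>" using M.emeasure_finite by simp
  fix X :: "('b \<times> 'c) set" assume "X \<in> ?G"
  then obtain A B where X: "X = A \<times> B" and A: "A \<in> sets lebesgue" and B: "B \<in> sets borel" by blast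
  obtain A' N' N where A': "A = A' \<union> N'" "N' \<subseteq> N" "N \<in> null_sets lborel" "A' \<in> sets lborel"
    using A by (rule sets_completionE)
  have XL: "A \<times> B \<in> sets (lebesgue \<Otimes>\<^sub>M borel)" using A B by simp
  have A'B: "A' \<times> B \<in> sets borel" using A' B by (simp add: borel_prod[symmetric])
  have "AE p in lebesgue. p \<notin> N" using A' by (intro AE_not_in null_sets_completionI)
  then have N: "AE p in LS. p \<notin> N" by (rule AE_LS)
  have XM: "A \<times> B \<in> sets (completion M)"
    using measurable_sets[OF measurable_pairing XL] sets_eq_imp_space_eq[OF M(1)] by simp
  have "emeasure ?L X = emeasure (completion M) (A \<times> B)"
    using sets_eq_imp_space_eq[OF M(1)] unfolding X by (subst emeasure_distr[OF measurable_pairing XL]) simp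
  also have "\<dots> = emeasure (completion M) (A' \<times> B)"
  proof (rule emeasure_eq_AE[OF _ XM])
    have "AE x in completion M. fst x \<notin> N"
      by (rule AE_completion) (use AE_base[OF N] in eventually_elim, simp)
    then show "AE x in completion M. x \<in> A \<times> B \<longleftrightarrow> x \<in> A' \<times> B"
      by eventually_elim (use A' in \<open>auto simp: mem_Times_iff\<close>)
    show "A' \<times> B \<in> sets (completion M)" using A'B M by auto
  qed
  also have "\<dots> = emeasure M (A' \<times> B)" using A'B M by simp
  also have "\<dots> = (\<integral>\<^sup>+p. emeasure (\<mu> p) {\<xi>. (p, \<xi>) \<in> A' \<times> B} \<partial>LS)" by (rule measure_M[OF A'B])
  also have "\<dots> = (\<integral>\<^sup>+p. emeasure (distr (\<mu> p) (lebesgue \<Otimes>\<^sub>M borel) (Pair p)) X \<partial>LS)"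
  proof (rule nn_integral_cong_AE)
    from N AE_space show "AE p in LS. emeasure (\<mu> p) {\<xi>. (p, \<xi>) \<in> A' \<times> B}
        = emeasure (distr (\<mu> p) (lebesgue \<Otimes>\<^sub>M borel) (Pair p)) X"
    proof eventually_elim
      fix p assume p: "p \<notin> N" "p \<in> space LS"
      then have pS: "p \<in> S" by (simp add: space_restrict_space)
      have "Pair p \<in> \<mu> p \<rightarrow>\<^sub>M lebesgue \<Otimes>\<^sub>M borel"
        by (rule measurable_Pair_fiber[OF pS])
      then show "emeasure (\<mu> p) {\<xi>. (p, \<xi>) \<in> A' \<times> B} = emeasure (distr (\<mu> p) (lebesgue \<Otimes>\<^sub>M borel) (Pair p)) X"
        using XL p A' prob(3)[OF pS] unfolding X
        by (subst emeasure_distr) (auto intro!: arg_cong2[where f=emeasure])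
    qed
  qed
  also have "\<dots> = emeasure ?R X"
    by (rule emeasure_bind[OF sp kernel_pair, symmetric]) (simp add: X XL)
  finally show "emeasure ?L X = emeasure ?R X" .
qed

lemma nn_integral_disintegration:
  assumes f: "f \<in> borel_measurable (lebesgue \<Otimes>\<^sub>M borel)"
  shows "(\<integral>\<^sup>+x. f x \<partial>completion M) = (\<integral>\<^sup>+p. (\<integral>\<^sup>+\<xi>. f (p, \<xi>) \<partial>\<mu> p) \<partial>LS)"
proof -
  have "(\<integral>\<^sup>+x. f x \<partial>completion M) = (\<integral>\<^sup>+x. f x \<partial>distr (completion M) (lebesgue \<Otimes>\<^sub>M borel) (\<lambda>x. x))"
    using f by (subst nn_integral_distr[OF measurable_pairing]) auto
  also have "\<dots> = (\<integral>\<^sup>+p. (\<integral>\<^sup>+x. f x \<partial>distr (\<mu> p) (lebesgue \<Otimes>\<^sub>M borel) (Pair p)) \<partial>LS)"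
    unfolding distr_eq_bind by (rule nn_integral_bind[OF f kernel_pair])
  also have "\<dots> = (\<integral>\<^sup>+p. (\<integral>\<^sup>+\<xi>. f (p, \<xi>) \<partial>\<mu> p) \<partial>LS)"
  proof (rule nn_integral_cong)
    fix p assume "p \<in> space LS"
    then have "p \<in> S" by (simp add: space_restrict_space)
    then have "Pair p \<in> \<mu> p \<rightarrow>\<^sub>M lebesgue \<Otimes>\<^sub>M borel"
      by (rule measurable_Pair_fiber)
    then show "(\<integral>\<^sup>+x. f x \<partial>distr (\<mu> p) (lebesgue \<Otimes>\<^sub>M borel) (Pair p)) = (\<integral>\<^sup>+\<xi>. f (p, \<xi>) \<partial>\<mu> p)"
      using f by (subst nn_integral_distr) auto
  qed
  finally show ?thesis .
qed

lemma nn_integral_measurable: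
  assumes "f \<in> borel_measurable (lebesgue \<Otimes>\<^sub>M borel)"
  shows "(\<lambda>p. \<integral>\<^sup>+\<xi>. f (p, \<xi>) \<partial>\<mu> p) \<in> borel_measurable LS"
proof (rule nn_integral_measurable_subprob_algebra2[OF _ kernel])
  from measurable_compose[OF measurable_restricted_base assms]
  show "(\<lambda>(x, y). f (x, y)) \<in> borel_measurable (LS \<Otimes>\<^sub>M borel)" by simp
qed

lemma fiber_measurable:
  assumes "f \<in> borel_measurable (lebesgue \<Otimes>\<^sub>M borel)" "p \<in> S"
  shows "(\<lambda>\<xi>. f (p, \<xi>)) \<in> borel_measurable (\<mu> p)"
  using measurable_compose[OF measurable_Pair1'[of p lebesgue borel] assms(1)] prob(2)[OF assms(2)]
  by (simp cong: measurable_cong_sets)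

lemma fiber_integrable:
  fixes g :: "'c \<Rightarrow> 'd::{banach, second_countable_topology}"
  assumes "p \<in> S" "g \<in> borel_measurable borel" "\<And>\<xi>. \<xi> \<in> E \<Longrightarrow> norm (g \<xi>) \<le> B"
  shows "integrable (\<mu> p) g"
proof -
  interpret prob_space "\<mu> p" by (rule prob(1)[OF assms(1)])
  show ?thesis
  proof (rule integrable_const_bound)
    show "AE x in \<mu> p. norm (g x) \<le> B" using AE_support[OF assms(1)] by eventually_elim (rule assms(3))
    show "g \<in> borel_measurable (\<mu> p)" using assms(2) prob(2)[OF assms(1)] by (simp cong: measurable_cong_sets)
  qed
qed

lemma fiber_integral_bound:
  fixes g :: "'c \<Rightarrow> 'd::{banach, second_countable_topology}"
  assumes "p \<in> S" "g \<in> borel_measurable borel" "\<And>\<xi>. \<xi> \<in> E \<Longrightarrow> norm (g \<xi>) \<le> B"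
  shows "norm (\<integral>\<xi>. g \<xi> \<partial>\<mu> p) \<le> B"
proof -
  interpret prob_space "\<mu> p" by (rule prob(1)[OF assms(1)])
  have "norm (\<integral>\<xi>. g \<xi> \<partial>\<mu> p) \<le> (\<integral>\<xi>. norm (g \<xi>) \<partial>\<mu> p)" by (rule integral_norm_bound)
  also have "\<dots> \<le> (\<integral>\<xi>. B \<partial>\<mu> p)"
    by (rule integral_mono_AE) (use fiber_integrable[OF assms] AE_support[OF assms(1)] assms(3) in auto)
  finally show ?thesis by (simp add: prob_space)
qed

lemma fiber_integral_measurable:
  fixes f :: "'b \<times> 'c \<Rightarrow> real"
  assumes f: "f \<in> borel_measurable (lebesgue \<Otimes>\<^sub>M borel)"
  shows "(\<lambda>p. \<integral>\<xi>. f (p, \<xi>) \<partial>\<mu> p) \<in> borel_measurable LS"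
proof -
  have m: "(\<lambda>p. \<integral>\<^sup>+\<xi>. ennreal (g (p, \<xi>)) \<partial>\<mu> p) \<in> borel_measurable LS"
    if "g \<in> borel_measurable (lebesgue \<Otimes>\<^sub>M borel)" for g :: "'b \<times> 'c \<Rightarrow> real"
    using nn_integral_measurable[of "\<lambda>x. ennreal (g x)"] that by simp
  have i: "integrable (\<mu> p) (\<lambda>\<xi>. f (p, \<xi>)) \<longleftrightarrow> (\<integral>\<^sup>+\<xi>. ennreal \<bar>f (p, \<xi>)\<bar> \<partial>\<mu> p) < \<infinity>"
    if "p \<in> space LS" for p
    using fiber_measurable[OF f, of p] that by (simp add: integrable_iff_bounded space_restrict_space)
  \<comment> \<open>Where the fibre integral does not exist, its value is \<open>0\<close> by convention.\<close>
  have "(\<lambda>p. if (\<integral>\<^sup>+\<xi>. ennreal \<bar>f (p, \<xi>)\<bar> \<partial>\<mu> p) < \<infinity>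
      then enn2real (\<integral>\<^sup>+\<xi>. ennreal (f (p, \<xi>)) \<partial>\<mu> p) - enn2real (\<integral>\<^sup>+\<xi>. ennreal (- f (p, \<xi>)) \<partial>\<mu> p)
      else 0) \<in> borel_measurable LS"
    using m[of f] m[of "\<lambda>x. - f x"] m[of "\<lambda>x. \<bar>f x\<bar>"] f by measurable
  then show ?thesis
  proof (rule measurable_cong[THEN iffD1, rotated])
    fix p assume "p \<in> space LS"
    from i[OF this] show "(if (\<integral>\<^sup>+\<xi>. ennreal \<bar>f (p, \<xi>)\<bar> \<partial>\<mu> p) < \<infinity>
      then enn2real (\<integral>\<^sup>+\<xi>. ennreal (f (p, \<xi>)) \<partial>\<mu> p) - enn2real (\<integral>\<^sup>+\<xi>. ennreal (- f (p, \<xi>)) \<partial>\<mu> p)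
      else 0) = (\<integral>\<xi>. f (p, \<xi>) \<partial>\<mu> p)"
      by (cases "integrable (\<mu> p) (\<lambda>\<xi>. f (p, \<xi>))")
         (simp_all add: real_lebesgue_integral_def not_integrable_integral_eq)
  qed
qed

lemma integral_disintegration_nonneg:
  fixes f :: "'b \<times> 'c \<Rightarrow> real"
  assumes f: "f \<in> borel_measurable (lebesgue \<Otimes>\<^sub>M borel)" and nn: "\<And>x. 0 \<le> f x"
    and a: "integrable LS a" and bd: "AE p in LS. \<forall>\<xi>\<in>E. f (p, \<xi>) \<le> a p"
  shows "integrable (completion M) f" "integrable LS (\<lambda>p. \<integral>\<xi>. f (p, \<xi>) \<partial>\<mu> p)"
    "(\<integral>x. f x \<partial>completion M) = (\<integral>p. (\<integral>\<xi>. f (p, \<xi>) \<partial>\<mu> p) \<partial>LS)"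
proof -
  have *: "AE p in LS. (\<integral>\<^sup>+\<xi>. f (p, \<xi>) \<partial>\<mu> p) = ennreal (\<integral>\<xi>. f (p, \<xi>) \<partial>\<mu> p) \<and> (\<integral>\<xi>. f (p, \<xi>) \<partial>\<mu> p) \<le> a p"
    using bd AE_space
  proof eventually_elim
    fix p assume p: "\<forall>\<xi>\<in>E. f (p, \<xi>) \<le> a p" "p \<in> space LS"
    then have pS: "p \<in> S" by (simp add: space_restrict_space)
    interpret prob_space "\<mu> p" by (rule prob(1)[OF pS])
    have ae: "AE \<xi> in \<mu> p. f (p, \<xi>) \<le> a p" using AE_support[OF pS] by eventually_elim (use p in auto)
    have i: "integrable (\<mu> p) (\<lambda>\<xi>. f (p, \<xi>))"
      by (rule integrable_const_bound[of _ "a p"]) (use ae nn fiber_measurable[OF f pS] in auto)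
    have "(\<integral>\<xi>. f (p, \<xi>) \<partial>\<mu> p) \<le> (\<integral>\<xi>. a p \<partial>\<mu> p)" by (rule integral_mono_AE[OF i _ ae]) simp
    then show "(\<integral>\<^sup>+\<xi>. f (p, \<xi>) \<partial>\<mu> p) = ennreal (\<integral>\<xi>. f (p, \<xi>) \<partial>\<mu> p) \<and> (\<integral>\<xi>. f (p, \<xi>) \<partial>\<mu> p) \<le> a p"
      using nn_integral_eq_integral[OF i] nn by (simp add: prob_space)
  qed
  show i2: "integrable LS (\<lambda>p. \<integral>\<xi>. f (p, \<xi>) \<partial>\<mu> p)"
    by (rule Bochner_Integration.integrable_bound[OF a fiber_integral_measurable[OF f]])
       (use * in eventually_elim, use nn in \<open>auto simp: integral_nonneg\<close>)
  have "(\<integral>\<^sup>+x. f x \<partial>completion M) = (\<integral>\<^sup>+p. (\<integral>\<^sup>+\<xi>. f (p, \<xi>) \<partial>\<mu> p) \<partial>LS)"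
    by (rule nn_integral_disintegration) (use f in simp)
  also have "\<dots> = (\<integral>\<^sup>+p. ennreal (\<integral>\<xi>. f (p, \<xi>) \<partial>\<mu> p) \<partial>LS)"
    by (rule nn_integral_cong_AE) (use * in eventually_elim, simp)
  also have "\<dots> = ennreal (\<integral>p. (\<integral>\<xi>. f (p, \<xi>) \<partial>\<mu> p) \<partial>LS)"
    by (rule nn_integral_eq_integral[OF i2]) (simp add: nn integral_nonneg)
  finally have nne: "(\<integral>\<^sup>+x. f x \<partial>completion M) = ennreal (\<integral>p. (\<integral>\<xi>. f (p, \<xi>) \<partial>\<mu> p) \<partial>LS)" .
  have fm: "f \<in> borel_measurable (completion M)"
    using measurable_compose[OF measurable_pairing f] by simp
  show "integrable (completion M) f"
    by (rule integrableI_nonneg[OF fm]) (use nn nne in auto)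
  show "(\<integral>x. f x \<partial>completion M) = (\<integral>p. (\<integral>\<xi>. f (p, \<xi>) \<partial>\<mu> p) \<partial>LS)"
    using nn by (subst integral_eq_nn_integral[OF fm]) (auto simp: nne integral_nonneg)
qed

text \<open>The bound depends on the base point, since test functions of class \<open>H1\<close> are
  integrable but in general unbounded.\<close>

lemma integral_disintegration:
  fixes f :: "'b \<times> 'c \<Rightarrow> real"
  assumes f: "f \<in> borel_measurable (lebesgue \<Otimes>\<^sub>M borel)"
    and a: "integrable LS a" and bd: "AE p in LS. \<forall>\<xi>\<in>E. \<bar>f (p, \<xi>)\<bar> \<le> a p"
  shows "integrable (completion M) f" "integrable LS (\<lambda>p. \<integral>\<xi>. f (p, \<xi>) \<partial>\<mu> p)"
    "(\<integral>x. f x \<partial>completion M) = (\<integral>p. (\<integral>\<xi>. f (p, \<xi>) \<partial>\<mu> p) \<partial>LS)"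
proof -
  let ?P = "\<lambda>x. max 0 (f x)" and ?N = "\<lambda>x. max 0 (- f x)"
  have m: "?P \<in> borel_measurable (lebesgue \<Otimes>\<^sub>M borel)" "?N \<in> borel_measurable (lebesgue \<Otimes>\<^sub>M borel)"
    using f by auto
  have b: "AE p in LS. \<forall>\<xi>\<in>E. ?P (p, \<xi>) \<le> a p" "AE p in LS. \<forall>\<xi>\<in>E. ?N (p, \<xi>) \<le> a p"
    using bd by (eventually_elim, fastforce)+
  note P = integral_disintegration_nonneg[OF m(1) _ a b(1)]
  note N = integral_disintegration_nonneg[OF m(2) _ a b(2)]
  have eq: "f = (\<lambda>x. ?P x - ?N x)" by (auto simp: max_def)
  show "integrable (completion M) f" by (subst eq) (intro Bochner_Integration.integrable_diff P N; simp)
  have ae: "AE p in LS. (\<integral>\<xi>. f (p, \<xi>) \<partial>\<mu> p) = (\<integral>\<xi>. ?P (p, \<xi>) \<partial>\<mu> p) - (\<integral>\<xi>. ?N (p, \<xi>) \<partial>\<mu> p)"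
    using bd AE_space
  proof eventually_elim
    fix p assume p: "\<forall>\<xi>\<in>E. \<bar>f (p, \<xi>)\<bar> \<le> a p" "p \<in> space LS"
    then have pS: "p \<in> S" by (simp add: space_restrict_space)
    interpret prob_space "\<mu> p" by (rule prob(1)[OF pS])
    have ae: "AE \<xi> in \<mu> p. \<bar>f (p, \<xi>)\<bar> \<le> a p" using AE_support[OF pS] by eventually_elim (use p in auto)
    have [measurable]: "(\<lambda>\<xi>. f (p, \<xi>)) \<in> borel_measurable (\<mu> p)" by (rule fiber_measurable[OF f pS])
    have "integrable (\<mu> p) (\<lambda>\<xi>. ?P (p, \<xi>))" "integrable (\<mu> p) (\<lambda>\<xi>. ?N (p, \<xi>))"
      by (rule integrable_const_bound[of _ "a p"], use ae in \<open>eventually_elim, auto\<close>, measurable)+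
    then have "(\<integral>\<xi>. ?P (p, \<xi>) - ?N (p, \<xi>) \<partial>\<mu> p) = (\<integral>\<xi>. ?P (p, \<xi>) \<partial>\<mu> p) - (\<integral>\<xi>. ?N (p, \<xi>) \<partial>\<mu> p)"
      by (rule Bochner_Integration.integral_diff)
    moreover have "(\<integral>\<xi>. f (p, \<xi>) \<partial>\<mu> p) = (\<integral>\<xi>. ?P (p, \<xi>) - ?N (p, \<xi>) \<partial>\<mu> p)"
      by (intro Bochner_Integration.integral_cong) (auto simp: max_def)
    ultimately show "(\<integral>\<xi>. f (p, \<xi>) \<partial>\<mu> p) = (\<integral>\<xi>. ?P (p, \<xi>) \<partial>\<mu> p) - (\<integral>\<xi>. ?N (p, \<xi>) \<partial>\<mu> p)"
      by (rule trans[rotated])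
  qed
  have iPN: "integrable LS (\<lambda>p. (\<integral>\<xi>. ?P (p, \<xi>) \<partial>\<mu> p) - (\<integral>\<xi>. ?N (p, \<xi>) \<partial>\<mu> p))"
    by (intro Bochner_Integration.integrable_diff P N; simp)
  show "integrable LS (\<lambda>p. \<integral>\<xi>. f (p, \<xi>) \<partial>\<mu> p)"
    using integrable_cong_AE[OF fiber_integral_measurable[OF f] _ ae] iPN by auto
  have "(\<integral>x. f x \<partial>completion M) = (\<integral>x. ?P x \<partial>completion M) - (\<integral>x. ?N x \<partial>completion M)"
    by (subst eq) (intro Bochner_Integration.integral_diff P N; simp)
  also have "\<dots> = (\<integral>p. (\<integral>\<xi>. ?P (p, \<xi>) \<partial>\<mu> p) \<partial>LS) - (\<integral>p. (\<integral>\<xi>. ?N (p, \<xi>) \<partial>\<mu> p) \<partial>LS)"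
    by (simp add: P(3) N(3))
  also have "\<dots> = (\<integral>p. (\<integral>\<xi>. ?P (p, \<xi>) \<partial>\<mu> p) - (\<integral>\<xi>. ?N (p, \<xi>) \<partial>\<mu> p) \<partial>LS)"
    by (intro Bochner_Integration.integral_diff[symmetric] P N; simp)
  also have "\<dots> = (\<integral>p. (\<integral>\<xi>. f (p, \<xi>) \<partial>\<mu> p) \<partial>LS)"
    using ae iPN fiber_integral_measurable[OF f] by (intro integral_cong_AE) auto
  finally show "(\<integral>x. f x \<partial>completion M) = (\<integral>p. (\<integral>\<xi>. f (p, \<xi>) \<partial>\<mu> p) \<partial>LS)" .
qed

end

section \<open>Lebesgue measurable functions and their Borel versions\<close>

lemma (in complete_measure) borel_measurable_AE_eq:
  fixes f g :: "'a \<Rightarrow> 'd::topological_space"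
  assumes f: "f \<in> borel_measurable M" and eq: "AE x in M. f x = g x"
  shows "g \<in> borel_measurable M"
proof (rule measurableI)
  fix A :: "'d set" assume A: "A \<in> sets borel"
  show "g -` A \<inter> space M \<in> sets M"
  proof (rule in_sets_AE)
    show "AE x in M. x \<in> f -` A \<inter> space M \<longleftrightarrow> x \<in> g -` A \<inter> space M"
      using eq by eventually_elim auto
    show "f -` A \<inter> space M \<in> sets M" using f A by (rule measurable_sets)
  qed simp
qed simp

lemma (in complete_measure) integral_cong_AE_complete:
  fixes f g :: "'a \<Rightarrow> 'd::{banach, second_countable_topology}"
  assumes "f \<in> borel_measurable M" "AE x in M. f x = g x"
  shows "integral\<^sup>L M f = integral\<^sup>L M g"
  using assms borel_measurable_AE_eq[OF assms] by (intro integral_cong_AE) auto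

lemma (in complete_measure) integrable_cong_AE_complete:
  fixes f g :: "'a \<Rightarrow> 'd::{banach, second_countable_topology}"
  assumes f: "integrable M f" and eq: "AE x in M. f x = g x"
  shows "integrable M g"
  using integrable_cong_AE[OF _ borel_measurable_AE_eq[OF _ eq] eq] f by auto

lemma abs_integral_le:
  fixes f g :: "'b \<Rightarrow> real"
  assumes "integrable M f" "integrable M g" "AE x in M. \<bar>f x\<bar> \<le> g x"
  shows "\<bar>integral\<^sup>L M f\<bar> \<le> integral\<^sup>L M g"
proof -
  have "\<bar>integral\<^sup>L M f\<bar> \<le> (\<integral>x. \<bar>f x\<bar> \<partial>M)" by (rule integral_abs_bound)
  also have "\<dots> \<le> integral\<^sup>L M g" by (rule integral_mono_AE) (use assms in auto)
  finally show ?thesis .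
qed

lemma complete_measure_lebesgue_on:
  assumes S: "S \<in> sets lebesgue"
  shows "complete_measure (lebesgue_on S)"
proof
  fix A B assume "B \<subseteq> A" "A \<in> null_sets (lebesgue_on S)"
  then have "B \<in> null_sets (lebesgue_on S)"
    using null_sets_completion_subset[of B A lborel] by (auto simp: null_sets_restrict_space[OF S])
  then show "B \<in> sets (lebesgue_on S)" by auto
qed

lemma finite_measure_lebesgue_on_bounded:
  assumes "bounded S" "S \<in> sets lebesgue"
  shows "finite_measure (lebesgue_on S)"
proof (rule finite_measure_lebesgue_on)
  show "S \<in> lmeasurable" using assms bounded_set_imp_lmeasurable by blast
qed

lemma integrable_bounded_lebesgue_on:
  fixes g :: "'b::euclidean_space \<Rightarrow> 'd::{banach, second_countable_topology}"
  assumes "bounded S" "S \<in> sets lebesgue" "g \<in> borel_measurable (lebesgue_on S)"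
    and "AE x in lebesgue_on S. norm (g x) \<le> B"
  shows "integrable (lebesgue_on S) g"
  using finite_measure.integrable_const_bound[OF finite_measure_lebesgue_on_bounded[OF assms(1,2)] assms(4,3)] .

lemma integral_lebesgue_on_eq_lborel:
  fixes g :: "'b::euclidean_space \<Rightarrow> 'd::{banach, second_countable_topology}"
  assumes "S \<in> sets lebesgue" "g \<in> borel_measurable borel" "\<And>x. x \<notin> S \<Longrightarrow> g x = 0"
  shows "integral\<^sup>L (lebesgue_on S) g = integral\<^sup>L lborel g"
    and "integrable lborel g \<Longrightarrow> integrable (lebesgue_on S) g"
proof -
  have e: "(\<lambda>x. indicator S x *\<^sub>R g x) = g" using assms(3) by (auto simp: indicator_def)
  show "integral\<^sup>L (lebesgue_on S) g = integral\<^sup>L lborel g"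
    using assms by (simp add: integral_restrict_space e integral_completion)
  show "integrable (lebesgue_on S) g" if "integrable lborel g"
    using assms that by (simp add: integrable_restrict_space e integrable_completion)
qed

lemma borel_version_lebesgue:
  fixes h :: "'b::euclidean_space \<Rightarrow> 'd::euclidean_space"
  assumes h: "h \<in> borel_measurable lebesgue"
  shows "\<exists>h'\<in>borel_measurable borel. AE x in lborel. h x = h' x"
proof -
  have "\<exists>g. g \<in> borel_measurable borel \<and> (AE x in lborel. h x \<bullet> i = g x)" if "i \<in> Basis" for i :: 'd
    using completion_ex_borel_measurable_real[of "\<lambda>x. h x \<bullet> i" lborel] h by auto
  then obtain g where g: "\<And>i. i \<in> Basis \<Longrightarrow> g i \<in> borel_measurable borel"
      "\<And>i. i \<in> Basis \<Longrightarrow> AE x in lborel. h x \<bullet> i = g i x" by metis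
  have "AE x in lborel. \<forall>i\<in>Basis. h x \<bullet> i = g i x"
    by (rule AE_finite_allI) (auto intro: g(2))
  then have "AE x in lborel. h x = (\<Sum>i\<in>Basis. g i x *\<^sub>R i)"
  proof eventually_elim
    case (elim x)
    have "h x = (\<Sum>i\<in>Basis. (h x \<bullet> i) *\<^sub>R i)" by (simp add: euclidean_representation)
    also have "\<dots> = (\<Sum>i\<in>Basis. g i x *\<^sub>R i)" using elim by (intro sum.cong) auto
    finally show ?case .
  qed
  moreover have "(\<lambda>x. \<Sum>i\<in>Basis. g i x *\<^sub>R i) \<in> borel_measurable borel"
    using g(1) by (intro borel_measurable_sum borel_measurable_scaleR) auto
  ultimately show ?thesis by (intro bexI[of _ "\<lambda>x. \<Sum>i\<in>Basis. g i x *\<^sub>R i"])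
qed

text \<open>Extension by zero to the whole space, as needed for mollification, with the almost everywhere
  modification chosen so that the bound holds at every point.\<close>

lemma borel_version_bounded:
  fixes h :: "'b::euclidean_space \<Rightarrow> 'd::euclidean_space"
  assumes h: "h \<in> borel_measurable (lebesgue_on S)" and S: "S \<in> sets borel" "bounded S"
    and B: "B \<ge> 0" "\<And>x. x \<in> S \<Longrightarrow> norm (h x) \<le> B"
  shows "\<exists>h'. h' \<in> borel_measurable borel \<and> integrable lborel h' \<and> (\<forall>x. norm (h' x) \<le> B) \<and>
    (\<forall>x. x \<notin> S \<longrightarrow> h' x = 0) \<and> (AE x in lborel. x \<in> S \<longrightarrow> h x = h' x)"
proof -
  have SL: "S \<in> sets lebesgue" using S by auto
  have "(\<lambda>x. if x \<in> S then h x else 0) \<in> borel_measurable lebesgue" by (rule borel_measurable_if_I[OF h SL])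
  then obtain g where g[measurable]: "g \<in> borel_measurable borel" and ae: "AE x in lborel. (if x \<in> S then h x else 0) = g x"
    using borel_version_lebesgue by blast
  \<comment> \<open>Values of the Borel version that exceed the bound occur only on a null set and are set to \<open>0\<close>.\<close>
  define h' where "h' x = (if x \<in> S \<and> norm (g x) \<le> B then g x else 0)" for x
  have [measurable]: "S \<in> sets borel" by (rule S)
  have m: "h' \<in> borel_measurable borel" unfolding h'_def by measurable
  have nb: "norm (h' x) \<le> B * indicator S x" for x using B(1) by (simp add: h'_def)
  have "emeasure lborel S < \<infinity>" using S(2) by (rule emeasure_bounded_finite)
  then have "integrable lborel (\<lambda>x. B * indicator S x)"
    using S by (intro integrable_mult_right integrable_real_indicator) auto
  then have "integrable lborel h'"
    by (rule Bochner_Integration.integrable_bound) (use m order_trans[OF nb abs_ge_self] in auto)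
  moreover have "AE x in lborel. x \<in> S \<longrightarrow> h x = h' x"
    using ae
  proof eventually_elim
    case (elim x)
    then show ?case using B(2)[of x] by (auto simp: h'_def)
  qed
  ultimately show ?thesis using m B(1) by (intro exI[of _ h']) (auto simp: h'_def)
qed

lemma integral_lebesgue_on_eq_borel_version:
  fixes g g' :: "'b::euclidean_space \<Rightarrow> 'd::{banach, second_countable_topology}"
  assumes S: "S \<in> sets borel" and g': "g' \<in> borel_measurable borel" "\<And>x. x \<notin> S \<Longrightarrow> g' x = 0"
    and ae: "AE x in lborel. x \<in> S \<longrightarrow> g x = g' x"
  shows "integral\<^sup>L (lebesgue_on S) g = integral\<^sup>L lborel g'"
proof -
  have SL: "S \<in> sets lebesgue" using S by auto
  have "AE x in lebesgue_on S. g' x = g x"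
    using AE_completion[OF ae] SL by (subst AE_restrict_space_iff) (auto elim: eventually_mono)
  moreover have "g' \<in> borel_measurable (lebesgue_on S)"
    using g' by (intro measurable_restrict_space1 measurable_completion) simp
  ultimately have "integral\<^sup>L (lebesgue_on S) g' = integral\<^sup>L (lebesgue_on S) g"
    by (intro complete_measure.integral_cong_AE_complete[OF complete_measure_lebesgue_on[OF SL]])
  then show ?thesis using integral_lebesgue_on_eq_lborel(1)[OF SL g'] by simp
qed

lemma AE_lborel_snd:
  assumes "AE x in (lborel :: 'c::euclidean_space measure). P x"
  shows "AE p in (lborel :: ('b::euclidean_space \<times> 'c) measure). P (snd p)"
proof -
  obtain N where N: "{x \<in> space lborel. \<not> P x} \<subseteq> N" "emeasure lborel N = 0" "N \<in> sets lborel"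
    using assms by (rule AE_E)
  have "emeasure (lborel \<Otimes>\<^sub>M lborel) ((UNIV :: 'b set) \<times> N) = 0"
    using N by (subst lborel.emeasure_pair_measure_Times) auto
  moreover have "(UNIV :: 'b set) \<times> N \<in> sets borel" using N by (intro borel_Times) auto
  ultimately have "(UNIV :: 'b set) \<times> N \<in> null_sets lborel" by (simp add: lborel_prod null_sets_def)
  from AE_not_in[OF this] show ?thesis by eventually_elim (use N(1) in \<open>auto simp: mem_Times_iff\<close>)
qed

lemma AE_lborel_fst_neq: "AE p in (lborel :: (real \<times> 'c::euclidean_space) measure). fst p \<noteq> c"
proof -
  have "emeasure (lborel \<Otimes>\<^sub>M lborel) ({c} \<times> (UNIV :: 'c set)) = 0"
    by (subst lborel.emeasure_pair_measure_Times) auto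
  moreover have "{c} \<times> (UNIV :: 'c set) \<in> sets borel" by (intro borel_Times) auto
  ultimately have "{c} \<times> (UNIV :: 'c set) \<in> null_sets lborel" by (simp add: lborel_prod null_sets_def)
  from AE_not_in[OF this] show ?thesis by eventually_elim (auto simp: mem_Times_iff)
qed

section \<open>Traces\<close>

lemma test_fun_zero: "test_fun U \<psi> \<Longrightarrow> x \<notin> U \<Longrightarrow> \<psi> x = 0"
  unfolding test_fun_def using closure_subset[of "{x. \<psi> x \<noteq> 0}"] by blast

lemma test_fun_grad_zero: 
  assumes "test_fun U \<psi>" "x \<notin> U"
  shows "grad \<psi> x = 0"
proof (rule grad_eq_0)
  show "x \<in> - closure {x. \<psi> x \<noteq> 0}" using assms by (auto simp: test_fun_def)
  show "\<psi> y = 0" if "y \<in> - closure {x. \<psi> x \<noteq> 0}" for y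
    using that closure_subset[of "{x. \<psi> x \<noteq> 0}"] by blast
qed (rule open_Compl[OF closed_closure])

lemma Lp_continuous:
  fixes g :: "'a::euclidean_space \<Rightarrow> 'c::euclidean_space"
  assumes \<Omega>: "open \<Omega>" "bounded \<Omega>" and g: "continuous_on UNIV g" and p: "p > 0"
  shows "Lp p \<Omega> g"
proof -
  have SL: "\<Omega> \<in> sets lebesgue" using \<Omega> by auto
  have m: "g \<in> borel_measurable (lebesgue_on \<Omega>)"
    by (rule measurable_restrict_space1, rule measurable_completion)
       (use g in \<open>simp add: borel_measurable_continuous_onI\<close>)
  have "compact (g ` closure \<Omega>)"
    using \<Omega> by (intro compact_continuous_image continuous_on_subset[OF g]) (auto simp: compact_closure)
  then obtain B where B: "\<And>x. x \<in> closure \<Omega> \<Longrightarrow> norm (g x) \<le> B"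
    using compact_imp_bounded bounded_iff by (metis imageI)
  have "integrable (lebesgue_on \<Omega>) (\<lambda>x. norm (g x) powr p)"
  proof (rule integrable_bounded_lebesgue_on[OF \<Omega>(2) SL])
    show "(\<lambda>x. norm (g x) powr p) \<in> borel_measurable (lebesgue_on \<Omega>)" using m by measurable
    have "norm (g x) powr p \<le> B powr p" if "x \<in> \<Omega>" for x
      using B that closure_subset[of \<Omega>] p by (intro powr_mono2) auto
    then show "AE x in lebesgue_on \<Omega>. norm (norm (g x) powr p) \<le> B powr p"
      by (intro AE_I2) simp
  qed
  then show ?thesis using m by (simp add: Lp_def)
qed

lemma integrable_lebesgue_on_compact:
  fixes g :: "'a::euclidean_space \<Rightarrow> 'c::euclidean_space"
  assumes "compact K" "continuous_on UNIV g"
  shows "integrable (lebesgue_on K) g"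
proof -
  have "K \<in> sets lebesgue" using assms(1) by (simp add: compact_imp_closed)
  then show ?thesis
    using borel_integrable_compact[OF assms(1) continuous_on_subset[OF assms(2)]] assms
    by (simp add: integrable_restrict_space integrable_completion borel_measurable_continuous_onI compact_imp_closed)
qed

lemma smooth_W1:
  assumes v: "smooth v" and \<Omega>: "open \<Omega>" "bounded \<Omega>"
  shows "W1 2 \<Omega> v (grad v)"
proof -
  have SL: "\<Omega> \<in> sets lebesgue" using \<Omega> by auto
  have cv: "continuous_on UNIV v" "continuous_on UNIV (grad v)"
    using v by (auto intro: smooth_continuous_on smooth_continuous_grad)
  have "(\<integral>x. (grad \<psi> x \<bullet> i) * v x \<partial>lebesgue_on \<Omega>) = - (\<integral>x. \<psi> x * (grad v x \<bullet> i) \<partial>lebesgue_on \<Omega>)"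
    if \<psi>: "test_fun \<Omega> \<psi>" and i: "i \<in> Basis" for \<psi> i
  proof -
    obtain B R \<delta> where s: "smooth \<psi>" and R: "\<And>p. R \<le> norm p \<Longrightarrow> \<psi> p = 0" "\<And>p. R \<le> norm p \<Longrightarrow> grad \<psi> p = 0"
      using test_fun_bounds[OF \<psi> \<Omega>(1)] by metis
    have c: "continuous_on UNIV \<psi>" "continuous_on UNIV (grad \<psi>)"
      using s by (auto intro: smooth_continuous_on smooth_continuous_grad)
    have c1: "continuous_on UNIV (\<lambda>x. (grad \<psi> x \<bullet> i) * v x)" "continuous_on UNIV (\<lambda>x. \<psi> x * (grad v x \<bullet> i))"
      "continuous_on UNIV (\<lambda>x. \<psi> x * v x)"
      by (intro continuous_intros c cv)+
    have i1: "integrable lborel (\<lambda>x. (grad \<psi> x \<bullet> i) * v x)" and i2: "integrable lborel (\<lambda>x. \<psi> x * (grad v x \<bullet> i))"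
      and i3: "integrable lborel (\<lambda>x. \<psi> x * v x)"
      using integrable_continuous_bounded_support[OF c1(1), of R 0] integrable_continuous_bounded_support[OF c1(2), of R 0]
        integrable_continuous_bounded_support[OF c1(3), of R 0] R by auto
    have "continuous_on UNIV (\<lambda>x. (grad \<psi> x \<bullet> i) * v x + \<psi> x * (grad v x \<bullet> i))"
      by (intro continuous_intros c1)
    then obtain B where B: "\<And>x. \<bar>(grad \<psi> x \<bullet> i) * v x + \<psi> x * (grad v x \<bullet> i)\<bar> \<le> B"
      using bounded_of_continuous_bounded_support[of "\<lambda>x. (grad \<psi> x \<bullet> i) * v x + \<psi> x * (grad v x \<bullet> i)" R] R by auto
    have "(\<integral>x. (grad \<psi> x \<bullet> i) * v x + \<psi> x * (grad v x \<bullet> i) \<partial>lborel) = 0"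
    proof (rule integral_directional_derivative_eq_0[OF i3 _ _ B])
      show "((\<lambda>s. \<psi> (p + s *\<^sub>R i) * v (p + s *\<^sub>R i)) has_real_derivative
          grad \<psi> p \<bullet> i * v p + \<psi> p * (grad v p \<bullet> i)) (at 0)" for p
        using DERIV_mult[OF smooth_directional[OF s, of p i] smooth_directional[OF v, of p i]]
        by (simp add: mult.commute)
      show "\<psi> p * v p = 0" if "R \<le> norm p" for p using R(1)[OF that] by simp
    qed
    then have e: "(\<integral>x. (grad \<psi> x \<bullet> i) * v x \<partial>lborel) = - (\<integral>x. \<psi> x * (grad v x \<bullet> i) \<partial>lborel)"
      using i1 i2 by simp
    have "(\<integral>x. (grad \<psi> x \<bullet> i) * v x \<partial>lebesgue_on \<Omega>) = (\<integral>x. (grad \<psi> x \<bullet> i) * v x \<partial>lborel)"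
      by (rule integral_lebesgue_on_eq_lborel[OF SL])
         (use c1 test_fun_grad_zero[OF \<psi>] in \<open>auto intro: borel_measurable_continuous_onI\<close>)
    moreover have "(\<integral>x. \<psi> x * (grad v x \<bullet> i) \<partial>lebesgue_on \<Omega>) = (\<integral>x. \<psi> x * (grad v x \<bullet> i) \<partial>lborel)"
      by (rule integral_lebesgue_on_eq_lborel[OF SL])
         (use c1 test_fun_zero[OF \<psi>] in \<open>auto intro: borel_measurable_continuous_onI\<close>)
    ultimately show ?thesis using e by simp
  qed
  then show ?thesis
    unfolding W1_def weak_gradient_def
    using cv by (auto intro!: Lp_continuous[OF \<Omega>] integrable_lebesgue_on_compact)
qed

lemma smooth_H1_trace:
  assumes v: "smooth v" and \<Omega>: "open \<Omega>" "bounded \<Omega>"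
  shows "H1_trace \<Omega> v (grad v) v"
  unfolding H1_trace_def
  using smooth_W1[OF assms] v
  by (auto intro!: borel_measurable_continuous_onI smooth_continuous_on exI[of _ "\<lambda>k. v"])

text \<open>The approximating test functions vanish on the boundary, hence so does the limit of their traces.\<close>

lemma W10_H1_trace:
  fixes \<Omega> :: "'a::euclidean_space set"
  assumes "W10 2 \<Omega> v G" "open \<Omega>"
  shows "H1_trace \<Omega> v G (\<lambda>x. 0)"
proof -
  obtain \<psi> where \<psi>: "\<And>k::nat. test_fun \<Omega> (\<psi> k)"
      "(\<lambda>k. \<integral>x. \<bar>v x - \<psi> k x\<bar> powr 2 \<partial>lebesgue_on \<Omega>) \<longlonglongrightarrow> 0"
      "(\<lambda>k. \<integral>x. norm (G x - grad (\<psi> k) x) powr 2 \<partial>lebesgue_on \<Omega>) \<longlonglongrightarrow> 0"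
    using assms(1) by (auto simp: W10_def)
  have "\<psi> k x = 0" if "x \<in> frontier \<Omega>" for k x
    using test_fun_zero[OF \<psi>(1)] that assms(2) by (auto simp: frontier_def interior_open)
  then have z0: "ennreal (\<bar>0 - \<psi> k x\<bar> powr 2) * indicator (frontier \<Omega>) x = 0" for k x
    by (cases "x \<in> frontier \<Omega>") auto
  have "(\<integral>\<^sup>+x. ennreal (\<bar>0 - \<psi> k x\<bar> powr 2) * indicator (frontier \<Omega>) x
           \<partial>hausdorff_measure (DIM('a) - 1)) = (\<integral>\<^sup>+(x::'a). 0 \<partial>hausdorff_measure (DIM('a) - 1))" for k
    by (rule nn_integral_cong) (rule z0)
  then have z: "(\<lambda>k. \<integral>\<^sup>+x. ennreal (\<bar>0 - \<psi> k x\<bar> powr 2) * indicator (frontier \<Omega>) x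
           \<partial>hausdorff_measure (DIM('a) - 1)) \<longlonglongrightarrow> 0" by (simp only: nn_integral_0_iff_AE nn_integral_const mult_zero_left tendsto_const)
  show ?thesis
    unfolding H1_trace_def
  proof (intro conjI exI[of _ \<psi>] allI)
    show "W1 2 \<Omega> v G" using assms(1) by (simp add: W10_def)
    show "smooth (\<psi> k)" for k using \<psi>(1) by (simp add: test_fun_def)
  qed (use \<psi> z in auto)
qed

section \<open>The boundary of the space-time cylinder\<close>

lemma frontier_cylinder:
  assumes "open \<Omega>" "T > 0" "(t, x) \<in> frontier (QT T \<Omega>)"
  shows "t \<in> {0..T} \<and> x \<in> closure \<Omega> \<and> (t = 0 \<or> t = T \<or> x \<in> frontier \<Omega>)"
proof -
  have "closed (QT T \<Omega>)" by (intro closed_Times) auto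
  then have "(t, x) \<in> QT T \<Omega>" using assms(3) by (auto simp: frontier_def)
  moreover have "{0<..<T} \<times> \<Omega> \<subseteq> interior (QT T \<Omega>)"
    using assms(1) closure_subset[of \<Omega>] by (intro interior_maximal open_Times) auto
  then have "(t, x) \<notin> {0<..<T} \<times> \<Omega>" using assms(3) unfolding frontier_def by blast
  ultimately show ?thesis using assms(1) by (auto simp: frontier_def interior_open)
qed

text \<open>Near a boundary point the domain lies strictly below a graph in the direction \<open>e\<close>. Moving along \<open>e\<close>
  leaves the argument of the graph function unchanged and thus leads out of the closed domain.\<close>

lemma exterior_dense_at_frontier:
  assumes "lipschitz_boundary \<Omega>" "open \<Omega>"
  shows "frontier \<Omega> \<subseteq> closure (- closure \<Omega>)"
proof
  fix p assume p: "p \<in> frontier \<Omega>"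
  from bspec[OF assms(1)[unfolded lipschitz_boundary_def] this] obtain U e h L where U: "open U" "p \<in> U" "norm e = 1" and h: "L-lipschitz_on UNIV (h :: 'a \<Rightarrow> real)"
    and eq: "\<Omega> \<inter> U = {x \<in> U. x \<bullet> e < h (x - (x \<bullet> e) *\<^sub>R e)}"
    by (elim exE conjE) (rule that)
  have ee: "e \<bullet> e = 1" using U(3) by (simp add: norm_eq_1)
  let ?V = "U \<inter> {x. h (x - (x \<bullet> e) *\<^sub>R e) < x \<bullet> e}"
  have "continuous_on UNIV (\<lambda>x. h (x - (x \<bullet> e) *\<^sub>R e))"
    by (rule continuous_on_compose2[OF lipschitz_on_continuous_on[OF h]]) (auto intro!: continuous_intros)
  then have "open ?V"
    using U(1) by (intro open_Int open_Collect_less) (auto intro!: continuous_intros)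
  moreover have mem: "x \<bullet> e < h (x - (x \<bullet> e) *\<^sub>R e)" if "x \<in> \<Omega>" "x \<in> U" for x
    using eq that by blast
  have "?V \<inter> \<Omega> = {}" using mem by force
  ultimately have V: "?V \<subseteq> - closure \<Omega>" using open_Int_closure_eq_empty[of ?V \<Omega>] by blast
  have "p \<notin> \<Omega>" using p assms(2) by (auto simp: frontier_def interior_open)
  then have pe: "h (p - (p \<bullet> e) *\<^sub>R e) \<le> p \<bullet> e" using eq U(2) by force
  have sh: "(p + s *\<^sub>R e) - ((p + s *\<^sub>R e) \<bullet> e) *\<^sub>R e = p - (p \<bullet> e) *\<^sub>R e" for s
    by (simp add: inner_add_left ee algebra_simps)
  show "p \<in> closure (- closure \<Omega>)"
    unfolding closure_approachable
  proof (intro allI impI)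
    fix d :: real assume d: "d > 0"
    obtain \<rho> where \<rho>: "\<rho> > 0" "ball p \<rho> \<subseteq> U" using U(1,2) open_contains_ball by blast
    define s where "s = min d \<rho> / 2"
    have s: "s > 0" "s < d" "s < \<rho>" using d \<rho>(1) by (auto simp: s_def)
    have "dist p (p + s *\<^sub>R e) < \<rho>" using s U(3) by (simp add: dist_norm)
    then have "p + s *\<^sub>R e \<in> U" using \<rho>(2) by auto
    moreover have "h ((p + s *\<^sub>R e) - ((p + s *\<^sub>R e) \<bullet> e) *\<^sub>R e) < (p + s *\<^sub>R e) \<bullet> e"
      unfolding sh using pe s(1) by (simp add: inner_add_left ee)
    ultimately have "p + s *\<^sub>R e \<in> - closure \<Omega>" using V by blast
    moreover have "dist (p + s *\<^sub>R e) p < d" using s U(3) by (simp add: dist_norm)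
    ultimately show "\<exists>y\<in>- closure \<Omega>. dist y p < d" by blast
  qed
qed

text \<open>At times strictly between \<open>0\<close> and \<open>T\<close> small time shifts do not leave the cylinder, which excludes
  a normal with a time component. If there is no normal, the normal field is \<open>0\<close> by definition.\<close>

lemma outward_normal_lateral:
  assumes t: "0 < t" "t < T" and x: "x \<in> closure \<Omega>"
  shows "fst (outward_normal (QT T \<Omega>) (t, x)) = 0"
proof -
  have "fst \<nu> = 0" if \<nu>: "is_outward_normal (QT T \<Omega>) (t, x) \<nu>" for \<nu>
  proof (rule ccontr)
    assume nz: "fst \<nu> \<noteq> 0"
    then have "\<bar>fst \<nu>\<bar> / 2 > 0" by simp
    then obtain \<delta> where \<delta>: "\<delta> > 0" "\<And>q. dist q (t, x) < \<delta> \<Longrightarrow>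
        \<nu> \<bullet> (q - (t, x)) > \<bar>fst \<nu>\<bar> / 2 * norm (q - (t, x)) \<Longrightarrow> q \<notin> QT T \<Omega>"
      using \<nu> unfolding is_outward_normal_def by blast
    define s where "s = min (\<delta> / 2) (min (t / 2) ((T - t) / 2))"
    have s: "s > 0" "s < \<delta>" "s < t" "s < T - t" using \<delta>(1) t by (auto simp: s_def min_def)
    define q where "q = (t + s * sgn (fst \<nu>), x)"
    have d: "q - (t, x) = (s * sgn (fst \<nu>), 0)" by (simp add: q_def)
    have n: "norm (q - (t, x)) = s" using s(1) nz by (simp add: d norm_Pair abs_mult abs_sgn_eq)
    have "\<nu> \<bullet> (q - (t, x)) = s * \<bar>fst \<nu>\<bar>" by (simp add: d inner_prod_def abs_sgn mult.commute mult.left_commute)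
    moreover have "s * \<bar>fst \<nu>\<bar> > \<bar>fst \<nu>\<bar> / 2 * s" using s(1) nz by simp
    ultimately have "q \<notin> QT T \<Omega>" using \<delta>(2)[of q] n s(2) by (simp add: dist_norm)
    moreover have "t + s * sgn (fst \<nu>) \<in> {0..T}" using s t by (auto simp: sgn_if)
    ultimately show False using x by (simp add: q_def)
  qed
  note zero = this
  show ?thesis
  proof (cases "\<exists>!\<nu>. is_outward_normal (QT T \<Omega>) (t, x) \<nu>")
    case True
    then show ?thesis using zero[OF theI'[OF True]] by (simp add: outward_normal_def)
  next
    case False
    then show ?thesis by (simp only: outward_normal_def if_False fst_zero)
  qed
qed

text \<open>Near such a point the cylinder is the half-space of nonnegative times. If \<open>\<nu>\<close> is a normal, every
  direction \<open>d\<close> with \<open>\<nu> \<bullet> d < 0\<close> points into this half-space, and \<open>(-1, 0)\<close> is the only unit vector with this property.\<close>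

lemma outward_normal_initial:
  assumes T: "T > 0" and \<Omega>: "open \<Omega>" and x: "x \<in> \<Omega>"
  shows "outward_normal (QT T \<Omega>) (0, x) = (-1, 0)"
proof -
  obtain \<rho> where \<rho>: "\<rho> > 0" "ball x \<rho> \<subseteq> \<Omega>" using \<Omega> x open_contains_ball by blast
  define \<delta> where "\<delta> = min \<rho> T"
  have \<delta>: "\<delta> > 0" using \<rho> T by (simp add: \<delta>_def)
  have near: "q \<in> QT T \<Omega> \<longleftrightarrow> 0 \<le> fst q" if "dist q (0, x) < \<delta>" for q
  proof -
    have "dist (fst q) 0 < \<delta>" "dist (snd q) x < \<delta>"
      using that dist_fst_le[of q "(0, x)"] dist_snd_le[of q "(0, x)"] by auto
    then have "\<bar>fst q\<bar> < T" "snd q \<in> \<Omega>" using \<rho>(2) by (auto simp: \<delta>_def dist_commute)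
    then show ?thesis using closure_subset[of \<Omega>] by (cases q) auto
  qed
  have ex: "is_outward_normal (QT T \<Omega>) (0, x) (-1, 0)"
    unfolding is_outward_normal_def
  proof (intro conjI allI impI exI[of _ \<delta>])
    show "norm (-1 :: real, 0 :: 'a) = 1" by (simp add: norm_Pair)
    fix \<epsilon> :: real and q :: "real \<times> 'a" assume \<epsilon>: "0 < \<epsilon>" and q: "dist q (0, x) < \<delta>"
    have "0 \<le> \<epsilon> * norm (q - (0, x))" using \<epsilon> by simp
    moreover have "(-1, 0) \<bullet> (q - (0, x)) = - fst q" by (simp add: inner_prod_def)
    ultimately show "\<epsilon> * norm (q - (0, x)) < (-1, 0) \<bullet> (q - (0, x)) \<Longrightarrow> q \<notin> QT T \<Omega>"
      "(-1, 0) \<bullet> (q - (0, x)) < - \<epsilon> * norm (q - (0, x)) \<Longrightarrow> q \<in> QT T \<Omega>"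
      unfolding near[OF q] by auto
  qed (rule \<delta>)
  have un: "\<nu> = (-1, 0)" if \<nu>: "is_outward_normal (QT T \<Omega>) (0, x) \<nu>" for \<nu>
  proof -
    have inward: "0 \<le> fst d" if d: "\<nu> \<bullet> d < 0" for d
    proof -
      have d0: "norm d > 0" using d by auto
      \<comment> \<open>With half of the actual slope the cone condition is strict along the ray in direction \<open>d\<close>.\<close>
      define \<epsilon> where "\<epsilon> = - (\<nu> \<bullet> d) / (2 * norm d)"
      have \<epsilon>: "\<epsilon> > 0" using d d0 by (simp add: \<epsilon>_def divide_neg_pos)
      obtain \<delta>' where \<delta>': "\<delta>' > 0" "\<And>q. dist q (0, x) < \<delta>' \<Longrightarrow>
          \<nu> \<bullet> (q - (0, x)) < - \<epsilon> * norm (q - (0, x)) \<Longrightarrow> q \<in> QT T \<Omega>"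
        using \<nu> \<epsilon> unfolding is_outward_normal_def by blast
      define s where "s = min \<delta> \<delta>' / (2 * norm d)"
      have s: "s > 0" using \<delta> \<delta>' d0 by (simp add: s_def)
      have sd: "s * norm d < \<delta>" "s * norm d < \<delta>'" using \<delta> \<delta>' d0 by (auto simp: s_def)
      define q where "q = (0, x) + s *\<^sub>R d"
      have qd: "q - (0, x) = s *\<^sub>R d" by (simp add: q_def)
      have dq: "dist q (0, x) = s * norm d" using s by (simp add: dist_norm qd)
      have "\<epsilon> * norm d = - (\<nu> \<bullet> d) / 2" using d0 by (simp add: \<epsilon>_def)
      then have "s * (\<nu> \<bullet> d) < - (s * (\<epsilon> * norm d))"
        using d s by (simp add: mult_pos_neg)
      then have "q \<in> QT T \<Omega>"
        using \<delta>'(2)[of q] sd dq s by (simp add: qd mult_ac)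
      then have "0 \<le> fst q" using near[of q] dq sd by simp
      then show ?thesis using s by (simp add: q_def zero_le_mult_iff)
    qed
    have snd0: "snd \<nu> = 0"
    proof (rule ccontr)
      assume nz: "snd \<nu> \<noteq> 0"
      \<comment> \<open>For this \<open>l\<close> the spatial part of the inner product outweighs the time part by \<open>1\<close>.\<close>
      define l where "l = (\<bar>fst \<nu>\<bar> + 1) / (snd \<nu> \<bullet> snd \<nu>)"
      have "l * (snd \<nu> \<bullet> snd \<nu>) = \<bar>fst \<nu>\<bar> + 1" using nz by (simp add: l_def)
      then have "\<nu> \<bullet> (-1, - l *\<^sub>R snd \<nu>) < 0" by (simp add: inner_prod_def)
      from inward[OF this] show False by simp
    qed
    have n: "norm \<nu> = 1" using \<nu> by (simp add: is_outward_normal_def)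
    have "norm \<nu> = \<bar>fst \<nu>\<bar>" using snd0 by (cases \<nu>) (simp add: norm_Pair)
    then have "\<bar>fst \<nu>\<bar> = 1" using n by simp
    moreover have "\<not> fst \<nu> > 0"
    proof
      assume "fst \<nu> > 0"
      then have "\<nu> \<bullet> (-1, 0) < 0" by (simp add: inner_prod_def)
      from inward[OF this] show False by simp
    qed
    ultimately have "fst \<nu> = -1" by linarith
    then show ?thesis using snd0 by (simp add: prod_eq_iff)
  qed
  have "\<exists>!\<nu>. is_outward_normal (QT T \<Omega>) (0, x) \<nu>" by (rule ex1I) (fact ex, rule un)
  moreover have "(THE \<nu>. is_outward_normal (QT T \<Omega>) (0, x) \<nu>) = (-1, 0)" by (rule the_equality) (fact ex, rule un)
  ultimately show ?thesis by (simp only: outward_normal_def if_True)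
qed

section \<open>Initial and boundary values of Lipschitz functions\<close>

text \<open>The test function is a mollifier concentrated where \<open>E\<close> differs from \<open>E x\<close> by less than half of
  the absolute value of \<open>E x\<close>.\<close>

lemma continuous_eq_0_of_orthogonal:
  fixes E :: "'a::euclidean_space \<Rightarrow> real"
  assumes \<Omega>: "open \<Omega>" and E: "continuous_on \<Omega> E"
    and orth: "\<And>v. test_fun \<Omega> v \<Longrightarrow> (\<integral>x. v x * E x \<partial>lebesgue_on \<Omega>) = 0" and x: "x \<in> \<Omega>"
  shows "E x = 0"
proof (rule ccontr)
  assume nz: "E x \<noteq> 0"
  have SL: "\<Omega> \<in> sets lebesgue" using \<Omega> by auto
  define g where "g y = indicator \<Omega> y * E y" for y
  have g[measurable]: "g \<in> borel_measurable borel"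
    using borel_measurable_continuous_on_indicator[OF _ E] \<Omega> by (simp add: g_def[abs_def])
  have "isCont E x" using E \<Omega> x by (simp add: continuous_on_eq_continuous_at)
  then obtain d where d: "d > 0" "\<And>y. dist y x < d \<Longrightarrow> \<bar>E y - E x\<bar> < \<bar>E x\<bar> / 2"
    using nz unfolding continuous_at_eps_delta dist_real_def by (metis half_gt_zero zero_less_abs_iff)
  obtain \<rho> where \<rho>: "\<rho> > 0" "cball x \<rho> \<subseteq> \<Omega>" using \<Omega> x open_contains_cball by blast
  define \<epsilon> where "\<epsilon> = min d \<rho>"
  have \<epsilon>: "\<epsilon> > 0" "\<epsilon> \<le> d" "cball x \<epsilon> \<subseteq> \<Omega>" using d \<rho> by (auto simp: \<epsilon>_def)
  obtain K :: "'a \<Rightarrow> real" where K: "mollifier \<epsilon> K" using mollifier_exists[OF \<epsilon>(1)] by blast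
  note [measurable] = mollifier_measurable[OF K]
  note im = integrable_mollifier_translate[OF K]
  have Kz: "K (y - x) = 0" if "\<not> dist y x < \<epsilon>" for y using K that by (simp add: mollifier_def dist_norm)
  have gE: "g y = E y" if "dist y x < \<epsilon>" for y
    using subsetD[OF \<epsilon>(3), of y] that by (simp add: g_def dist_commute)
  have bd: "\<bar>E x * K (y - x) - K (y - x) * g y\<bar> \<le> (\<bar>E x\<bar> / 2) * K (y - x)" for y
  proof (cases "dist y x < \<epsilon>")
    case True
    have "\<bar>E x * K (y - x) - K (y - x) * g y\<bar> = \<bar>E y - E x\<bar> * K (y - x)"
      using K by (simp add: gE[OF True] mollifier_def abs_mult abs_minus_commute mult.commute[of "E x"] flip: right_diff_distrib)
    also have "\<dots> \<le> (\<bar>E x\<bar> / 2) * K (y - x)"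
      using d(2)[of y] True \<epsilon>(2) K by (intro mult_right_mono) (auto simp: mollifier_def)
    finally show ?thesis .
  qed (simp add: Kz)
  have i0: "integrable lborel (\<lambda>y. E x * K (y - x) - K (y - x) * g y)"
    by (rule Bochner_Integration.integrable_bound[of _ "\<lambda>y. (\<bar>E x\<bar> / 2) * K (y - x)"])
       (use im bd order_trans[OF bd abs_ge_self] in auto)
  have i1: "integrable lborel (\<lambda>y. K (y - x) * g y)"
    using Bochner_Integration.integrable_diff[OF integrable_mult_right[OF im(3), of "E x" x] i0] by simp
  have "(\<integral>y. K (y - x) * g y \<partial>lborel) = (\<integral>y. K (y - x) * g y \<partial>lebesgue_on \<Omega>)"
    by (rule integral_lebesgue_on_eq_lborel(1)[OF SL, symmetric]) (measurable, simp add: g_def)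
  also have "\<dots> = (\<integral>y. K (y - x) * E y \<partial>lebesgue_on \<Omega>)"
    by (intro Bochner_Integration.integral_cong) (auto simp: g_def space_restrict_space)
  also have "\<dots> = 0" by (rule orth[OF mollifier_test_fun[OF K \<epsilon>(3)]])
  finally have "(\<integral>y. E x * K (y - x) - K (y - x) * g y \<partial>lborel) = E x"
    using i1 im by simp
  moreover have "\<bar>\<integral>y. E x * K (y - x) - K (y - x) * g y \<partial>lborel\<bar> \<le> (\<integral>y. (\<bar>E x\<bar> / 2) * K (y - x) \<partial>lborel)"
    by (rule integral_abs_bound_integral[OF i0 _ bd]) (use im in auto)
  ultimately show False using nz im by simp
qed

lemma continuous_eq_0_of_AE:
  fixes u :: "'b::euclidean_space \<Rightarrow> real"
  assumes "open D" "continuous_on D u" "AE x in lborel. x \<in> D \<longrightarrow> u x = 0" "x \<in> D"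
  shows "u x = 0"
proof -
  let ?N = "{x \<in> D. u x \<noteq> 0}"
  have "?N = D \<inter> u -` (- {0})" by auto
  then have "open ?N" using continuous_open_preimage[OF assms(2,1), of "- {0}"] by auto
  moreover have "AE x in lborel. x \<notin> ?N" using assms(3) by eventually_elim auto
  then have "?N \<in> null_sets lborel"
    using \<open>open ?N\<close> AE_iff_null_sets[of ?N lborel] by auto
  then have "negligible ?N" by (simp add: negligible_iff_null_sets null_sets_completionI)
  ultimately have "?N = {}" using open_not_negligible by blast
  with assms(4) show ?thesis by auto
qed

text \<open>The function \<open>U\<close> itself serves as the representative. It is strongly measurable with values in the
  continuous functions because freezing time on a grid gives simple functions that converge to it
  uniformly in space.\<close>

lemma lipschitz_attains_data:
  fixes U :: "real \<times> 'a::euclidean_space \<Rightarrow> real"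
  assumes lip: "C-lipschitz_on ({0..T} \<times> UNIV) U" and T: "T > 0"
    and \<Omega>: "open \<Omega>" "bounded \<Omega>" "\<Omega> \<noteq> {}" and r: "r > 0"
    and ae: "AE p in lebesgue_on ({0..T} \<times> \<Omega>). U p = m p"
    and bd: "\<And>t x. t \<in> {0..T} \<Longrightarrow> x \<in> frontier \<Omega> \<Longrightarrow> U (t, x) = 0"
    and init: "AE x in lebesgue_on \<Omega>. U (0, x) = w x"
  shows "attains_data T \<Omega> r m w"
proof -
  have C0: "C \<ge> 0" using lip by (rule lipschitz_on_nonneg)
  have SL: "\<Omega> \<in> sets lebesgue" using \<Omega> by auto
  have Ut: "\<bar>U (t, x) - U (s, x)\<bar> \<le> C * \<bar>t - s\<bar>" if "t \<in> {0..T}" "s \<in> {0..T}" for t s x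
    using lipschitz_onD[OF lip, of "(t, x)" "(s, x)"] that by (simp add: dist_Pair_Pair dist_real_def)
  have Ux: "continuous_on UNIV (\<lambda>x. U (t, x))" if "t \<in> {0..T}" for t
    by (rule continuous_on_compose2[OF lipschitz_on_continuous_on[OF lip]]) (use that in \<open>auto intro!: continuous_intros\<close>)
  have "compact (QT T \<Omega>)" using \<Omega> by (intro compact_Times) (auto simp: compact_closure)
  then have "compact (U ` QT T \<Omega>)"
    by (rule compact_continuous_image[rotated]) (auto intro: continuous_on_subset[OF lipschitz_on_continuous_on[OF lip]])
  then obtain B where "\<forall>z\<in>U ` QT T \<Omega>. norm z \<le> B"
    using compact_imp_bounded[of "U ` QT T \<Omega>"] unfolding bounded_iff by auto
  then have B: "\<bar>U (t, x)\<bar> \<le> B" if "t \<in> {0..T}" "x \<in> closure \<Omega>" for t x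
    using that by auto
  have cl: "\<Omega> \<subseteq> closure \<Omega>" "closure \<Omega> \<noteq> {}" using \<Omega>(3) closure_subset by auto
  have mU: "(\<lambda>x. U (t, x)) \<in> borel_measurable (lebesgue_on \<Omega>)" if "t \<in> {0..T}" for t
    by (rule measurable_restrict_space1, rule measurable_completion)
       (use Ux[OF that] in \<open>simp add: borel_measurable_continuous_onI\<close>)
  have CL: "C_Lp T \<Omega> r (\<lambda>t x. U (t, x))"
    unfolding C_Lp_def
  proof (intro conjI ballI)
    fix t assume t: "t \<in> {0..T}"
    have "integrable (lebesgue_on \<Omega>) (\<lambda>x. norm (U (t, x)) powr r)"
    proof (rule integrable_bounded_lebesgue_on[OF \<Omega>(2) SL])
      show "(\<lambda>x. norm (U (t, x)) powr r) \<in> borel_measurable (lebesgue_on \<Omega>)" using mU[OF t] by measurable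
      show "AE x in lebesgue_on \<Omega>. norm (norm (U (t, x)) powr r) \<le> B powr r"
        using B[OF t] cl(1) r by (intro AE_I2) (auto simp: space_restrict_space intro!: powr_mono2)
    qed
    then show "Lp r \<Omega> (\<lambda>x. U (t, x))" using mU[OF t] by (simp add: Lp_def)
  next
    fix s assume s: "s \<in> {0..T}"
    let ?V = "measure lebesgue \<Omega>"
    interpret finite_measure "lebesgue_on \<Omega>" by (rule finite_measure_lebesgue_on_bounded[OF \<Omega>(2) SL])
    have "((\<lambda>t. (C * \<bar>t - s\<bar>) powr r * ?V) \<longlongrightarrow> 0 * ?V) (at s within {0..T})"
      by (intro tendsto_mult tendsto_const tendsto_zero_powrI[where b=r] always_eventually)
         (use C0 r in \<open>auto intro!: tendsto_eq_intros\<close>)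
    then have lim: "((\<lambda>t. (C * \<bar>t - s\<bar>) powr r * ?V) \<longlongrightarrow> 0) (at s within {0..T})" by simp
    show "((\<lambda>t. \<integral>x. \<bar>U (t, x) - U (s, x)\<bar> powr r \<partial>lebesgue_on \<Omega>) \<longlongrightarrow> 0) (at s within {0..T})"
    proof (rule tendsto_sandwich[OF _ _ tendsto_const lim])
      show "\<forall>\<^sub>F t in at s within {0..T}. 0 \<le> (\<integral>x. \<bar>U (t, x) - U (s, x)\<bar> powr r \<partial>lebesgue_on \<Omega>)"
        by (intro always_eventually allI integral_nonneg) simp
      have "(\<integral>x. \<bar>U (t, x) - U (s, x)\<bar> powr r \<partial>lebesgue_on \<Omega>) \<le> (C * \<bar>t - s\<bar>) powr r * ?V"
        if t: "t \<in> {0..T}" for t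
      proof -
        have b: "\<bar>U (t, x) - U (s, x)\<bar> powr r \<le> (C * \<bar>t - s\<bar>) powr r" for x
          using Ut[OF t s] r by (intro powr_mono2) auto
        have "integrable (lebesgue_on \<Omega>) (\<lambda>x. \<bar>U (t, x) - U (s, x)\<bar> powr r)"
          by (rule integrable_bounded_lebesgue_on[OF \<Omega>(2) SL, of _ "(C * \<bar>t - s\<bar>) powr r"])
             (use b mU[OF t] mU[OF s] in auto)
        then have "(\<integral>x. \<bar>U (t, x) - U (s, x)\<bar> powr r \<partial>lebesgue_on \<Omega>)
            \<le> (\<integral>x. (C * \<bar>t - s\<bar>) powr r \<partial>lebesgue_on \<Omega>)"
          by (rule integral_mono) (use b in auto)
        also have "\<dots> = (C * \<bar>t - s\<bar>) powr r * ?V"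
          using SL by (simp add: space_restrict_space measure_restrict_space)
        finally show ?thesis .
      qed
      then show "\<forall>\<^sub>F t in at s within {0..T}.
          (\<integral>x. \<bar>U (t, x) - U (s, x)\<bar> powr r \<partial>lebesgue_on \<Omega>) \<le> (C * \<bar>t - s\<bar>) powr r * ?V"
        by (simp add: eventually_at_filter)
    qed
  qed
  let ?N = "\<lambda>w. SUP x\<in>closure \<Omega>. \<bar>w x :: real\<bar>"
  have N_le: "?N w \<le> a" if "\<And>x. x \<in> closure \<Omega> \<Longrightarrow> \<bar>w x\<bar> \<le> a" for w a
    using cl(2) that by (rule cSUP_least)
  have N_ge: "\<bar>w x\<bar> \<le> ?N w" if "\<And>x. x \<in> closure \<Omega> \<Longrightarrow> \<bar>w x\<bar> \<le> a" "x \<in> closure \<Omega>" for w a x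
    by (rule cSUP_upper[OF that(2)]) (use that(1) in \<open>auto simp: bdd_above_def\<close>)
  have N0: "0 \<le> ?N w" if "\<And>x. x \<in> closure \<Omega> \<Longrightarrow> \<bar>w x\<bar> \<le> a" for w a
  proof -
    obtain x where x: "x \<in> closure \<Omega>" using cl(2) by (metis ex_in_conv)
    have "\<bar>w x\<bar> \<le> ?N w" by (rule N_ge[where a=a], erule that, rule x)
    then show ?thesis by (rule order_trans[OF abs_ge_zero])
  qed
  \<comment> \<open>Rounding down to multiples of \<open>1 / (k + 1)\<close> does not leave \<open>[0, T]\<close> and takes finitely many values there.\<close>
  define c where "c k t = real_of_int \<lfloor>real (Suc k) * t\<rfloor> / real (Suc k)" for k :: nat and t :: real
  have c: "c k t \<in> {0..T}" "\<bar>c k t - t\<bar> \<le> 1 / real (Suc k)" if t: "t \<in> {0..T}" for k t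
  proof -
    have le: "real_of_int \<lfloor>real (Suc k) * t\<rfloor> \<le> real (Suc k) * t" "real (Suc k) * t - 1 \<le> real_of_int \<lfloor>real (Suc k) * t\<rfloor>"
      by linarith+
    have n0: "real (Suc k) > 0" by simp
    have "t = (real (Suc k) * t) / real (Suc k)" "t - 1 / real (Suc k) = (real (Suc k) * t - 1) / real (Suc k)"
      using n0 by (simp_all add: diff_divide_distrib del: of_nat_Suc)
    then have u: "c k t \<le> t" "t - 1 / real (Suc k) \<le> c k t"
      using divide_right_mono[OF le(1), of "real (Suc k)"] divide_right_mono[OF le(2), of "real (Suc k)"]
      unfolding c_def by simp_all
    have "0 \<le> c k t" unfolding c_def using t by simp
    with u t show "c k t \<in> {0..T}" "\<bar>c k t - t\<bar> \<le> 1 / real (Suc k)" by auto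
  qed
  have csf: "simple_function (lebesgue_on {0..T}) (c k)" for k
  proof (rule simple_function_borel_measurable)
    have "c k \<in> borel_measurable borel" unfolding c_def by measurable
    then show "c k \<in> borel_measurable (lebesgue_on {0..T})"
      by (intro measurable_restrict_space1 measurable_completion) simp
    have "c k t \<in> (\<lambda>i::int. real_of_int i / real (Suc k)) ` {0..\<lfloor>real (Suc k) * T\<rfloor>}" if "t \<in> {0..T}" for t
      unfolding c_def using that by (intro imageI) (auto intro!: floor_mono mult_left_mono)
    then have "c k ` {0..T} \<subseteq> (\<lambda>i::int. real_of_int i / real (Suc k)) ` {0..\<lfloor>real (Suc k) * T\<rfloor>}" by blast
    from finite_subset[OF this] show "finite (c k ` space (lebesgue_on {0..T}))" by simp
  qed
  have L2: "L2_C T \<Omega> (\<lambda>t x. U (t, x))"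
    unfolding bochner_L2_def
  proof (intro conjI exI[of _ "\<lambda>k t x. U (c k t, x)"] allI ballI)
    fix k
    have "simple_function (lebesgue_on {0..T}) ((\<lambda>s x. U (s, x)) \<circ> c k)"
      by (rule simple_function_compose[OF csf])
    then show "simple_function (lebesgue_on {0..T}) (\<lambda>t x. U (c k t, x))" by (simp add: comp_def)
    show "continuous_on (closure \<Omega>) (\<lambda>x. U (c k t, x))" if "t \<in> {0..T}" for t
      by (rule continuous_on_subset[OF Ux]) (use c[OF that] in auto)
  next
    show "AE t in lebesgue_on {0..T}. continuous_on (closure \<Omega>) (\<lambda>x. U (t, x)) \<and>
        (\<lambda>k. ?N (\<lambda>x. U (c k t, x) - U (t, x))) \<longlonglongrightarrow> 0"
    proof (intro AE_I2 conjI)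
      fix t assume "t \<in> space (lebesgue_on {0..T})"
      then have t: "t \<in> {0..T}" by (simp add: space_restrict_space)
      show "continuous_on (closure \<Omega>) (\<lambda>x. U (t, x))" by (rule continuous_on_subset[OF Ux[OF t]]) simp
      have b: "\<bar>U (c k t, x) - U (t, x)\<bar> \<le> C * (1 / real (Suc k))" for k x
        using Ut[OF c(1)[OF t] t, of k x] mult_left_mono[OF c(2)[OF t, of k] C0] by linarith
      have "(\<lambda>k. C * (1 / real (Suc k))) \<longlonglongrightarrow> C * 0"
        using LIMSEQ_inverse_real_of_nat by (intro tendsto_mult tendsto_const) (simp add: inverse_eq_divide)
      then have lim: "(\<lambda>k. C * (1 / real (Suc k))) \<longlonglongrightarrow> 0" by simp
      show "(\<lambda>k. ?N (\<lambda>x. U (c k t, x) - U (t, x))) \<longlonglongrightarrow> 0"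
        by (rule tendsto_sandwich[OF _ _ tendsto_const lim]; intro always_eventually allI)
           (rule N0 N_le, rule b)+
    qed
    have Nt: "?N (\<lambda>x. U (t, x)) \<le> ?N (\<lambda>x. U (s, x)) + C * \<bar>t - s\<bar>" if ts: "t \<in> {0..T}" "s \<in> {0..T}" for t s
    proof (rule N_le)
      fix x assume x: "x \<in> closure \<Omega>"
      have "\<bar>U (s, x)\<bar> \<le> ?N (\<lambda>x. U (s, x))" by (rule N_ge[where a=B], rule B[OF ts(2)], assumption, rule x)
      then show "\<bar>U (t, x)\<bar> \<le> ?N (\<lambda>x. U (s, x)) + C * \<bar>t - s\<bar>" using Ut[OF ts, of x] by linarith
    qed
    have "C-lipschitz_on {0..T} (\<lambda>t. ?N (\<lambda>x. U (t, x)))"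
    proof (rule lipschitz_onI[OF _ C0])
      fix t s assume "t \<in> {0..T}" "s \<in> {0..T}"
      then show "dist (?N (\<lambda>x. U (t, x))) (?N (\<lambda>x. U (s, x))) \<le> C * dist t s"
        using Nt[of t s] Nt[of s t] by (simp add: dist_real_def abs_le_iff abs_minus_commute)
    qed
    then have "continuous_on {0..T} (\<lambda>t. ?N (\<lambda>x. U (t, x)))" by (rule lipschitz_on_continuous_on)
    then have "continuous_on {0..T} (\<lambda>t. (?N (\<lambda>x. U (t, x)))\<^sup>2)" by (intro continuous_intros)
    then have m2: "(\<lambda>t. (?N (\<lambda>x. U (t, x)))\<^sup>2) \<in> borel_measurable (lebesgue_on {0..T})"
      by (rule continuous_imp_measurable_on_sets_lebesgue) simp
    show "integrable (lebesgue_on {0..T}) (\<lambda>t. (?N (\<lambda>x. U (t, x)))\<^sup>2)"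
    proof (rule integrable_bounded_lebesgue_on[OF _ _ m2])
      show "AE t in lebesgue_on {0..T}. norm ((?N (\<lambda>x. U (t, x)))\<^sup>2) \<le> B\<^sup>2"
      proof (intro AE_I2)
        fix t assume "t \<in> space (lebesgue_on {0..T})"
        then have t: "t \<in> {0..T}" by (simp add: space_restrict_space)
        have "0 \<le> ?N (\<lambda>x. U (t, x))" "?N (\<lambda>x. U (t, x)) \<le> B"
          using N0[of "\<lambda>x. U (t, x)" B] N_le[of "\<lambda>x. U (t, x)" B] B[OF t] by blast+
        then show "norm ((?N (\<lambda>x. U (t, x)))\<^sup>2) \<le> B\<^sup>2" by (simp add: power_mono)
      qed
    qed auto
  qed
  show ?thesis
    unfolding attains_data_def
  proof (intro exI[of _ "\<lambda>t x. U (t, x)"] conjI CL L2)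
    show "AE (t, x) in lebesgue_on ({0..T} \<times> \<Omega>). U (t, x) = m (t, x)"
      using ae by (simp add: case_prod_unfold)
    show "AE t in lebesgue_on {0..T}. \<forall>x\<in>frontier \<Omega>. U (t, x) = 0"
      using bd by (intro AE_I2) (auto simp: space_restrict_space)
  qed (rule init)
qed

section \<open>Functions of the state\<close>

lemma C1_real:
  fixes \<beta> :: "real \<Rightarrow> real"
  assumes "\<beta> C1_differentiable_on UNIV"
  shows "continuous_on UNIV \<beta>" "continuous_on UNIV (deriv \<beta>)"
proof -
  obtain D where D: "\<And>x. (\<beta> has_vector_derivative D x) (at x)" "continuous_on UNIV D"
    using assms unfolding C1_differentiable_on_def by auto
  have d: "(\<beta> has_real_derivative D x) (at x)" for x
    using D(1) by (simp add: has_real_derivative_iff_has_vector_derivative)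
  then have "deriv \<beta> = D" by (auto intro: DERIV_imp_deriv)
  then show "continuous_on UNIV (deriv \<beta>)" using D(2) by simp
  show "continuous_on UNIV \<beta>" by (intro continuous_at_imp_continuous_on ballI DERIV_isCont[OF d])
qed

lemma C1_id: "(\<lambda>y::real. y) C1_differentiable_on UNIV" "deriv (\<lambda>y::real. y) = (\<lambda>y. 1)"
  by (auto intro!: DERIV_imp_deriv)

lemma C1_square: "(\<lambda>y::real. y\<^sup>2) C1_differentiable_on UNIV" "deriv (\<lambda>y::real. y\<^sup>2) = (\<lambda>y. 2 * y)"
proof -
  have D: "((\<lambda>y::real. y\<^sup>2) has_real_derivative 2 * y) (at y)" for y
    by (auto intro!: derivative_eq_intros)
  show "(\<lambda>y::real. y\<^sup>2) C1_differentiable_on UNIV"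
    unfolding C1_differentiable_on_def
    by (intro exI[of _ "\<lambda>y. 2 * y"] conjI ballI continuous_intros
        D[unfolded has_real_derivative_iff_has_vector_derivative])
  show "deriv (\<lambda>y::real. y\<^sup>2) = (\<lambda>y. 2 * y)" using D by (auto intro: DERIV_imp_deriv)
qed

lemma C1_const: "(\<lambda>y::real. c::real) C1_differentiable_on UNIV" "deriv (\<lambda>y::real. c::real) = (\<lambda>y. 0)"
  by (auto intro!: DERIV_imp_deriv)

lemma C1_scaled: "(\<lambda>y::real. 2 * y) C1_differentiable_on UNIV" "deriv (\<lambda>y::real. 2 * y) = (\<lambda>y. 2)"
  by (auto intro!: DERIV_imp_deriv derivative_eq_intros)

lemma continuous_state_functions:
  fixes \<beta> :: "real \<Rightarrow> real" and j :: "'a::euclidean_space"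
  assumes "continuous_on UNIV \<beta>"
  shows "continuous_on UNIV (\<lambda>(y, z0 :: real, z :: 'a). \<beta> y)"
    and "continuous_on UNIV (\<lambda>(y, z0, z :: 'a). z0 * \<beta> y)"
    and "continuous_on UNIV (\<lambda>(y, z0 :: real, z). (z \<bullet> j) * \<beta> y)"
    and "continuous_on UNIV (\<lambda>(y, z0 :: real, z :: 'a). \<beta> y * (norm z)\<^sup>2)"
proof -
  have "continuous_on UNIV (\<lambda>\<xi> :: real \<times> real \<times> 'a. \<beta> (fst \<xi>))"
    by (rule continuous_on_compose2[OF assms]) (auto intro!: continuous_intros)
  then show "continuous_on UNIV (\<lambda>(y, z0 :: real, z :: 'a). \<beta> y)"
    and "continuous_on UNIV (\<lambda>(y, z0, z :: 'a). z0 * \<beta> y)"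
    and "continuous_on UNIV (\<lambda>(y, z0 :: real, z). (z \<bullet> j) * \<beta> y)"
    and "continuous_on UNIV (\<lambda>(y, z0 :: real, z :: 'a). \<beta> y * (norm z)\<^sup>2)"
    unfolding case_prod_unfold by (auto intro!: continuous_intros)
qed

section \<open>Occupation measures and their fibres\<close>

text \<open>Continuity and boundedness of \<open>y0\<close> come from a continuous weak solution. They make the
  initial value of the Lipschitz representative of \<open>\<langle>\<beta>(y)\<rangle>\<close> comparable with \<open>\<beta> \<circ> y0\<close> pointwise.\<close>

locale occupation_setting =
  fixes T r :: real and \<Omega> :: "'a::euclidean_space set" and f :: "real \<Rightarrow> 'a \<Rightarrow> real \<Rightarrow> real"
    and y0 :: "'a \<Rightarrow> real" and Y :: "real set" and Z :: "(real \<times> 'a) set"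
    and M Mb :: "((real \<times> 'a) \<times> real \<times> real \<times> 'a) measure"
    and \<mu> :: "real \<times> 'a \<Rightarrow> (real \<times> real \<times> 'a) measure"
  assumes T: "T > 0" and \<Omega>: "open \<Omega>" "bounded \<Omega>" "\<Omega> \<noteq> {}" and lipb: "lipschitz_boundary \<Omega>"
    and r: "r > 0" and adm: "admissible_rhs T \<Omega> f"
    and YZ: "compact Y" "compact Z"
    and y0: "continuous_on \<Omega> y0" "bounded (y0 ` \<Omega>)"
    and finM: "finite_borel_measure_on (QT T \<Omega> \<times> Y \<times> Z) M"
    and finMb: "finite_borel_measure_on (frontier (QT T \<Omega>) \<times> Y \<times> Z) Mb"
    and occ: "occupation_identities T \<Omega> f y0 M Mb"
    and disint: "disintegration ({0..T} \<times> \<Omega>) (Y \<times> Z) M \<mu>"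

sublocale occupation_setting \<subseteq> disintegrated_measure "{0..T} \<times> \<Omega>" "Y \<times> Z" M \<mu>
proof (rule disintegrated_measure.intro)
  show "{0..T} \<times> \<Omega> \<in> sets borel" using \<Omega>(1) by (intro borel_Times) auto
  show "{0..T} \<times> \<Omega> \<noteq> {}" using T \<Omega>(3) by auto
  show "Y \<times> Z \<in> sets borel" using YZ by (intro borel_closed compact_imp_closed compact_Times)
  show "sets M = sets borel" "finite_measure M" using finM by (simp_all add: finite_borel_measure_on_def)
qed (rule disint)

context occupation_setting
begin

abbreviation "S \<equiv> {0..T} \<times> \<Omega>"
abbreviation "E \<equiv> Y \<times> Z"

lemma SL: "S \<in> sets lebesgue" using S by auto

lemma bounded_S: "bounded S" using \<Omega> by (intro bounded_Times) auto

lemma LS_complete: "complete_measure LS" by (rule complete_measure_lebesgue_on[OF SL])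

lemma LS_AE_mem: "AE p in LS. p \<in> S" using AE_space[of LS] by (rule eventually_mono) (simp add: space_restrict_space)

lemma completion_complete: "complete_measure (completion N)"
  by (rule completion.complete_measure_axioms)

lemma E_compact: "compact E" using YZ by (intro compact_Times)

lemma E_bound:
  fixes c :: "real \<times> real \<times> 'a \<Rightarrow> 'd::real_normed_vector"
  assumes "continuous_on UNIV c"
  shows "\<exists>B\<ge>0. \<forall>\<xi>\<in>E. norm (c \<xi>) \<le> B"
proof -
  have "bounded (c ` E)"
    by (intro compact_imp_bounded compact_continuous_image E_compact continuous_on_subset[OF assms]) auto
  then obtain B where "\<forall>\<xi>\<in>E. norm (c \<xi>) \<le> B" unfolding bounded_iff by auto
  then show ?thesis by (intro exI[of _ "max B 0"]) (auto simp: le_max_iff_disj)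
qed

text \<open>Both \<open>h\<close> and \<open>k\<close> agree only almost everywhere in the base variable with jointly measurable
  functions. Since Lebesgue measure and the completion of \<open>M\<close> are complete, the disintegration
  formula is not affected.\<close>

lemma integral_state_function:
  fixes k :: "real \<times> 'a \<Rightarrow> real \<times> real \<times> 'a \<Rightarrow> real"
  assumes kh: "kh \<in> borel_measurable (lebesgue \<Otimes>\<^sub>M borel)" and eq: "AE p in LS. \<forall>\<xi>. k p \<xi> = kh (p, \<xi>)"
    and bd: "AE p in LS. \<forall>\<xi>\<in>E. \<bar>k p \<xi>\<bar> \<le> B" and h: "integrable LS h"
  shows "integrable (completion M) (\<lambda>x. h (fst x) * k (fst x) (snd x))"
    and "integrable LS (\<lambda>p. h p * (\<integral>\<xi>. k p \<xi> \<partial>\<mu> p))"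
    and "(\<integral>x. h (fst x) * k (fst x) (snd x) \<partial>completion M) = (\<integral>p. h p * (\<integral>\<xi>. k p \<xi> \<partial>\<mu> p) \<partial>LS)"
proof -
  define h' where "h' p = (if p \<in> S then h p else 0)" for p
  have h'm: "h' \<in> borel_measurable lebesgue"
    unfolding h'_def by (rule borel_measurable_if_I[OF _ SL]) (use h in auto)
  let ?\<Phi> = "\<lambda>x. h' (fst x) * kh x"
  have m: "?\<Phi> \<in> borel_measurable (lebesgue \<Otimes>\<^sub>M borel)"
    using kh measurable_compose[OF measurable_fst h'm] by measurable
  have a: "integrable LS (\<lambda>p. \<bar>h p\<bar> * B)" using h by auto
  have b: "AE p in LS. \<forall>\<xi>\<in>E. \<bar>?\<Phi> (p, \<xi>)\<bar> \<le> \<bar>h p\<bar> * B"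
    using eq bd LS_AE_mem
  proof eventually_elim
    case (elim p)
    show ?case
    proof
      fix \<xi> assume "\<xi> \<in> E"
      then have "\<bar>k p \<xi>\<bar> \<le> B" by (rule bspec[OF elim(2)])
      moreover have "k p \<xi> = kh (p, \<xi>)" by (rule spec[OF elim(1)])
      ultimately show "\<bar>?\<Phi> (p, \<xi>)\<bar> \<le> \<bar>h p\<bar> * B"
        using elim(3) by (auto simp: h'_def abs_mult intro!: mult_left_mono)
    qed
  qed
  note D = integral_disintegration[OF m a b]
  have aeM: "AE x in completion M. ?\<Phi> x = h (fst x) * k (fst x) (snd x)"
    by (rule AE_completion) (use AE_base[OF eq] in eventually_elim, auto simp: h'_def)
  have mM: "(\<lambda>x. h (fst x) * k (fst x) (snd x)) \<in> borel_measurable (completion M)"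
    by (rule complete_measure.borel_measurable_AE_eq[OF completion_complete _ aeM]) (use D(1) in auto)
  show "integrable (completion M) (\<lambda>x. h (fst x) * k (fst x) (snd x))"
    using integrable_cong_AE[OF _ mM aeM] D(1) by auto
  have aeL: "AE p in LS. (\<integral>\<xi>. ?\<Phi> (p, \<xi>) \<partial>\<mu> p) = h p * (\<integral>\<xi>. k p \<xi> \<partial>\<mu> p)"
    using eq LS_AE_mem
  proof eventually_elim
    case (elim p)
    have "(\<lambda>\<xi>. ?\<Phi> (p, \<xi>)) = (\<lambda>\<xi>. h p * k p \<xi>)"
    proof
      fix \<xi>
      have "k p \<xi> = kh (p, \<xi>)" by (rule spec[OF elim(1)])
      then show "?\<Phi> (p, \<xi>) = h p * k p \<xi>" using elim(2) by (simp only: h'_def fst_conv if_True)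
    qed
    then show ?case by (simp only: integral_mult_right_zero)
  qed
  have mL: "(\<lambda>p. h p * (\<integral>\<xi>. k p \<xi> \<partial>\<mu> p)) \<in> borel_measurable LS"
    by (rule complete_measure.borel_measurable_AE_eq[OF LS_complete _ aeL]) (use D(2) in auto)
  show "integrable LS (\<lambda>p. h p * (\<integral>\<xi>. k p \<xi> \<partial>\<mu> p))"
    using integrable_cong_AE[OF _ mL aeL] D(2) by auto
  have "(\<integral>x. h (fst x) * k (fst x) (snd x) \<partial>completion M) = (\<integral>x. ?\<Phi> x \<partial>completion M)"
    using aeM D(1) mM by (intro integral_cong_AE) auto
  also have "\<dots> = (\<integral>p. h p * (\<integral>\<xi>. k p \<xi> \<partial>\<mu> p) \<partial>LS)"
    unfolding D(3) using aeL D(2) mL by (intro integral_cong_AE) auto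
  finally show "(\<integral>x. h (fst x) * k (fst x) (snd x) \<partial>completion M) = (\<integral>p. h p * (\<integral>\<xi>. k p \<xi> \<partial>\<mu> p) \<partial>LS)" .
qed

lemma integral_separated:
  fixes c :: "real \<times> real \<times> 'a \<Rightarrow> real"
  assumes c: "continuous_on UNIV c" and h: "integrable LS h"
  shows "integrable (completion M) (\<lambda>x. h (fst x) * c (snd x))"
    and "integrable LS (\<lambda>p. h p * (\<integral>\<xi>. c \<xi> \<partial>\<mu> p))"
    and "(\<integral>x. h (fst x) * c (snd x) \<partial>completion M) = (\<integral>p. h p * (\<integral>\<xi>. c \<xi> \<partial>\<mu> p) \<partial>LS)"
proof -
  obtain B where "\<forall>\<xi>\<in>E. \<bar>c \<xi>\<bar> \<le> B" using E_bound[OF c] by auto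
  then have b: "AE p in LS. \<forall>\<xi>\<in>E. \<bar>c \<xi>\<bar> \<le> B" by simp
  have m: "(\<lambda>x. c (snd x)) \<in> borel_measurable (lebesgue \<Otimes>\<^sub>M borel :: ((real \<times> 'a) \<times> real \<times> real \<times> 'a) measure)"
    by (rule measurable_compose[OF measurable_snd]) (rule borel_measurable_continuous_onI[OF c])
  note D = integral_state_function[where k="\<lambda>p. c", OF m _ b h]
  show "integrable (completion M) (\<lambda>x. h (fst x) * c (snd x))"
    "integrable LS (\<lambda>p. h p * (\<integral>\<xi>. c \<xi> \<partial>\<mu> p))"
    "(\<integral>x. h (fst x) * c (snd x) \<partial>completion M) = (\<integral>p. h p * (\<integral>\<xi>. c \<xi> \<partial>\<mu> p) \<partial>LS)"
    using D by simp_all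
qed

text \<open>A function that is measurable in \<open>(t, x)\<close> and continuous in \<open>y\<close> is the limit of its values at \<open>y\<close>
  rounded down to a grid; each of these approximations consists of countably many measurable slices.\<close>

lemma rhs_measurable_version:
  "\<exists>g. g \<in> borel_measurable (lebesgue \<Otimes>\<^sub>M borel) \<and> (AE p in LS. \<forall>y. f (fst p) (snd p) y = g (p, y))"
proof -
  let ?f = "\<lambda>p y. f (fst p) (snd p) y"
  have fm: "(\<lambda>p. ?f p y) \<in> borel_measurable LS" for y
    using adm by (simp add: admissible_rhs_def case_prod_unfold)
  have "AE p in LS. continuous_on UNIV (?f p)"
    using adm by (simp add: admissible_rhs_def case_prod_unfold)
  then obtain N where N: "{p \<in> space LS. \<not> continuous_on UNIV (?f p)} \<subseteq> N" "emeasure LS N = 0" "N \<in> sets LS"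
    by (rule AE_E)
  have "N \<in> sets lebesgue" using N(3) SL by (simp add: sets_restrict_space_iff)
  then have NL: "S - N \<in> sets lebesgue" by (rule sets.Diff[OF SL])
  define g where "g x = (if fst x \<in> S - N then ?f (fst x) (snd x) else 0)" for x :: "(real \<times> 'a) \<times> real"
  define gk where "gk k x = g (fst x, real_of_int \<lfloor>real (Suc k) * snd x\<rfloor> / real (Suc k))" for k :: nat and x :: "(real \<times> 'a) \<times> real"
  have slice: "(\<lambda>p. g (p, y)) \<in> borel_measurable lebesgue" for y
  proof -
    have "(\<lambda>p. if p \<in> S then ?f p y else 0) \<in> borel_measurable lebesgue" by (rule borel_measurable_if_I[OF fm SL])
    then have "(\<lambda>p. indicator (S - N) p * (if p \<in> S then ?f p y else 0)) \<in> borel_measurable lebesgue"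
      by (rule borel_measurable_times[OF borel_measurable_indicator[OF NL]])
    moreover have "(\<lambda>p. indicator (S - N) p * (if p \<in> S then ?f p y else 0)) = (\<lambda>p. g (p, y))"
      by (rule ext) (simp add: g_def indicator_def)
    ultimately show ?thesis by simp
  qed
  have gkm: "gk k \<in> borel_measurable (lebesgue \<Otimes>\<^sub>M borel)" for k
    unfolding gk_def
  proof (rule measurable_compose_countable[where g="\<lambda>x. \<lfloor>real (Suc k) * snd x\<rfloor>" and f="\<lambda>i x. g (fst x, real_of_int i / real (Suc k))"])
    show "(\<lambda>x. g (fst x, real_of_int i / real (Suc k))) \<in> borel_measurable (lebesgue \<Otimes>\<^sub>M borel)" for i
      by (rule measurable_compose[OF measurable_fst slice])
    show "(\<lambda>x. \<lfloor>real (Suc k) * snd x\<rfloor>) \<in> lebesgue \<Otimes>\<^sub>M borel \<rightarrow>\<^sub>M count_space UNIV"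
      by (rule measurable_compose[OF measurable_snd]) measurable
  qed
  have lim: "(\<lambda>k. gk k x) \<longlonglongrightarrow> g x" for x
  proof (cases "fst x \<in> S - N")
    case True
    then have "continuous_on UNIV (?f (fst x))" using N(1) by (auto simp: space_restrict_space)
    then have c: "isCont (?f (fst x)) (snd x)" by (simp add: continuous_on_eq_continuous_at)
    have "(\<lambda>k. real_of_int \<lfloor>real (Suc k) * snd x\<rfloor> / real (Suc k)) \<longlonglongrightarrow> snd x"
    proof (rule tendsto_sandwich[OF always_eventually always_eventually])
      have n0: "real (Suc k) > 0" for k by simp
      show "\<forall>k. snd x - 1 / real (Suc k) \<le> real_of_int \<lfloor>real (Suc k) * snd x\<rfloor> / real (Suc k)"
      proof
        fix k
        have "(real (Suc k) * snd x - 1) / real (Suc k) \<le> real_of_int \<lfloor>real (Suc k) * snd x\<rfloor> / real (Suc k)"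
          by (intro divide_right_mono) linarith+
        moreover have "(real (Suc k) * snd x - 1) / real (Suc k) = snd x - 1 / real (Suc k)"
          using n0[of k] by (simp add: diff_divide_distrib del: of_nat_Suc)
        ultimately show "snd x - 1 / real (Suc k) \<le> real_of_int \<lfloor>real (Suc k) * snd x\<rfloor> / real (Suc k)" by simp
      qed
      show "\<forall>k. real_of_int \<lfloor>real (Suc k) * snd x\<rfloor> / real (Suc k) \<le> snd x"
      proof
        fix k
        have "real_of_int \<lfloor>real (Suc k) * snd x\<rfloor> / real (Suc k) \<le> (real (Suc k) * snd x) / real (Suc k)"
          by (intro divide_right_mono) linarith+
        then show "real_of_int \<lfloor>real (Suc k) * snd x\<rfloor> / real (Suc k) \<le> snd x"
          using n0[of k] by (simp del: of_nat_Suc)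
      qed
      have "(\<lambda>k. snd x - inverse (real (Suc k))) \<longlonglongrightarrow> snd x - 0"
        by (intro tendsto_diff tendsto_const LIMSEQ_inverse_real_of_nat)
      then show "(\<lambda>k. snd x - 1 / real (Suc k)) \<longlonglongrightarrow> snd x" by (simp add: inverse_eq_divide)
    qed simp
    from isCont_tendsto_compose[OF c this] show ?thesis
      using True by (simp add: gk_def g_def)
  next
    case False
    then have z: "g (fst x, y) = 0" for y by (simp only: g_def fst_conv if_False)
    have "gk k x = 0" for k by (simp only: gk_def z)
    moreover have "g x = 0" using z[of "snd x"] by simp
    ultimately show ?thesis by simp
  qed
  have "g \<in> borel_measurable (lebesgue \<Otimes>\<^sub>M borel)"
    by (rule borel_measurable_LIMSEQ_metric[OF gkm lim])
  moreover have "N \<in> null_sets LS" using N by auto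
  then have "AE p in LS. p \<notin> N" by (rule AE_not_in)
  then have "AE p in LS. \<forall>y. ?f p y = g (p, y)"
    using LS_AE_mem by eventually_elim (auto simp: g_def)
  ultimately show ?thesis by blast
qed

lemma rhs_bound: "\<exists>B\<ge>0. AE p in LS. \<forall>y\<in>Y. \<bar>f (fst p) (snd p) y\<bar> \<le> B"
  using adm YZ(1) unfolding admissible_rhs_def case_prod_unfold by blast

lemma rhs_state_function:
  fixes b :: "real \<times> real \<times> 'a \<Rightarrow> real"
  assumes b: "continuous_on UNIV b"
  shows "\<exists>kh B. kh \<in> borel_measurable (lebesgue \<Otimes>\<^sub>M borel) \<and> B \<ge> 0 \<and>
    (AE p in LS. \<forall>\<xi>. b \<xi> * f (fst p) (snd p) (fst \<xi>) = kh (p, \<xi>)) \<and>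
    (AE p in LS. \<forall>\<xi>\<in>E. \<bar>b \<xi> * f (fst p) (snd p) (fst \<xi>)\<bar> \<le> B)"
proof -
  obtain g where g: "g \<in> borel_measurable (lebesgue \<Otimes>\<^sub>M borel)" "AE p in LS. \<forall>y. f (fst p) (snd p) y = g (p, y)"
    using rhs_measurable_version by blast
  obtain B1 where B1: "B1 \<ge> 0" "AE p in LS. \<forall>y\<in>Y. \<bar>f (fst p) (snd p) y\<bar> \<le> B1" using rhs_bound by blast
  obtain B2 where B2: "B2 \<ge> 0" "\<forall>\<xi>\<in>E. \<bar>b \<xi>\<bar> \<le> B2" using E_bound[OF b] by auto
  have mb: "(\<lambda>x. b (snd x)) \<in> borel_measurable (lebesgue \<Otimes>\<^sub>M borel :: ((real \<times> 'a) \<times> real \<times> real \<times> 'a) measure)"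
    by (rule measurable_compose[OF measurable_snd]) (rule borel_measurable_continuous_onI[OF b])
  have "fst \<in> (borel :: (real \<times> real \<times> 'a) measure) \<rightarrow>\<^sub>M borel"
    by (rule borel_measurable_continuous_onI) (intro continuous_intros)
  then have "(\<lambda>x. (fst x, fst (snd x))) \<in> (lebesgue \<Otimes>\<^sub>M borel :: ((real \<times> 'a) \<times> real \<times> real \<times> 'a) measure) \<rightarrow>\<^sub>M lebesgue \<Otimes>\<^sub>M borel"
    by (intro measurable_Pair measurable_fst measurable_compose[OF measurable_snd])
  from measurable_compose[OF this g(1)]
  have mg: "(\<lambda>x. g (fst x, fst (snd x))) \<in> borel_measurable (lebesgue \<Otimes>\<^sub>M borel :: ((real \<times> 'a) \<times> real \<times> real \<times> 'a) measure)" .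
  show ?thesis
  proof (intro exI[of _ "\<lambda>x. b (snd x) * g (fst x, fst (snd x))"] exI[of _ "B2 * B1"] conjI)
    show "(\<lambda>x. b (snd x) * g (fst x, fst (snd x))) \<in> borel_measurable (lebesgue \<Otimes>\<^sub>M borel)"
      using mb mg by (rule borel_measurable_times)
    show "0 \<le> B2 * B1" using B1 B2 by simp
    show "AE p in LS. \<forall>\<xi>. b \<xi> * f (fst p) (snd p) (fst \<xi>) = b (snd (p, \<xi>)) * g (fst (p, \<xi>), fst (snd (p, \<xi>)))"
      using g(2) by eventually_elim simp
    show "AE p in LS. \<forall>\<xi>\<in>E. \<bar>b \<xi> * f (fst p) (snd p) (fst \<xi>)\<bar> \<le> B2 * B1"
      using B1(2) by eventually_elim (use B2 in \<open>auto simp: abs_mult intro!: mult_mono\<close>)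
  qed
qed

lemma integral_separated_rhs:
  fixes b :: "real \<times> real \<times> 'a \<Rightarrow> real"
  assumes b: "continuous_on UNIV b" and h: "integrable LS h"
  shows "integrable (completion M) (\<lambda>x. h (fst x) * (b (snd x) * f (fst (fst x)) (snd (fst x)) (fst (snd x))))"
    and "integrable LS (\<lambda>p. h p * (\<integral>\<xi>. b \<xi> * f (fst p) (snd p) (fst \<xi>) \<partial>\<mu> p))"
    and "(\<integral>x. h (fst x) * (b (snd x) * f (fst (fst x)) (snd (fst x)) (fst (snd x))) \<partial>completion M)
      = (\<integral>p. h p * (\<integral>\<xi>. b \<xi> * f (fst p) (snd p) (fst \<xi>) \<partial>\<mu> p) \<partial>LS)"
proof -
  obtain kh B where kh: "kh \<in> borel_measurable (lebesgue \<Otimes>\<^sub>M borel)"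
    "AE p in LS. \<forall>\<xi>. b \<xi> * f (fst p) (snd p) (fst \<xi>) = kh (p, \<xi>)"
    "AE p in LS. \<forall>\<xi>\<in>E. \<bar>b \<xi> * f (fst p) (snd p) (fst \<xi>)\<bar> \<le> B"
    using rhs_state_function[OF b] by blast
  note D = integral_state_function[where k="\<lambda>p \<xi>. b \<xi> * f (fst p) (snd p) (fst \<xi>)", OF kh h]
  show "integrable (completion M) (\<lambda>x. h (fst x) * (b (snd x) * f (fst (fst x)) (snd (fst x)) (fst (snd x))))"
    by (rule D(1))
  show "integrable LS (\<lambda>p. h p * (\<integral>\<xi>. b \<xi> * f (fst p) (snd p) (fst \<xi>) \<partial>\<mu> p))" by (rule D(2))
  show "(\<integral>x. h (fst x) * (b (snd x) * f (fst (fst x)) (snd (fst x)) (fst (snd x))) \<partial>completion M)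
      = (\<integral>p. h p * (\<integral>\<xi>. b \<xi> * f (fst p) (snd p) (fst \<xi>) \<partial>\<mu> p) \<partial>LS)" by (rule D(3))
qed

lemma Mb_finite: "finite_measure (completion Mb)"
proof -
  interpret finite_measure Mb using finMb by (simp add: finite_borel_measure_on_def)
  show ?thesis
  proof
    have "emeasure (completion Mb) (space (completion Mb)) = emeasure Mb (space Mb)" by simp
    then show "emeasure (completion Mb) (space (completion Mb)) \<noteq> \<infinity>" by simp
  qed
qed

lemma Mb_measurable: "g \<in> borel_measurable borel \<Longrightarrow> g \<in> borel_measurable (completion Mb)"
  using finMb by (intro measurable_completion) (simp add: finite_borel_measure_on_def cong: measurable_cong_sets)

lemma AE_Mb: "AE x in completion Mb. fst x \<in> frontier (QT T \<Omega>) \<and> snd x \<in> E"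
proof -
  let ?C = "frontier (QT T \<Omega>) \<times> Y \<times> Z"
  have "closed ?C" using YZ by (intro closed_Times frontier_closed compact_imp_closed)
  then have "- ?C \<in> null_sets Mb"
    using finMb by (auto simp: finite_borel_measure_on_def null_sets_def)
  then have "AE x in Mb. x \<notin> - ?C" by (rule AE_not_in)
  then show ?thesis by (intro AE_completion) (auto elim!: eventually_mono)
qed

lemma bdQ_closed: "closed (bdQ i T \<Omega>)"
  unfolding bdQ_def by (auto intro!: closed_Times frontier_closed)

lemma
  assumes "smooth \<phi>" "H1_trace \<Omega> v G g" "\<beta> C1_differentiable_on UNIV"
  defines "w \<equiv> (\<lambda>x. if x \<in> \<Omega> then v x else g x)" and "\<eta> \<equiv> outward_normal (QT T \<Omega>)"
  shows occ_time: "(\<integral>((t, x), y, z0, z). deriv \<phi> t * w x * \<beta> y + z0 * (\<phi> t * w x * deriv \<beta> y) \<partial>completion M)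
          - (\<integral>((t, x), y, z0, z). \<phi> t * w x * \<beta> y * fst (\<eta> (t, x)) \<partial>completion Mb) = 0"
    and occ_space: "j \<in> Basis \<Longrightarrow>
          (\<integral>((t, x), y, z0, z). \<phi> t * (G x \<bullet> j) * \<beta> y + (z \<bullet> j) * (\<phi> t * w x * deriv \<beta> y) \<partial>completion M)
            - (\<integral>((t, x), y, z0, z). \<phi> t * w x * \<beta> y * (snd (\<eta> (t, x)) \<bullet> j) \<partial>completion Mb) = 0"
    and occ_pde: "(\<integral>((t, x), y, z0, z). \<phi> t * w x * \<beta> y * (z0 - f t x y)
              + (\<Sum>j\<in>Basis. (\<phi> t * (G x \<bullet> j) * \<beta> y + (z \<bullet> j) * (\<phi> t * w x * deriv \<beta> y)) * (z \<bullet> j))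
              \<partial>completion M)
          - (\<Sum>j\<in>Basis. \<integral>((t, x), y, z0, z). \<phi> t * w x * \<beta> y * (z \<bullet> j) * (snd (\<eta> (t, x)) \<bullet> j)
              \<partial>completion Mb) = 0"
    and occ_init: "(\<integral>((t, x), y, z0, z)\<in>bdQ 1 T \<Omega> \<times> UNIV. \<phi> t * w x * \<beta> y \<partial>completion Mb)
          = (\<integral>x. \<phi> 0 * v x * \<beta> (y0 x) \<partial>lebesgue_on \<Omega>)"
    and occ_lateral: "(\<integral>((t, x), y, z0, z)\<in>bdQ 3 T \<Omega> \<times> UNIV. \<phi> t * w x * \<beta> y \<partial>completion Mb)
          = (\<integral>(t, x)\<in>bdQ 3 T \<Omega>. \<phi> t * g x * \<beta> 0 \<partial>hausdorff_measure DIM('a))"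
proof -
  note A = occ[unfolded occupation_identities_def Let_def, THEN conjunct1, rule_format,
      OF conjI[OF assms(1) conjI[OF assms(2,3)]], folded w_def \<eta>_def]
  show "(\<integral>((t, x), y, z0, z). deriv \<phi> t * w x * \<beta> y + z0 * (\<phi> t * w x * deriv \<beta> y) \<partial>completion M)
          - (\<integral>((t, x), y, z0, z). \<phi> t * w x * \<beta> y * fst (\<eta> (t, x)) \<partial>completion Mb) = 0"
    using A[THEN conjunct1] unfolding w_def .
  show "j \<in> Basis \<Longrightarrow>
          (\<integral>((t, x), y, z0, z). \<phi> t * (G x \<bullet> j) * \<beta> y + (z \<bullet> j) * (\<phi> t * w x * deriv \<beta> y) \<partial>completion M)
            - (\<integral>((t, x), y, z0, z). \<phi> t * w x * \<beta> y * (snd (\<eta> (t, x)) \<bullet> j) \<partial>completion Mb) = 0"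
    using A[THEN conjunct2, THEN conjunct1] unfolding w_def by (rule bspec)
  show "(\<integral>((t, x), y, z0, z). \<phi> t * w x * \<beta> y * (z0 - f t x y)
              + (\<Sum>j\<in>Basis. (\<phi> t * (G x \<bullet> j) * \<beta> y + (z \<bullet> j) * (\<phi> t * w x * deriv \<beta> y)) * (z \<bullet> j))
              \<partial>completion M)
          - (\<Sum>j\<in>Basis. \<integral>((t, x), y, z0, z). \<phi> t * w x * \<beta> y * (z \<bullet> j) * (snd (\<eta> (t, x)) \<bullet> j)
              \<partial>completion Mb) = 0"
    using A[THEN conjunct2, THEN conjunct2, THEN conjunct1] unfolding w_def .
  show "(\<integral>((t, x), y, z0, z)\<in>bdQ 1 T \<Omega> \<times> UNIV. \<phi> t * w x * \<beta> y \<partial>completion Mb)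
          = (\<integral>x. \<phi> 0 * v x * \<beta> (y0 x) \<partial>lebesgue_on \<Omega>)"
    using A[THEN conjunct2, THEN conjunct2, THEN conjunct2, THEN conjunct1] unfolding w_def .
  show "(\<integral>((t, x), y, z0, z)\<in>bdQ 3 T \<Omega> \<times> UNIV. \<phi> t * w x * \<beta> y \<partial>completion Mb)
          = (\<integral>(t, x)\<in>bdQ 3 T \<Omega>. \<phi> t * g x * \<beta> 0 \<partial>hausdorff_measure DIM('a))"
    using A[THEN conjunct2, THEN conjunct2, THEN conjunct2, THEN conjunct2] unfolding w_def .
qed

text \<open>The lateral identity with constant \<open>\<phi>\<close> and \<open>v\<close> and with \<open>\<beta>(y) = y\<^sup>2\<close> shows that \<open>y\<^sup>2\<close> has integral
  zero over the lateral boundary.\<close>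

lemma lateral_value_zero: "AE x in completion Mb. fst x \<in> bdQ 3 T \<Omega> \<longrightarrow> fst (snd x) = 0"
proof -
  have H: "H1_trace \<Omega> (\<lambda>x. 1) (grad (\<lambda>x. 1)) (\<lambda>x. 1)"
    by (rule smooth_H1_trace[OF smooth_const \<Omega>(1,2)])
  let ?g = "\<lambda>x :: (real \<times> 'a) \<times> real \<times> real \<times> 'a. indicator (bdQ 3 T \<Omega> \<times> UNIV) x * (fst (snd x))\<^sup>2"
  have "(\<integral>x. ?g x \<partial>completion Mb) = (\<integral>((t, x), y, z0, z)\<in>bdQ 3 T \<Omega> \<times> UNIV. 1 * (if x \<in> \<Omega> then 1 else 1) * y\<^sup>2 \<partial>completion Mb)"
    unfolding set_lebesgue_integral_def by (intro Bochner_Integration.integral_cong) (auto simp: case_prod_unfold)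
  also have "\<dots> = (\<integral>(t, x)\<in>bdQ 3 T \<Omega>. 1 * 1 * 0\<^sup>2 \<partial>hausdorff_measure DIM('a))"
    by (rule occ_lateral[OF smooth_const H C1_square(1)])
  also have "\<dots> = 0" by (simp add: set_lebesgue_integral_def case_prod_unfold)
  finally have i0: "(\<integral>x. ?g x \<partial>completion Mb) = 0" .
  have "continuous_on UNIV (\<lambda>\<xi> :: real \<times> real \<times> 'a. (fst \<xi>)\<^sup>2)" by (intro continuous_intros)
  then obtain B where B: "B \<ge> 0" "\<forall>\<xi>\<in>E. norm ((fst \<xi>)\<^sup>2) \<le> B"
    using E_bound by blast
  have "closed (bdQ 3 T \<Omega> \<times> (UNIV :: (real \<times> real \<times> 'a) set))" by (intro closed_Times bdQ_closed closed_UNIV)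
  then have c: "bdQ 3 T \<Omega> \<times> (UNIV :: (real \<times> real \<times> 'a) set) \<in> sets borel" by (rule borel_closed)
  have "(\<lambda>x :: (real \<times> 'a) \<times> real \<times> real \<times> 'a. (fst (snd x))\<^sup>2) \<in> borel_measurable borel"
    by (intro borel_measurable_continuous_onI continuous_intros)
  then have m: "?g \<in> borel_measurable (completion Mb)"
    using c by (intro Mb_measurable borel_measurable_times borel_measurable_indicator)
  have "integrable (completion Mb) ?g"
  proof (rule finite_measure.integrable_const_bound[OF Mb_finite _ m])
    show "AE x in completion Mb. norm (?g x) \<le> B"
      using AE_Mb by eventually_elim (use B in \<open>auto simp: indicator_def\<close>)
  qed
  then have "AE x in completion Mb. ?g x = 0"
    using i0 by (subst (asm) integral_nonneg_eq_0_iff_AE) auto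
  then show ?thesis by eventually_elim (auto simp: indicator_def mem_Times_iff)
qed

text \<open>At the initial and final times \<open>\<phi>\<close> vanishes, and on the lateral boundary \<open>y = 0\<close>. The alternative
  \<open>\<beta> 0 = 0\<close> will permit test functions in space that do not vanish on the boundary of \<open>\<Omega>\<close>.\<close>

lemma boundary_term_zero:
  assumes \<phi>: "test_fun {0<..<T} \<phi>" and "\<beta> 0 = 0 \<or> (\<forall>x\<in>frontier \<Omega>. w x = 0)"
  shows "AE x in completion Mb. \<phi> (fst (fst x)) * w (snd (fst x)) * \<beta> (fst (snd x)) = 0"
  using AE_Mb lateral_value_zero
proof eventually_elim
  case (elim x)
  obtain t a where ta: "fst x = (t, a)" by (cases "fst x")
  then have fr: "t \<in> {0..T} \<and> a \<in> closure \<Omega> \<and> (t = 0 \<or> t = T \<or> a \<in> frontier \<Omega>)"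
    using frontier_cylinder[OF \<Omega>(1) T, of t a] elim by simp
  show ?case
  proof (cases "a \<in> frontier \<Omega>")
    case True
    then have "fst x \<in> bdQ 3 T \<Omega>" using fr ta by (simp add: bdQ_def)
    then have "fst (snd x) = 0" using elim by blast
    with True assms(2) ta show ?thesis by auto
  next
    case False
    then have "\<phi> t = 0" using fr test_fun_zero[OF \<phi>, of t] by auto
    then show ?thesis using ta by simp
  qed
qed

end

section \<open>Weak derivatives of fibre means\<close>

context occupation_setting
begin

definition mean :: "(real \<Rightarrow> real) \<Rightarrow> real \<times> 'a \<Rightarrow> real" where
  "mean \<beta> p = (\<integral>(y, z0, z). \<beta> y \<partial>\<mu> p)"

definition mean_t :: "(real \<Rightarrow> real) \<Rightarrow> real \<times> 'a \<Rightarrow> real" where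
  "mean_t \<beta> p = (\<integral>(y, z0, z). z0 * \<beta> y \<partial>\<mu> p)"

definition mean_x :: "'a \<Rightarrow> (real \<Rightarrow> real) \<Rightarrow> real \<times> 'a \<Rightarrow> real" where
  "mean_x j \<beta> p = (\<integral>(y, z0, z). (z \<bullet> j) * \<beta> y \<partial>\<mu> p)"

text \<open>The chain rule suggests \<open>mean_grad (deriv \<beta>)\<close> as the weak gradient of \<open>mean \<beta>\<close>.\<close>

definition mean_grad :: "(real \<Rightarrow> real) \<Rightarrow> real \<times> 'a \<Rightarrow> real \<times> 'a" where
  "mean_grad \<beta> p = (mean_t \<beta> p, \<Sum>j\<in>Basis. mean_x j \<beta> p *\<^sub>R j)"

lemma mean_grad_inner:
  "fst (mean_grad \<beta> p) = mean_t \<beta> p" "j \<in> Basis \<Longrightarrow> snd (mean_grad \<beta> p) \<bullet> j = mean_x j \<beta> p"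
  by (simp_all add: mean_grad_def inner_sum_left inner_Basis if_distrib cong: if_cong)

lemma fiber_mean_measurable_bounded:
  fixes c :: "real \<times> real \<times> 'a \<Rightarrow> real"
  assumes c: "continuous_on UNIV c"
  shows "(\<lambda>p. \<integral>\<xi>. c \<xi> \<partial>\<mu> p) \<in> borel_measurable LS" "\<exists>B\<ge>0. \<forall>p\<in>S. \<bar>\<integral>\<xi>. c \<xi> \<partial>\<mu> p\<bar> \<le> B"
proof -
  have cm: "c \<in> borel_measurable borel" by (rule borel_measurable_continuous_onI[OF c])
  show "(\<lambda>p. \<integral>\<xi>. c \<xi> \<partial>\<mu> p) \<in> borel_measurable LS"
    using fiber_integral_measurable[OF measurable_compose[OF measurable_snd cm]] by simp
  obtain B where "B \<ge> 0" "\<forall>\<xi>\<in>E. norm (c \<xi>) \<le> B" using E_bound[OF c] by blast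
  then show "\<exists>B\<ge>0. \<forall>p\<in>S. \<bar>\<integral>\<xi>. c \<xi> \<partial>\<mu> p\<bar> \<le> B"
    using fiber_integral_bound[OF _ cm] by (metis real_norm_def)
qed

lemma mean_measurable_bounded:
  assumes \<beta>: "continuous_on UNIV \<beta>"
  shows "mean \<beta> \<in> borel_measurable LS" "\<exists>B\<ge>0. \<forall>p\<in>S. \<bar>mean \<beta> p\<bar> \<le> B"
    and "mean_grad \<beta> \<in> borel_measurable LS" "\<exists>B\<ge>0. \<forall>p\<in>S. norm (mean_grad \<beta> p) \<le> B"
proof -
  note F = fiber_mean_measurable_bounded
  show "mean \<beta> \<in> borel_measurable LS" "\<exists>B\<ge>0. \<forall>p\<in>S. \<bar>mean \<beta> p\<bar> \<le> B"
    unfolding mean_def[abs_def] by (rule F[OF continuous_state_functions(1)[OF \<beta>]])+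
  have t: "mean_t \<beta> \<in> borel_measurable LS" "\<exists>B\<ge>0. \<forall>p\<in>S. \<bar>mean_t \<beta> p\<bar> \<le> B"
    unfolding mean_t_def[abs_def] by (rule F[OF continuous_state_functions(2)[OF \<beta>]])+
  have x: "mean_x j \<beta> \<in> borel_measurable LS" "\<exists>B\<ge>0. \<forall>p\<in>S. \<bar>mean_x j \<beta> p\<bar> \<le> B" for j
    unfolding mean_x_def[abs_def] by (rule F[OF continuous_state_functions(3)[OF \<beta>]])+
  show "mean_grad \<beta> \<in> borel_measurable LS"
    unfolding mean_grad_def[abs_def]
    using t(1) x(1) by (intro borel_measurable_Pair borel_measurable_sum borel_measurable_scaleR) auto
  obtain Bt where Bt: "Bt \<ge> 0" "\<And>p. p \<in> S \<Longrightarrow> \<bar>mean_t \<beta> p\<bar> \<le> Bt" using t(2) by blast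
  have "\<forall>j. \<exists>B. B \<ge> 0 \<and> (\<forall>p\<in>S. \<bar>mean_x j \<beta> p\<bar> \<le> B)" using x(2) by blast
  then obtain Bx where Bx: "\<And>j. Bx j \<ge> 0" "\<And>j p. p \<in> S \<Longrightarrow> \<bar>mean_x j \<beta> p\<bar> \<le> Bx j" by metis
  show "\<exists>B\<ge>0. \<forall>p\<in>S. norm (mean_grad \<beta> p) \<le> B"
  proof (intro exI[of _ "Bt + (\<Sum>j\<in>Basis. Bx j)"] conjI ballI)
    show "0 \<le> Bt + (\<Sum>j\<in>Basis. Bx j)" using Bt Bx by (simp add: sum_nonneg)
    fix p assume p: "p \<in> S"
    have "norm (\<Sum>j\<in>Basis. mean_x j \<beta> p *\<^sub>R j) \<le> (\<Sum>j\<in>Basis. Bx j)"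
      by (rule order_trans[OF norm_sum]) (use Bx(2)[OF p] in \<open>auto intro!: sum_mono\<close>)
    then show "norm (mean_grad \<beta> p) \<le> Bt + (\<Sum>j\<in>Basis. Bx j)"
      using norm_Pair_le[of "mean_t \<beta> p" "\<Sum>j\<in>Basis. mean_x j \<beta> p *\<^sub>R j"] Bt(2)[OF p]
      unfolding mean_grad_def by simp
  qed
qed

lemma integrable_LS_continuous:
  fixes h :: "real \<times> 'a \<Rightarrow> real"
  assumes "continuous_on UNIV h"
  shows "integrable LS h"
proof -
  have "bounded (h ` closure S)"
    using bounded_S by (intro compact_imp_bounded compact_continuous_image continuous_on_subset[OF assms]) (auto simp: compact_closure)
  then obtain B where B: "\<forall>z\<in>h ` closure S. norm z \<le> B" unfolding bounded_iff ..
  have "norm (h p) \<le> B" if "p \<in> S" for p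
    by (rule bspec[OF B imageI[OF subsetD[OF closure_subset that]]])
  then have ae: "AE p in LS. norm (h p) \<le> B" using LS_AE_mem by (auto elim: eventually_mono)
  show ?thesis
    by (rule integrable_bounded_lebesgue_on[OF bounded_S SL _ ae])
       (intro measurable_restrict_space1 measurable_completion, simp add: borel_measurable_continuous_onI assms)
qed

lemma tensor_continuous:
  assumes "continuous_on UNIV (\<phi> :: real \<Rightarrow> real)" "continuous_on UNIV (v :: 'a \<Rightarrow> real)"
  shows "continuous_on UNIV (\<lambda>p. \<phi> (fst p) * v (snd p))"
  by (intro continuous_intros continuous_on_compose2[OF assms(1)] continuous_on_compose2[OF assms(2)]) auto

lemma time_identity:
  assumes \<phi>: "smooth \<phi>" and v: "smooth v" and \<beta>: "\<beta> C1_differentiable_on UNIV"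
  shows "(\<integral>p. (deriv \<phi> (fst p) * v (snd p)) * mean \<beta> p \<partial>LS) + (\<integral>p. (\<phi> (fst p) * v (snd p)) * mean_t (deriv \<beta>) p \<partial>LS)
    = (\<integral>x. \<phi> (fst (fst x)) * v (snd (fst x)) * \<beta> (fst (snd x)) * fst (outward_normal (QT T \<Omega>) (fst x)) \<partial>completion Mb)"
proof -
  note c = C1_real[OF \<beta>]
  let ?h1 = "\<lambda>p. deriv \<phi> (fst p) * v (snd p)" and ?h2 = "\<lambda>p. \<phi> (fst p) * v (snd p)"
  let ?c1 = "\<lambda>(y, z0 :: real, z :: 'a). \<beta> y" and ?c2 = "\<lambda>(y, z0, z :: 'a). z0 * deriv \<beta> y"
  have i1: "integrable LS ?h1" by (intro integrable_LS_continuous tensor_continuous smooth_continuous_on smooth_deriv \<phi> v)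
  have i2: "integrable LS ?h2" by (intro integrable_LS_continuous tensor_continuous smooth_continuous_on \<phi> v)
  note D1 = integral_separated[OF continuous_state_functions(1)[OF c(1)] i1] and D2 = integral_separated[OF continuous_state_functions(2)[OF c(2)] i2]
  have "(\<integral>((t, x), y, z0, z). deriv \<phi> t * (if x \<in> \<Omega> then v x else v x) * \<beta> y
        + z0 * (\<phi> t * (if x \<in> \<Omega> then v x else v x) * deriv \<beta> y) \<partial>completion M)
      = (\<integral>x. ?h1 (fst x) * ?c1 (snd x) + ?h2 (fst x) * ?c2 (snd x) \<partial>completion M)"
    by (intro Bochner_Integration.integral_cong refl) (simp add: case_prod_unfold mult_ac)
  also have "\<dots> = (\<integral>p. ?h1 p * mean \<beta> p \<partial>LS) + (\<integral>p. ?h2 p * mean_t (deriv \<beta>) p \<partial>LS)"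
    unfolding mean_def mean_t_def D1(3)[symmetric] D2(3)[symmetric]
    by (rule Bochner_Integration.integral_add[OF D1(1) D2(1)])
  finally have L: "(\<integral>((t, x), y, z0, z). deriv \<phi> t * (if x \<in> \<Omega> then v x else v x) * \<beta> y
        + z0 * (\<phi> t * (if x \<in> \<Omega> then v x else v x) * deriv \<beta> y) \<partial>completion M)
      = (\<integral>p. ?h1 p * mean \<beta> p \<partial>LS) + (\<integral>p. ?h2 p * mean_t (deriv \<beta>) p \<partial>LS)" .
  have R: "(\<integral>((t, x), y, z0, z). \<phi> t * (if x \<in> \<Omega> then v x else v x) * \<beta> y * fst (outward_normal (QT T \<Omega>) (t, x)) \<partial>completion Mb)
      = (\<integral>x. \<phi> (fst (fst x)) * v (snd (fst x)) * \<beta> (fst (snd x)) * fst (outward_normal (QT T \<Omega>) (fst x)) \<partial>completion Mb)"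
    by (intro Bochner_Integration.integral_cong refl) (simp add: case_prod_unfold)
  show ?thesis
    using occ_time[OF \<phi> smooth_H1_trace[OF v \<Omega>(1,2)] \<beta>] unfolding L R by simp
qed

lemma space_identity:
  assumes \<phi>: "smooth \<phi>" and v: "smooth v" and \<beta>: "\<beta> C1_differentiable_on UNIV" and j: "j \<in> Basis"
  shows "(\<integral>p. (\<phi> (fst p) * (grad v (snd p) \<bullet> j)) * mean \<beta> p \<partial>LS) + (\<integral>p. (\<phi> (fst p) * v (snd p)) * mean_x j (deriv \<beta>) p \<partial>LS)
    = (\<integral>x. \<phi> (fst (fst x)) * v (snd (fst x)) * \<beta> (fst (snd x)) * (snd (outward_normal (QT T \<Omega>) (fst x)) \<bullet> j) \<partial>completion Mb)"
proof -
  note c = C1_real[OF \<beta>]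
  let ?h1 = "\<lambda>p. \<phi> (fst p) * (grad v (snd p) \<bullet> j)" and ?h2 = "\<lambda>p. \<phi> (fst p) * v (snd p)"
  let ?c1 = "\<lambda>(y, z0 :: real, z :: 'a). \<beta> y" and ?c2 = "\<lambda>(y, z0 :: real, z :: 'a). (z \<bullet> j) * deriv \<beta> y"
  have i1: "integrable LS ?h1"
    by (intro integrable_LS_continuous tensor_continuous smooth_continuous_on \<phi> continuous_on_inner smooth_continuous_grad v continuous_on_const)
  have i2: "integrable LS ?h2" by (intro integrable_LS_continuous tensor_continuous smooth_continuous_on \<phi> v)
  note D1 = integral_separated[OF continuous_state_functions(1)[OF c(1)] i1] and D2 = integral_separated[OF continuous_state_functions(3)[OF c(2), of j] i2]
  have "(\<integral>((t, x), y, z0, z). \<phi> t * (grad v x \<bullet> j) * \<beta> y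
        + (z \<bullet> j) * (\<phi> t * (if x \<in> \<Omega> then v x else v x) * deriv \<beta> y) \<partial>completion M)
      = (\<integral>x. ?h1 (fst x) * ?c1 (snd x) + ?h2 (fst x) * ?c2 (snd x) \<partial>completion M)"
    by (intro Bochner_Integration.integral_cong refl) (simp add: case_prod_unfold mult_ac)
  also have "\<dots> = (\<integral>p. ?h1 p * mean \<beta> p \<partial>LS) + (\<integral>p. ?h2 p * mean_x j (deriv \<beta>) p \<partial>LS)"
    unfolding mean_def mean_x_def D1(3)[symmetric] D2(3)[symmetric]
    by (rule Bochner_Integration.integral_add[OF D1(1) D2(1)])
  finally have L: "(\<integral>((t, x), y, z0, z). \<phi> t * (grad v x \<bullet> j) * \<beta> y
        + (z \<bullet> j) * (\<phi> t * (if x \<in> \<Omega> then v x else v x) * deriv \<beta> y) \<partial>completion M)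
      = (\<integral>p. ?h1 p * mean \<beta> p \<partial>LS) + (\<integral>p. ?h2 p * mean_x j (deriv \<beta>) p \<partial>LS)" .
  have R: "(\<integral>((t, x), y, z0, z). \<phi> t * (if x \<in> \<Omega> then v x else v x) * \<beta> y * (snd (outward_normal (QT T \<Omega>) (t, x)) \<bullet> j) \<partial>completion Mb)
      = (\<integral>x. \<phi> (fst (fst x)) * v (snd (fst x)) * \<beta> (fst (snd x)) * (snd (outward_normal (QT T \<Omega>) (fst x)) \<bullet> j) \<partial>completion Mb)"
    by (intro Bochner_Integration.integral_cong refl) (simp add: case_prod_unfold)
  show ?thesis
    using occ_space[OF \<phi> smooth_H1_trace[OF v \<Omega>(1,2)] \<beta> j] unfolding L R by simp
qed

lemma mean_borel_versions:
  assumes \<beta>: "\<beta> C1_differentiable_on UNIV"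
  obtains F H B C where "F \<in> borel_measurable borel" "integrable lborel F" "\<And>p. \<bar>F p\<bar> \<le> B"
    "\<And>p. p \<notin> S \<Longrightarrow> F p = 0" "AE p in lborel. p \<in> S \<longrightarrow> mean \<beta> p = F p"
    "H \<in> borel_measurable borel" "integrable lborel H" "\<And>p. norm (H p) \<le> C" "C \<ge> 0"
    "\<And>p. p \<notin> S \<Longrightarrow> H p = 0" "AE p in lborel. p \<in> S \<longrightarrow> mean_grad (deriv \<beta>) p = H p"
proof -
  note c = C1_real[OF \<beta>]
  obtain B where B: "B \<ge> 0" "\<And>p. p \<in> S \<Longrightarrow> norm (mean \<beta> p) \<le> B" using mean_measurable_bounded(2)[OF c(1)] by auto
  obtain C where C: "C \<ge> 0" "\<And>p. p \<in> S \<Longrightarrow> norm (mean_grad (deriv \<beta>) p) \<le> C" using mean_measurable_bounded(4)[OF c(2)] by blast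
  obtain F where F: "F \<in> borel_measurable borel" "integrable lborel F" "\<forall>p. norm (F p) \<le> B"
    "\<forall>p. p \<notin> S \<longrightarrow> F p = 0" "AE p in lborel. p \<in> S \<longrightarrow> mean \<beta> p = F p"
    using borel_version_bounded[OF mean_measurable_bounded(1)[OF c(1)] S(1) bounded_S B] by blast
  obtain H where H: "H \<in> borel_measurable borel" "integrable lborel H" "\<forall>p. norm (H p) \<le> C"
    "\<forall>p. p \<notin> S \<longrightarrow> H p = 0" "AE p in lborel. p \<in> S \<longrightarrow> mean_grad (deriv \<beta>) p = H p"
    using borel_version_bounded[OF mean_measurable_bounded(3)[OF c(2)] S(1) bounded_S C] by blast
  show ?thesis
    by (rule that[OF F(1,2) F(3)[unfolded real_norm_def, rule_format] F(4)[rule_format] F(5)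
        H(1,2) H(3)[rule_format] C(1) H(4)[rule_format] H(5)])
qed

text \<open>Here \<open>F\<close> and \<open>H\<close> are the mean and its gradient extended by zero. In the case \<open>W = UNIV\<close> the identity
  holds across the lateral boundary: the boundary term that would describe a jump of \<open>F\<close> there
  contains the factor \<open>\<beta> y\<close>, which is \<open>\<beta> 0 = 0\<close>.\<close>

lemma weak_gradient_mean:
  assumes \<beta>: "\<beta> C1_differentiable_on UNIV" and W: "W = \<Omega> \<or> (W = UNIV \<and> \<beta> 0 = 0)"
    and F: "F \<in> borel_measurable borel" "integrable lborel F" "\<And>p. p \<notin> S \<Longrightarrow> F p = 0"
      "AE p in lborel. p \<in> S \<longrightarrow> mean \<beta> p = F p"
    and H: "H \<in> borel_measurable borel" "integrable lborel H" "\<And>p. p \<notin> S \<Longrightarrow> H p = 0"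
      "AE p in lborel. p \<in> S \<longrightarrow> mean_grad (deriv \<beta>) p = H p"
    and \<psi>: "test_fun ({0<..<T} \<times> W) \<psi>" and i: "i \<in> Basis"
  shows "(\<integral>p. (grad \<psi> p \<bullet> i) * F p \<partial>lborel) = - (\<integral>p. \<psi> p * (H p \<bullet> i) \<partial>lborel)"
proof (rule weak_gradient_from_tensor_products[OF _ F(2) H(2) _ _ \<psi> i])
  show "open W" using W \<Omega>(1) by auto
  have "(\<lambda>p. fst (H p)) \<in> borel_measurable borel" "(\<lambda>p. snd (H p)) \<in> borel_measurable borel"
    by (rule measurable_compose[OF H(1)], rule borel_measurable_continuous_onI, intro continuous_intros)+
  note [measurable] = F(1) H(1) this
  fix \<phi> v assume \<phi>: "test_fun {0<..<T} \<phi>" and v: "test_fun W v"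
  have s: "smooth \<phi>" "smooth v" using \<phi> v by (auto simp: test_fun_def)
  have c: "continuous_on UNIV (\<lambda>p. deriv \<phi> (fst p) * v (snd p))" "continuous_on UNIV (\<lambda>p. \<phi> (fst p) * v (snd p))"
    by (intro tensor_continuous smooth_continuous_on smooth_deriv s)+
  note [measurable] = c[THEN borel_measurable_continuous_onI]
  have z: "\<beta> 0 = 0 \<or> (\<forall>x\<in>frontier \<Omega>. v x = 0)"
    using W test_fun_zero[OF v] \<Omega>(1) by (auto simp: frontier_def interior_open)
  note bz = boundary_term_zero[where \<beta>=\<beta> and w=v, OF \<phi> z]
  have "(\<integral>x. \<phi> (fst (fst x)) * v (snd (fst x)) * \<beta> (fst (snd x)) * fst (outward_normal (QT T \<Omega>) (fst x)) \<partial>completion Mb) = 0"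
    by (rule integral_eq_zero_AE) (use bz in eventually_elim, simp)
  with time_identity[OF s \<beta>]
  have "(\<integral>p. (deriv \<phi> (fst p) * v (snd p)) * mean \<beta> p \<partial>LS) = - (\<integral>p. (\<phi> (fst p) * v (snd p)) * mean_t (deriv \<beta>) p \<partial>LS)"
    by simp
  also have "(\<integral>p. (deriv \<phi> (fst p) * v (snd p)) * mean \<beta> p \<partial>LS) = (\<integral>p. F p * (deriv \<phi> (fst p) * v (snd p)) \<partial>lborel)"
    by (rule integral_lebesgue_on_eq_borel_version[OF S(1)])
       (measurable, simp add: F(3), use F(4) in eventually_elim, simp add: mult.commute)
  also have "(\<integral>p. (\<phi> (fst p) * v (snd p)) * mean_t (deriv \<beta>) p \<partial>LS) = (\<integral>p. fst (H p) * (\<phi> (fst p) * v (snd p)) \<partial>lborel)"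
    by (rule integral_lebesgue_on_eq_borel_version[OF S(1)])
       (measurable, simp add: H(3), use H(4) in eventually_elim, auto simp: mean_grad_inner(1)[symmetric] mult.commute)
  finally show "(\<integral>p. F p * (deriv \<phi> (fst p) * v (snd p)) \<partial>lborel) = - (\<integral>p. fst (H p) * (\<phi> (fst p) * v (snd p)) \<partial>lborel)" .
  fix j :: 'a assume j: "j \<in> Basis"
  have "continuous_on UNIV (\<lambda>p. \<phi> (fst p) * (grad v (snd p) \<bullet> j))"
    by (intro tensor_continuous smooth_continuous_on s continuous_on_inner smooth_continuous_grad continuous_on_const)
  note [measurable] = this[THEN borel_measurable_continuous_onI]
  have "(\<integral>x. \<phi> (fst (fst x)) * v (snd (fst x)) * \<beta> (fst (snd x)) * (snd (outward_normal (QT T \<Omega>) (fst x)) \<bullet> j) \<partial>completion Mb) = 0"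
    by (rule integral_eq_zero_AE) (use bz in eventually_elim, simp)
  with space_identity[OF s \<beta> j]
  have "(\<integral>p. (\<phi> (fst p) * (grad v (snd p) \<bullet> j)) * mean \<beta> p \<partial>LS) = - (\<integral>p. (\<phi> (fst p) * v (snd p)) * mean_x j (deriv \<beta>) p \<partial>LS)"
    by simp
  also have "(\<integral>p. (\<phi> (fst p) * (grad v (snd p) \<bullet> j)) * mean \<beta> p \<partial>LS) = (\<integral>p. F p * (\<phi> (fst p) * (grad v (snd p) \<bullet> j)) \<partial>lborel)"
    by (rule integral_lebesgue_on_eq_borel_version[OF S(1)])
       (measurable, simp add: F(3), use F(4) in eventually_elim, simp add: mult.commute)
  also have "(\<integral>p. (\<phi> (fst p) * v (snd p)) * mean_x j (deriv \<beta>) p \<partial>LS) = (\<integral>p. (snd (H p) \<bullet> j) * (\<phi> (fst p) * v (snd p)) \<partial>lborel)"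
    by (rule integral_lebesgue_on_eq_borel_version[OF S(1)])
       (measurable, simp add: H(3), use H(4) in eventually_elim, auto simp: mean_grad_inner(2)[OF j, symmetric] mult.commute)
  finally show "(\<integral>p. F p * (\<phi> (fst p) * (grad v (snd p) \<bullet> j)) \<partial>lborel) = - (\<integral>p. (snd (H p) \<bullet> j) * (\<phi> (fst p) * v (snd p)) \<partial>lborel)" .
qed

text \<open>The extension of the mean by zero has a bounded weak gradient on a convex set, the strip over the
  whole space, hence a Lipschitz representative. This representative vanishes in the exterior of \<open>\<Omega>\<close>,
  and by continuity at all points of the boundary, where the exterior accumulates.\<close>

lemma mean_lipschitz_representative:
  assumes \<beta>: "\<beta> C1_differentiable_on UNIV" "\<beta> 0 = 0"
  obtains U C where "C-lipschitz_on ({0..T} \<times> UNIV) U" "AE p in LS. U p = mean \<beta> p"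
    "\<And>t x. t \<in> {0..T} \<Longrightarrow> x \<in> frontier \<Omega> \<Longrightarrow> U (t, x) = 0"
    "\<And>p. p \<in> S \<Longrightarrow> norm (mean_grad (deriv \<beta>) p) \<le> C"
proof -
  note c = C1_real[OF \<beta>(1)]
  obtain F H B C where F: "F \<in> borel_measurable borel" "integrable lborel F" "\<And>p. \<bar>F p\<bar> \<le> B"
    "\<And>p. p \<notin> S \<Longrightarrow> F p = 0" "AE p in lborel. p \<in> S \<longrightarrow> mean \<beta> p = F p"
    and H: "H \<in> borel_measurable borel" "integrable lborel H" "\<And>p. norm (H p) \<le> C" "C \<ge> 0"
    "\<And>p. p \<notin> S \<Longrightarrow> H p = 0" "AE p in lborel. p \<in> S \<longrightarrow> mean_grad (deriv \<beta>) p = H p"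
    by (rule mean_borel_versions[OF \<beta>(1)]) (rule that)
  obtain C' where C': "\<And>p. p \<in> S \<Longrightarrow> norm (mean_grad (deriv \<beta>) p) \<le> C'" using mean_measurable_bounded(4)[OF c(2)] by blast
  let ?D = "{0<..<T} \<times> (UNIV :: 'a set)"
  have "open ?D" "convex ?D" by (auto intro!: open_Times convex_Times)
  then have "\<exists>u. C-lipschitz_on ?D u \<and> u \<in> borel_measurable borel \<and> (AE p in lborel. p \<in> ?D \<longrightarrow> u p = F p)"
  proof (rule bounded_weak_gradient_lipschitz_representative[OF _ _ F(2,3) H(1,3)])
    fix \<psi> and i :: "real \<times> 'a" assume \<psi>: "test_fun ?D \<psi>" and i: "i \<in> Basis"
    show "(\<integral>p. (grad \<psi> p \<bullet> i) * F p \<partial>lborel) = - (\<integral>p. \<psi> p * (H p \<bullet> i) \<partial>lborel)"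
      by (rule weak_gradient_mean[OF \<beta>(1) _ F(1,2,4,5) H(1,2,5,6) \<psi> i]) (simp add: \<beta>(2))
  qed
  then obtain u where u: "C-lipschitz_on ?D u" "AE p in lborel. p \<in> ?D \<longrightarrow> u p = F p" by (elim exE conjE)
  \<comment> \<open>The Lipschitz function extends to the closed strip, where initial and boundary values are defined.\<close>
  have clD: "closure ?D = {0..T} \<times> UNIV" using T by (simp add: closure_Times)
  obtain U where U: "C-lipschitz_on ({0..T} \<times> UNIV) U" "\<forall>p\<in>?D. U p = u p"
    using lipschitz_extend_closure[OF u(1)] unfolding clD by blast
  have ae: "AE p in LS. U p = mean \<beta> p"
  proof (rule AE_LS[OF _, THEN eventually_rev_mp])
    have "AE p in lborel. p \<in> S \<longrightarrow> U p = mean \<beta> p"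
      using u(2) F(5) AE_lborel_fst_neq[of 0] AE_lborel_fst_neq[of T]
    proof eventually_elim
      case (elim p)
      show ?case
      proof
        assume p: "p \<in> S"
        then have "p \<in> ?D" using elim(3,4) by (auto simp: mem_Times_iff)
        then have "U p = u p" by (rule bspec[OF U(2)])
        with \<open>p \<in> ?D\<close> show "U p = mean \<beta> p" using elim(1,2) p by simp
      qed
    qed
    then show "AE p in lebesgue. p \<in> S \<longrightarrow> U p = mean \<beta> p" by (rule AE_completion)
    show "AE p in LS. (p \<in> S \<longrightarrow> U p = mean \<beta> p) \<longrightarrow> U p = mean \<beta> p"
      using LS_AE_mem by eventually_elim simp
  qed
  let ?O = "{0<..<T} \<times> (- closure \<Omega>)"
  have uO: "U p = 0" if "p \<in> ?O" for p
  proof -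
    have "u p = 0"
    proof (rule continuous_eq_0_of_AE[OF _ _ _ that])
      show "open ?O" by (intro open_Times open_Compl) auto
      show "continuous_on ?O u"
        by (rule continuous_on_subset[OF lipschitz_on_continuous_on[OF u(1)]]) auto
      show "AE x in lborel. x \<in> ?O \<longrightarrow> u x = 0"
        using u(2)
      proof eventually_elim
        case (elim x)
        show ?case
        proof
          assume x: "x \<in> ?O"
          then have "x \<notin> S" using closure_subset[of \<Omega>] by auto
          then show "u x = 0" using elim x F(4) by auto
        qed
      qed
    qed
    then show ?thesis using U(2) that by auto
  qed
  have fr: "U (t, x) = 0" if t: "t \<in> {0..T}" and x: "x \<in> frontier \<Omega>" for t x
  proof (rule continuous_constant_on_closure[of ?O])
    have "closure ?O = {0..T} \<times> closure (- closure \<Omega>)" using T by (simp add: closure_Times)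
    then show "(t, x) \<in> closure ?O" "continuous_on (closure ?O) U"
      using t subsetD[OF exterior_dense_at_frontier[OF lipb \<Omega>(1)] x]
        continuous_on_subset[OF lipschitz_on_continuous_on[OF U(1)], of "{0..T} \<times> closure (- closure \<Omega>)"] by auto
  qed (rule uO)
  show ?thesis
  proof (rule that[OF _ ae fr])
    show "(max C C')-lipschitz_on ({0..T} \<times> UNIV) U" by (rule lipschitz_on_mono[OF U(1)]) auto
    show "norm (mean_grad (deriv \<beta>) p) \<le> max C C'" if "p \<in> S" for p using C'[OF that] by simp
  qed
qed

end

section \<open>Initial values\<close>

lemma eq_0_if_le_linear:
  fixes c K T :: real
  assumes T: "T > 0" and "\<And>\<delta>. 0 < \<delta> \<Longrightarrow> \<delta> \<le> T \<Longrightarrow> \<bar>c\<bar> \<le> K * \<delta>"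
  shows "c = 0"
proof (rule ccontr)
  assume "c \<noteq> 0"
  define \<delta> where "\<delta> = min T (\<bar>c\<bar> / (2 * (\<bar>K\<bar> + 1)))"
  have \<delta>: "0 < \<delta>" "\<delta> \<le> T" "\<delta> \<le> \<bar>c\<bar> / (2 * (\<bar>K\<bar> + 1))" using T \<open>c \<noteq> 0\<close> by (auto simp: \<delta>_def)
  have "\<bar>c\<bar> \<le> K * \<delta>" by (rule assms(2)[OF \<delta>(1,2)])
  also have "\<dots> \<le> (\<bar>K\<bar> + 1) * \<delta>" using \<delta>(1) by (intro mult_right_mono) auto
  also have "\<dots> \<le> (\<bar>K\<bar> + 1) * (\<bar>c\<bar> / (2 * (\<bar>K\<bar> + 1)))" using \<delta>(3) by (intro mult_left_mono) auto
  also have "\<dots> = \<bar>c\<bar> / 2" by (simp add: field_simps add_pos_nonneg pos_add_strict[of _ 1] abs_ge_zero add_nonneg_eq_0_iff)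
  finally show False using \<open>c \<noteq> 0\<close> by simp
qed

context occupation_setting
begin

lemma \<Omega>_measurable: "\<Omega> \<in> sets lebesgue" "\<Omega> \<in> sets borel" using \<Omega>(1) by auto

lemma tensor_integral:
  fixes a :: "real \<Rightarrow> real" and b :: "'a \<Rightarrow> real"
  assumes a: "integrable lborel (\<lambda>t. indicator {0..T} t * a t)" and b: "integrable (lebesgue_on \<Omega>) b"
  shows "integrable LS (\<lambda>p. a (fst p) * b (snd p))"
    and "(\<integral>p. a (fst p) * b (snd p) \<partial>LS) = (\<integral>t. indicator {0..T} t * a t \<partial>lborel) * (\<integral>x. b x \<partial>lebesgue_on \<Omega>)"
proof -
  have "(\<lambda>x. if x \<in> \<Omega> then b x else 0) \<in> borel_measurable lebesgue"
    by (rule borel_measurable_if_I[OF _ \<Omega>_measurable(1)]) (use b in auto)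
  then obtain g where g: "g \<in> borel_measurable borel" and ae: "AE x in lborel. (if x \<in> \<Omega> then b x else 0) = g x"
    using borel_version_lebesgue by blast
  define b' where "b' x = indicator \<Omega> x * g x" for x
  have b'm: "b' \<in> borel_measurable borel"
    unfolding b'_def using g \<Omega>_measurable(2) by (intro borel_measurable_times borel_measurable_indicator) auto
  have b'z: "b' x = 0" if "x \<notin> \<Omega>" for x using that by (simp add: b'_def)
  have ae': "AE x in lborel. x \<in> \<Omega> \<longrightarrow> b x = b' x" using ae by eventually_elim (auto simp: b'_def)
  have Ib: "(\<integral>x. b x \<partial>lebesgue_on \<Omega>) = integral\<^sup>L lborel b'"
    by (rule integral_lebesgue_on_eq_borel_version[OF \<Omega>_measurable(2) b'm b'z ae'])
  have "AE x in lebesgue_on \<Omega>. b x = b' x"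
    using AE_completion[OF ae'] \<Omega>_measurable(1) by (subst AE_restrict_space_iff) auto
  from complete_measure.integrable_cong_AE_complete[OF complete_measure_lebesgue_on[OF \<Omega>_measurable(1)] b this]
  have "integrable (lebesgue_on \<Omega>) b'" .
  then have "integrable lebesgue (\<lambda>x. indicator \<Omega> x *\<^sub>R b' x)" using \<Omega>_measurable(1) by (simp add: integrable_restrict_space)
  moreover have "(\<lambda>x. indicator \<Omega> x *\<^sub>R b' x) = b'" by (auto simp: b'_def indicator_def)
  ultimately have ib': "integrable lborel b'" using b'm by (simp add: integrable_completion)
  let ?P = "\<lambda>p. (indicator {0..T} (fst p) * a (fst p)) * b' (snd p)"
  note P = integrable_lborel_product[OF a ib']
  have Pz: "?P p = 0" if "p \<notin> S" for p using that b'z[of "snd p"] by (cases p) (auto simp: indicator_def)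
  have Pm: "?P \<in> borel_measurable borel" using P(1) by auto
  have aeP: "AE p in lborel. p \<in> S \<longrightarrow> a (fst p) * b (snd p) = ?P p"
    using AE_lborel_snd[OF ae'] by eventually_elim (auto simp: mem_Times_iff)
  have "(\<integral>p. a (fst p) * b (snd p) \<partial>LS) = integral\<^sup>L lborel ?P"
    by (rule integral_lebesgue_on_eq_borel_version[OF S(1) Pm Pz aeP])
  then show "(\<integral>p. a (fst p) * b (snd p) \<partial>LS) = (\<integral>t. indicator {0..T} t * a t \<partial>lborel) * (\<integral>x. b x \<partial>lebesgue_on \<Omega>)"
    using P(2) Ib by simp
  have iP: "integrable LS ?P" by (rule integral_lebesgue_on_eq_lborel(2)[OF SL Pm Pz P(1)])
  have "AE p in LS. p \<in> S \<longrightarrow> a (fst p) * b (snd p) = ?P p" by (rule AE_LS[OF AE_completion[OF aeP]])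
  then have "AE p in LS. ?P p = a (fst p) * b (snd p)" using LS_AE_mem
    by eventually_elim (rule sym, erule mp)
  from complete_measure.integrable_cong_AE_complete[OF LS_complete iP this]
  show "integrable LS (\<lambda>p. a (fst p) * b (snd p))" .
qed

lemma integrable_time_continuous:
  assumes "continuous_on UNIV (a :: real \<Rightarrow> real)"
  shows "integrable lborel (\<lambda>t. indicator {0..T} t * a t)"
  using borel_integrable_compact[of "{0..T}" a] continuous_on_subset[OF assms] by simp

lemma integrable_space_continuous:
  fixes g :: "'a \<Rightarrow> real"
  assumes "continuous_on \<Omega> g" "\<And>x. x \<in> \<Omega> \<Longrightarrow> \<bar>g x\<bar> \<le> B"
  shows "integrable (lebesgue_on \<Omega>) g"
proof (rule integrable_bounded_lebesgue_on[OF \<Omega>(2) \<Omega>_measurable(1)])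
  show "g \<in> borel_measurable (lebesgue_on \<Omega>)" by (rule continuous_imp_measurable_on_sets_lebesgue[OF assms(1) \<Omega>_measurable(1)])
  show "AE x in lebesgue_on \<Omega>. norm (g x) \<le> B" using assms(2) by (intro AE_I2) (simp add: space_restrict_space)
qed

text \<open>Since \<open>v\<close> vanishes outside \<open>\<Omega>\<close> and \<open>\<phi>\<close> at time \<open>T\<close>, only the bottom of the cylinder contributes,
  where the time component of the normal is \<open>-1\<close>.\<close>

lemma initial_boundary_term:
  assumes \<phi>: "smooth \<phi>" "\<phi> T = 0" and v: "test_fun \<Omega> v" and \<beta>: "\<beta> C1_differentiable_on UNIV"
  shows "(\<integral>x. \<phi> (fst (fst x)) * v (snd (fst x)) * \<beta> (fst (snd x)) * fst (outward_normal (QT T \<Omega>) (fst x)) \<partial>completion Mb)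
    = - (\<phi> 0 * (\<integral>x. v x * \<beta> (y0 x) \<partial>lebesgue_on \<Omega>))"
proof -
  have sv: "smooth v" using v by (simp add: test_fun_def)
  let ?g = "\<lambda>x :: (real \<times> 'a) \<times> real \<times> real \<times> 'a. \<phi> (fst (fst x)) * v (snd (fst x)) * \<beta> (fst (snd x))"
  let ?I = "\<lambda>x :: (real \<times> 'a) \<times> real \<times> real \<times> 'a. indicator (bdQ 1 T \<Omega> \<times> UNIV) x * ?g x"
  have "continuous_on UNIV ?g"
    by (intro continuous_intros continuous_on_compose2[OF smooth_continuous_on[OF \<phi>(1), of UNIV]]
        continuous_on_compose2[OF smooth_continuous_on[OF sv, of UNIV]] continuous_on_compose2[OF C1_real(1)[OF \<beta>]]) auto
  then have gm: "?g \<in> borel_measurable borel" by (rule borel_measurable_continuous_onI)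
  have "closed (bdQ 1 T \<Omega> \<times> (UNIV :: (real \<times> real \<times> 'a) set))" by (intro closed_Times bdQ_closed closed_UNIV)
  then have Im: "?I \<in> borel_measurable (completion Mb)"
    by (intro Mb_measurable borel_measurable_times[OF borel_measurable_indicator[OF borel_closed] gm])
  have ae: "AE x in completion Mb. - ?I x = ?g x * fst (outward_normal (QT T \<Omega>) (fst x))"
    using AE_Mb
  proof eventually_elim
    case (elim x)
    obtain t a where ta: "fst x = (t, a)" by (cases "fst x")
    then have fr: "t \<in> {0..T} \<and> a \<in> closure \<Omega> \<and> (t = 0 \<or> t = T \<or> a \<in> frontier \<Omega>)"
      using frontier_cylinder[OF \<Omega>(1) T, of t a] elim by simp
    show ?case
    proof (cases "a \<in> \<Omega>")
      case False
      then have "v a = 0" by (rule test_fun_zero[OF v])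
      then show ?thesis using ta by simp
    next
      case True
      then have "a \<notin> frontier \<Omega>" using \<Omega>(1) by (simp add: frontier_def interior_open)
      then consider "t = 0" | "t = T" using fr by blast
      then show ?thesis
      proof cases
        case 1
        then have "x \<in> bdQ 1 T \<Omega> \<times> UNIV" using ta fr by (auto simp: bdQ_def mem_Times_iff)
        then show ?thesis using outward_normal_initial[OF T \<Omega>(1) True] ta 1 by simp
      next
        case 2
        then show ?thesis using ta \<phi>(2) by simp
      qed
    qed
  qed
  have "(\<integral>x. ?g x * fst (outward_normal (QT T \<Omega>) (fst x)) \<partial>completion Mb) = (\<integral>x. - ?I x \<partial>completion Mb)"
    by (rule complete_measure.integral_cong_AE_complete[OF completion_complete _ ae, symmetric])
       (rule borel_measurable_uminus[OF Im])
  also have "\<dots> = - (\<integral>x. ?I x \<partial>completion Mb)" by simp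
  also have "(\<integral>x. ?I x \<partial>completion Mb)
     = (\<integral>((t, x), y, z0, z)\<in>bdQ 1 T \<Omega> \<times> UNIV. \<phi> t * (if x \<in> \<Omega> then v x else v x) * \<beta> y \<partial>completion Mb)"
    unfolding set_lebesgue_integral_def by (intro Bochner_Integration.integral_cong refl) (simp add: case_prod_unfold)
  also have "\<dots> = (\<integral>x. \<phi> 0 * v x * \<beta> (y0 x) \<partial>lebesgue_on \<Omega>)"
    by (rule occ_init[OF \<phi>(1) smooth_H1_trace[OF sv \<Omega>(1,2)] \<beta>])
  also have "\<dots> = \<phi> 0 * (\<integral>x. v x * \<beta> (y0 x) \<partial>lebesgue_on \<Omega>)"
    by (simp only: mult.assoc integral_mult_right_zero)
  finally show ?thesis .
qed

text \<open>The time identity is tested with \<open>\<phi> t * v x\<close>, where \<open>\<phi>\<close> decreases from \<open>\<phi> 0 > 0\<close> to \<open>0\<close> on \<open>[0, \<delta>]\<close>.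
  Then \<open>- deriv \<phi>\<close> is \<open>\<phi> 0\<close> times a probability density on \<open>[0, \<delta>]\<close>, so replacing \<open>U (t, x)\<close> by
  \<open>U (0, x)\<close> costs \<open>\<phi> 0\<close> times a multiple of \<open>\<delta>\<close>, and so does the term with the time derivative.
  Division by \<open>\<phi> 0\<close> and \<open>\<delta> \<rightarrow> 0\<close> show that \<open>U (0, x) - \<beta> (y0 x)\<close> is orthogonal to all test functions.\<close>

lemma mean_initial_value:
  assumes \<beta>: "\<beta> C1_differentiable_on UNIV" and U: "C-lipschitz_on ({0..T} \<times> UNIV) U"
    and ae: "AE p in LS. U p = mean \<beta> p" and C: "\<And>p. p \<in> S \<Longrightarrow> norm (mean_grad (deriv \<beta>) p) \<le> C"
    and x: "x \<in> \<Omega>"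
  shows "U (0, x) = \<beta> (y0 x)"
proof -
  note c = C1_real[OF \<beta>]
  have C0: "C \<ge> 0" using U by (rule lipschitz_on_nonneg)
  have U0: "continuous_on UNIV (\<lambda>x. U (0, x))"
    by (rule continuous_on_compose2[OF lipschitz_on_continuous_on[OF U]]) (use T in \<open>auto intro!: continuous_intros\<close>)
  have \<beta>y: "continuous_on \<Omega> (\<lambda>x. \<beta> (y0 x))"
    by (rule continuous_on_compose2[OF c(1) y0(1)]) simp
  have "(\<lambda>x. U (0, x) - \<beta> (y0 x)) x = 0"
  proof (rule continuous_eq_0_of_orthogonal[OF \<Omega>(1) _ _ x])
    show "continuous_on \<Omega> (\<lambda>x. U (0, x) - \<beta> (y0 x))"
      by (intro continuous_on_diff continuous_on_subset[OF U0] \<beta>y) simp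
    fix v assume v: "test_fun \<Omega> v"
    obtain Bv where sv: "smooth v" and Bv: "\<And>p. \<bar>v p\<bar> \<le> Bv"
      using test_fun_bounds[OF v \<Omega>(1)] by metis
    have vc: "continuous_on A v" for A by (rule smooth_continuous_on[OF sv])
    have iv: "integrable (lebesgue_on \<Omega>) (\<lambda>x. \<bar>v x\<bar>)"
      by (rule integrable_space_continuous[of _ Bv]) (use Bv in \<open>auto intro!: continuous_intros vc\<close>)
    have "compact (closure \<Omega>)" using \<Omega>(2) by (simp add: compact_closure)
    then have "bounded ((\<lambda>x. U (0, x)) ` closure \<Omega>)"
      by (intro compact_imp_bounded compact_continuous_image continuous_on_subset[OF U0]) auto
    then obtain BU where "\<forall>z\<in>(\<lambda>x. U (0, x)) ` closure \<Omega>. norm z \<le> BU" unfolding bounded_iff ..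
    then have BU: "\<bar>U (0, x)\<bar> \<le> BU" if "x \<in> \<Omega>" for x using that closure_subset[of \<Omega>] by auto
    have iU: "integrable (lebesgue_on \<Omega>) (\<lambda>x. v x * U (0, x))"
    proof (rule integrable_space_continuous[of _ "Bv * BU"])
      show "continuous_on \<Omega> (\<lambda>x. v x * U (0, x))" by (intro continuous_on_mult vc continuous_on_subset[OF U0]) simp
      show "\<bar>v x * U (0, x)\<bar> \<le> Bv * BU" if "x \<in> \<Omega>" for x
        unfolding abs_mult using order_trans[OF abs_ge_zero Bv] by (intro mult_mono Bv BU[OF that]) auto
    qed
    have "compact (closure (y0 ` \<Omega>))" using y0(2) by (simp add: compact_closure)
    then have "bounded (\<beta> ` closure (y0 ` \<Omega>))"
      by (intro compact_imp_bounded compact_continuous_image continuous_on_subset[OF c(1)]) auto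
    then obtain B\<beta> where "\<forall>z\<in>\<beta> ` closure (y0 ` \<Omega>). norm z \<le> B\<beta>" unfolding bounded_iff ..
    then have B\<beta>: "\<bar>\<beta> (y0 x)\<bar> \<le> B\<beta>" if "x \<in> \<Omega>" for x using that closure_subset[of "y0 ` \<Omega>"] by auto
    have i\<beta>: "integrable (lebesgue_on \<Omega>) (\<lambda>x. v x * \<beta> (y0 x))"
    proof (rule integrable_space_continuous[of _ "Bv * B\<beta>"])
      show "continuous_on \<Omega> (\<lambda>x. v x * \<beta> (y0 x))" by (intro continuous_on_mult vc \<beta>y)
      show "\<bar>v x * \<beta> (y0 x)\<bar> \<le> Bv * B\<beta>" if "x \<in> \<Omega>" for x
        unfolding abs_mult using order_trans[OF abs_ge_zero Bv] by (intro mult_mono Bv B\<beta>[OF that]) auto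
    qed
    let ?I = "\<integral>x. \<bar>v x\<bar> \<partial>lebesgue_on \<Omega>"
    show "(\<integral>x. v x * (U (0, x) - \<beta> (y0 x)) \<partial>lebesgue_on \<Omega>) = 0"
    proof (rule eq_0_if_le_linear[OF T, where K="2 * C * ?I"])
      fix \<delta> :: real assume \<delta>: "0 < \<delta>" "\<delta> \<le> T"
      \<comment> \<open>Smooth, positive and decreasing for \<open>t < \<delta>\<close>, zero afterwards; \<open>\<delta> \<le> T\<close> gives \<open>\<phi> T = 0\<close>.\<close>
      define \<phi> where "\<phi> t = flat 0 (\<delta> - t)" for t
      have s\<phi>: "smooth \<phi>"
      proof -
        have "smooth (\<lambda>t::real. t)" using smooth_inner_const[of "1::real"] by simp
        then show ?thesis unfolding \<phi>_def by (intro smooth_compose_real[OF smooth_flat] smooth_diff smooth_const)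
      qed
      have d\<phi>: "(\<phi> has_real_derivative - flat 2 (\<delta> - t)) (at t)" for t
      proof -
        have "((\<lambda>t. \<delta> - t) has_real_derivative - 1) (at t)" by (auto intro!: derivative_eq_intros)
        from DERIV_chain2[OF flat_DERIV[of 0] this] show ?thesis by (simp add: \<phi>_def[abs_def] numeral_2_eq_2)
      qed
      then have deriv\<phi>: "deriv \<phi> t = - flat 2 (\<delta> - t)" for t by (rule DERIV_imp_deriv)
      have flat2: "0 \<le> flat 2 s" for s by (simp add: flat_def)
      have \<phi>0: "\<phi> 0 > 0" using \<delta> by (simp add: \<phi>_def flat_def)
      have \<phi>T: "\<phi> T = 0" using \<delta> by (simp add: \<phi>_def flat_def)
      have \<phi>le: "0 \<le> \<phi> t" "0 \<le> t \<Longrightarrow> \<phi> t \<le> \<phi> 0 * indicator {0..\<delta>} t" for t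
      proof -
        show "0 \<le> \<phi> t" by (simp add: \<phi>_def flat_def)
        show "\<phi> t \<le> \<phi> 0 * indicator {0..\<delta>} t" if "0 \<le> t"
        proof (cases "t < \<delta>")
          case True
          have "- 1 / (\<delta> - t) \<le> - 1 / \<delta>" using that True by (simp add: frac_le)
          then show ?thesis using that True \<delta> by (simp add: \<phi>_def flat_def)
        qed (use \<delta> that in \<open>auto simp: \<phi>_def flat_def indicator_def\<close>)
      qed
      have FTC: "(\<integral>t. indicator {0..T} t * deriv \<phi> t \<partial>lborel) = - \<phi> 0"
        using integral_FTC_Icc_real[of 0 T \<phi> "deriv \<phi>"] T \<phi>T smooth_DERIV[OF s\<phi>]
          continuous_on_interior[OF smooth_continuous_on[OF smooth_deriv[OF s\<phi>], of UNIV]]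
        by (simp add: mult.commute)
      have ia: "integrable lborel (\<lambda>t. indicator {0..T} t * deriv \<phi> t)"
        by (rule integrable_time_continuous[OF smooth_continuous_on[OF smooth_deriv[OF s\<phi>]]])
      have ia': "integrable lborel (\<lambda>t. indicator {0..T} t * (- deriv \<phi> t))"
        using integrable_minus[OF ia] by simp
      have ind: "(\<lambda>t. indicator {0..T} t * (\<phi> 0 * indicator {0..\<delta>} t)) = (\<lambda>t. \<phi> 0 * indicator {0..\<delta>} t)"
        using \<delta> by (auto simp: indicator_def fun_eq_iff)
      have ib: "integrable lborel (\<lambda>t. indicator {0..T} t * (\<phi> 0 * indicator {0..\<delta>} t))"
        unfolding ind by (intro integrable_mult_right integrable_real_indicator) (auto simp: emeasure_lborel_Icc_eq)
      have Ib: "(\<integral>t. indicator {0..T} t * (\<phi> 0 * indicator {0..\<delta>} t) \<partial>lborel) = \<phi> 0 * \<delta>"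
        unfolding ind using \<delta> by simp
      let ?A = "\<lambda>p. (deriv \<phi> (fst p) * v (snd p)) * mean \<beta> p"
      let ?B = "\<lambda>p. (\<phi> (fst p) * v (snd p)) * mean_t (deriv \<beta>) p"
      let ?Q = "\<lambda>p. deriv \<phi> (fst p) * (v (snd p) * U (0, snd p))"
      have h1: "integrable LS (\<lambda>p. deriv \<phi> (fst p) * v (snd p))" and h2: "integrable LS (\<lambda>p. \<phi> (fst p) * v (snd p))"
        by (intro integrable_LS_continuous tensor_continuous smooth_continuous_on smooth_deriv s\<phi> sv)+
      have iA: "integrable LS ?A"
        using integral_separated(2)[OF continuous_state_functions(1)[OF c(1)] h1] by (simp add: mean_def)
      have iB: "integrable LS ?B"
        using integral_separated(2)[OF continuous_state_functions(2)[OF c(2)] h2] by (simp add: mean_t_def)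
      have iA0: "integrable LS ?Q" by (rule tensor_integral(1)[OF ia iU])
      have IA0: "(\<integral>p. ?Q p \<partial>LS) = - \<phi> 0 * (\<integral>x. v x * U (0, x) \<partial>lebesgue_on \<Omega>)"
        using tensor_integral(2)[OF ia iU] FTC by simp
      have bA: "\<bar>\<integral>p. ?A p - ?Q p \<partial>LS\<bar> \<le> (\<integral>p. (- deriv \<phi> (fst p)) * (C * \<delta> * \<bar>v (snd p)\<bar>) \<partial>LS)"
      proof (rule abs_integral_le)
        show "integrable LS (\<lambda>p. ?A p - ?Q p)" by (rule Bochner_Integration.integrable_diff[OF iA iA0])
        show "integrable LS (\<lambda>p. (- deriv \<phi> (fst p)) * (C * \<delta> * \<bar>v (snd p)\<bar>))"
          by (rule tensor_integral(1)[OF ia' integrable_mult_right[OF iv]])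
        show "AE p in LS. \<bar>?A p - ?Q p\<bar> \<le> (- deriv \<phi> (fst p)) * (C * \<delta> * \<bar>v (snd p)\<bar>)"
          using ae LS_AE_mem
        proof eventually_elim
          case (elim p)
          have e: "?A p - ?Q p = deriv \<phi> (fst p) * (v (snd p) * (U p - U (0, snd p)))"
            using elim(1) by (simp add: algebra_simps)
          show ?case
          proof (cases "fst p < \<delta>")
            case True
            have t: "0 \<le> fst p" "fst p \<le> T" using elim(2) by (auto simp: mem_Times_iff)
            have "\<bar>U p - U (0, snd p)\<bar> \<le> C * \<bar>fst p\<bar>"
              using lipschitz_onD[OF U, of p "(0, snd p)"] t T
              by (cases p) (simp add: dist_Pair_Pair dist_real_def)
            also have "\<dots> \<le> C * \<delta>" using True t C0 by (intro mult_left_mono) auto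
            finally have "\<bar>v (snd p)\<bar> * \<bar>U p - U (0, snd p)\<bar> \<le> \<bar>v (snd p)\<bar> * (C * \<delta>)"
              by (intro mult_left_mono) auto
            then have "\<bar>deriv \<phi> (fst p)\<bar> * (\<bar>v (snd p)\<bar> * \<bar>U p - U (0, snd p)\<bar>) \<le> \<bar>deriv \<phi> (fst p)\<bar> * (\<bar>v (snd p)\<bar> * (C * \<delta>))"
              by (rule mult_left_mono) (rule abs_ge_zero)
            moreover have "\<bar>deriv \<phi> (fst p)\<bar> = - deriv \<phi> (fst p)" using flat2 by (simp add: deriv\<phi>)
            ultimately show ?thesis unfolding e abs_mult by (simp add: mult_ac)
          next
            case False
            then have "deriv \<phi> (fst p) = 0" by (simp add: deriv\<phi> flat_def)
            then show ?thesis unfolding e by simp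
          qed
        qed
      qed
      have "(\<integral>p. (- deriv \<phi> (fst p)) * (C * \<delta> * \<bar>v (snd p)\<bar>) \<partial>LS) = \<phi> 0 * (C * \<delta> * ?I)"
        using tensor_integral(2)[OF ia' integrable_mult_right[OF iv, of "C * \<delta>"]] FTC by simp
      with bA have bA': "\<bar>(\<integral>p. ?A p \<partial>LS) - (\<integral>p. ?Q p \<partial>LS)\<bar> \<le> \<phi> 0 * (C * \<delta> * ?I)"
        using iA iA0 by simp
      have "\<bar>\<integral>p. ?B p \<partial>LS\<bar> \<le> (\<integral>p. (\<phi> 0 * indicator {0..\<delta>} (fst p)) * (C * \<bar>v (snd p)\<bar>) \<partial>LS)"
      proof (rule abs_integral_le[OF iB])
        show "integrable LS (\<lambda>p. (\<phi> 0 * indicator {0..\<delta>} (fst p)) * (C * \<bar>v (snd p)\<bar>))"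
          by (rule tensor_integral(1)[OF ib integrable_mult_right[OF iv]])
        show "AE p in LS. \<bar>?B p\<bar> \<le> (\<phi> 0 * indicator {0..\<delta>} (fst p)) * (C * \<bar>v (snd p)\<bar>)"
          using LS_AE_mem
        proof eventually_elim
          case (elim p)
          have "0 \<le> fst p" using elim by (auto simp: mem_Times_iff)
          note le = \<phi>le(1)[of "fst p"] \<phi>le(2)[OF this]
          have "\<bar>mean_t (deriv \<beta>) p\<bar> \<le> C"
            using C[OF elim] norm_fst_le[of "mean_t (deriv \<beta>) p"] unfolding mean_grad_def
            by (metis order_trans real_norm_def)
          then have "\<bar>v (snd p)\<bar> * \<bar>mean_t (deriv \<beta>) p\<bar> \<le> \<bar>v (snd p)\<bar> * C" by (intro mult_left_mono) auto
          then have "\<phi> (fst p) * (\<bar>v (snd p)\<bar> * \<bar>mean_t (deriv \<beta>) p\<bar>) \<le> (\<phi> 0 * indicator {0..\<delta>} (fst p)) * (\<bar>v (snd p)\<bar> * C)"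
            by (rule mult_mono[OF le(2) _ order_trans[OF le(1) le(2)]]) simp
          moreover have "\<bar>?B p\<bar> = \<phi> (fst p) * (\<bar>v (snd p)\<bar> * \<bar>mean_t (deriv \<beta>) p\<bar>)"
            using le(1) by (simp add: abs_mult mult_ac)
          ultimately show ?case by (simp only: mult.commute[of C])
        qed
      qed
      also have "\<dots> = (\<phi> 0 * \<delta>) * (C * ?I)"
        using tensor_integral(2)[OF ib integrable_mult_right[OF iv, of C]] Ib by simp
      finally have bB: "\<bar>\<integral>p. ?B p \<partial>LS\<bar> \<le> (\<phi> 0 * \<delta>) * (C * ?I)" .
      have tot: "(\<integral>p. ?A p \<partial>LS) + (\<integral>p. ?B p \<partial>LS) = - (\<phi> 0 * (\<integral>x. v x * \<beta> (y0 x) \<partial>lebesgue_on \<Omega>))"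
        using time_identity[OF s\<phi> sv \<beta>] initial_boundary_term[OF s\<phi> \<phi>T v \<beta>] by simp
      have vE: "(\<integral>x. v x * (U (0, x) - \<beta> (y0 x)) \<partial>lebesgue_on \<Omega>)
          = (\<integral>x. v x * U (0, x) \<partial>lebesgue_on \<Omega>) - (\<integral>x. v x * \<beta> (y0 x) \<partial>lebesgue_on \<Omega>)"
        using iU i\<beta> by (simp add: right_diff_distrib)
      have "\<phi> 0 * (\<integral>x. v x * (U (0, x) - \<beta> (y0 x)) \<partial>lebesgue_on \<Omega>)
          = ((\<integral>p. ?A p \<partial>LS) - (\<integral>p. ?Q p \<partial>LS)) + (\<integral>p. ?B p \<partial>LS)"
        unfolding IA0 vE unfolding right_diff_distrib using tot by linarith
      then have "\<bar>\<phi> 0 * (\<integral>x. v x * (U (0, x) - \<beta> (y0 x)) \<partial>lebesgue_on \<Omega>)\<bar>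
          \<le> \<phi> 0 * (C * \<delta> * ?I) + (\<phi> 0 * \<delta>) * (C * ?I)"
        using bA' bB by linarith
      also have "\<dots> = \<phi> 0 * (2 * C * ?I * \<delta>)" by (simp add: algebra_simps)
      finally have "\<phi> 0 * \<bar>\<integral>x. v x * (U (0, x) - \<beta> (y0 x)) \<partial>lebesgue_on \<Omega>\<bar> \<le> \<phi> 0 * (2 * C * ?I * \<delta>)"
        using \<phi>0 by (simp only: abs_mult abs_of_pos)
      then show "\<bar>\<integral>x. v x * (U (0, x) - \<beta> (y0 x)) \<partial>lebesgue_on \<Omega>\<bar> \<le> 2 * C * ?I * \<delta>"
        using \<phi>0 by (rule mult_left_le_imp_le)
    qed
  qed
  then show ?thesis by simp
qed

end

section \<open>Moment equations\<close>

lemma Lp_2_imp_integrable: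
  fixes g :: "'b::euclidean_space \<Rightarrow> 'c::euclidean_space"
  assumes \<Omega>: "bounded \<Omega>" "\<Omega> \<in> sets lebesgue" and g: "Lp 2 \<Omega> g"
  shows "integrable (lebesgue_on \<Omega>) g"
proof -
  interpret finite_measure "lebesgue_on \<Omega>" by (rule finite_measure_lebesgue_on_bounded[OF \<Omega>])
  have m: "g \<in> borel_measurable (lebesgue_on \<Omega>)" and i: "integrable (lebesgue_on \<Omega>) (\<lambda>x. norm (g x) powr 2)"
    using g by (auto simp: Lp_def)
  have "integrable (lebesgue_on \<Omega>) (\<lambda>x. 1 + norm (g x) powr 2)"
    using i by (intro Bochner_Integration.integrable_add integrable_const)
  then show ?thesis
  proof (rule Bochner_Integration.integrable_bound[OF _ m], intro AE_I2)
    fix x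
    have "norm (g x) \<le> 1 + (norm (g x))\<^sup>2"
      using zero_le_power2[of "norm (g x) - 1"] norm_ge_zero[of "g x"] by (simp add: power2_diff) (use zero_le_power2[of "norm (g x)"] in linarith)
    then show "norm (g x) \<le> norm (1 + norm (g x) powr 2)" by simp
  qed
qed

lemma split_pde_integrand:
  fixes z g :: "'a::euclidean_space"
  shows "a * w * b * (z0 - F) + (\<Sum>j\<in>Basis. (a * (g \<bullet> j) * b + (z \<bullet> j) * (a * w * d)) * (z \<bullet> j))
     = (a * w * (z0 * b) - a * w * (b * F)) + (\<Sum>j\<in>Basis. a * (g \<bullet> j) * ((z \<bullet> j) * b)) + a * w * (d * (norm z)\<^sup>2)"
proof -
  have n: "(norm z)\<^sup>2 = (\<Sum>j\<in>Basis. (z \<bullet> j) * (z \<bullet> j))"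
    by (simp add: power2_norm_eq_inner euclidean_inner[of z z])
  have "(\<Sum>j\<in>Basis. (a * (g \<bullet> j) * b + (z \<bullet> j) * (a * w * d)) * (z \<bullet> j))
     = (\<Sum>j\<in>Basis. a * (g \<bullet> j) * ((z \<bullet> j) * b)) + a * w * (d * (norm z)\<^sup>2)"
    unfolding n by (simp add: sum_distrib_left distrib_left sum.distrib mult_ac)
  then show ?thesis by (simp add: algebra_simps)
qed

context occupation_setting
begin

definition mean_f :: "(real \<Rightarrow> real) \<Rightarrow> real \<times> 'a \<Rightarrow> real" where
  "mean_f \<beta> p = (\<integral>(y, z0, z). \<beta> y * f (fst p) (snd p) y \<partial>\<mu> p)"

definition mean_sq :: "(real \<Rightarrow> real) \<Rightarrow> real \<times> 'a \<Rightarrow> real" where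
  "mean_sq \<beta> p = (\<integral>(y, z0, z). \<beta> y * (norm z)\<^sup>2 \<partial>\<mu> p)"

text \<open>The trace of \<open>v\<close> is zero and \<open>\<phi>\<close> vanishes at the initial and final times, so the boundary
  integrals vanish for arbitrary \<open>\<beta>\<close>.\<close>

lemma pde_identity:
  assumes \<beta>: "\<beta> C1_differentiable_on UNIV" and v: "W10 2 \<Omega> v G" and \<phi>: "test_fun {0<..<T} \<phi>"
  shows "integrable LS (\<lambda>p. (\<phi> (fst p) * v (snd p)) * mean_t \<beta> p)"
    and "integrable LS (\<lambda>p. (\<phi> (fst p) * v (snd p)) * mean_f \<beta> p)"
    and "j \<in> Basis \<Longrightarrow> integrable LS (\<lambda>p. (\<phi> (fst p) * (G (snd p) \<bullet> j)) * mean_x j \<beta> p)"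
    and "integrable LS (\<lambda>p. (\<phi> (fst p) * v (snd p)) * mean_sq (deriv \<beta>) p)"
    and "(\<integral>p. (\<phi> (fst p) * v (snd p)) * mean_t \<beta> p \<partial>LS) - (\<integral>p. (\<phi> (fst p) * v (snd p)) * mean_f \<beta> p \<partial>LS)
      + (\<Sum>j\<in>Basis. \<integral>p. (\<phi> (fst p) * (G (snd p) \<bullet> j)) * mean_x j \<beta> p \<partial>LS)
      + (\<integral>p. (\<phi> (fst p) * v (snd p)) * mean_sq (deriv \<beta>) p \<partial>LS) = 0"
proof -
  note c = C1_real[OF \<beta>]
  have s: "smooth \<phi>" using \<phi> by (simp add: test_fun_def)
  have iv: "integrable (lebesgue_on \<Omega>) v" and iG: "integrable (lebesgue_on \<Omega>) G"
    using v by (auto simp: W10_def W1_def intro: Lp_2_imp_integrable[OF \<Omega>(2) \<Omega>_measurable(1)])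
  note ia = integrable_time_continuous[OF smooth_continuous_on[OF s]]
  \<comment> \<open>The values of \<open>v\<close> outside \<open>\<Omega>\<close> are arbitrary; the identities see its trace \<open>0\<close> instead.\<close>
  let ?w = "\<lambda>x. if x \<in> \<Omega> then v x else 0"
  let ?h = "\<lambda>p. \<phi> (fst p) * ?w (snd p)"
  let ?g = "\<lambda>j p. \<phi> (fst p) * (G (snd p) \<bullet> j)"
  have hv: "?h p = \<phi> (fst p) * v (snd p)" if "p \<in> space LS" for p
    using that by (auto simp: space_restrict_space)
  have ih: "integrable LS ?h"
    using tensor_integral(1)[OF ia iv] by (rule Bochner_Integration.integrable_cong[THEN iffD1, rotated -1]) (auto simp: hv)
  have ig: "integrable LS (?g j)" for j
    by (rule tensor_integral(1)[OF ia]) (use iG in simp)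
  note D1 = integral_separated[OF continuous_state_functions(2)[OF c(1)] ih]
  note D2 = integral_separated_rhs[OF continuous_state_functions(1)[OF c(1)] ih]
  note D3 = integral_separated[OF continuous_state_functions(3)[OF c(1)] ig]
  note D4 = integral_separated[OF continuous_state_functions(4)[OF c(2)] ih]
  let ?c1 = "\<lambda>(y, z0, z :: 'a). z0 * \<beta> y" and ?c2 = "\<lambda>(y, z0 :: real, z :: 'a). \<beta> y"
  let ?c3 = "\<lambda>j (y, z0 :: real, z :: 'a). (z \<bullet> j) * \<beta> y" and ?c4 = "\<lambda>(y, z0 :: real, z :: 'a). deriv \<beta> y * (norm z)\<^sup>2"
  have m1: "(\<integral>\<xi>. ?c1 \<xi> \<partial>\<mu> p) = mean_t \<beta> p" for p by (simp add: mean_t_def)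
  have m2: "(\<integral>\<xi>. ?c2 \<xi> * f (fst p) (snd p) (fst \<xi>) \<partial>\<mu> p) = mean_f \<beta> p" for p
    unfolding mean_f_def by (intro Bochner_Integration.integral_cong refl) (simp add: case_prod_unfold)
  have m3: "(\<integral>\<xi>. ?c3 j \<xi> \<partial>\<mu> p) = mean_x j \<beta> p" for p j by (simp add: mean_x_def)
  have m4: "(\<integral>\<xi>. ?c4 \<xi> \<partial>\<mu> p) = mean_sq (deriv \<beta>) p" for p by (simp add: mean_sq_def)
  have conv: "integrable LS (\<lambda>p. ?h p * k p) \<longleftrightarrow> integrable LS (\<lambda>p. (\<phi> (fst p) * v (snd p)) * k p)"
     "(\<integral>p. ?h p * k p \<partial>LS) = (\<integral>p. (\<phi> (fst p) * v (snd p)) * k p \<partial>LS)" for k :: "real \<times> 'a \<Rightarrow> real"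
    by (rule Bochner_Integration.integrable_cong Bochner_Integration.integral_cong, rule refl, simp only: hv)+
  show "integrable LS (\<lambda>p. (\<phi> (fst p) * v (snd p)) * mean_t \<beta> p)" using D1(2) unfolding m1 conv .
  show "integrable LS (\<lambda>p. (\<phi> (fst p) * v (snd p)) * mean_f \<beta> p)" using D2(2) unfolding m2 conv .
  show "integrable LS (\<lambda>p. (\<phi> (fst p) * (G (snd p) \<bullet> j)) * mean_x j \<beta> p)" using D3(2)[of j j] unfolding m3 .
  show "integrable LS (\<lambda>p. (\<phi> (fst p) * v (snd p)) * mean_sq (deriv \<beta>) p)" using D4(2) unfolding m4 conv .
  let ?F = "\<lambda>x. f (fst (fst x)) (snd (fst x)) (fst (snd x))"
  have "(\<integral>((t, x), y, z0, z). \<phi> t * ?w x * \<beta> y * (z0 - f t x y)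
        + (\<Sum>j\<in>Basis. (\<phi> t * (G x \<bullet> j) * \<beta> y + (z \<bullet> j) * (\<phi> t * ?w x * deriv \<beta> y)) * (z \<bullet> j)) \<partial>completion M)
      = (\<integral>x. (?h (fst x) * ?c1 (snd x) - ?h (fst x) * (?c2 (snd x) * ?F x)) + (\<Sum>j\<in>Basis. ?g j (fst x) * ?c3 j (snd x))
            + ?h (fst x) * ?c4 (snd x) \<partial>completion M)"
    by (rule Bochner_Integration.integral_cong[OF refl]) (simp only: case_prod_unfold split_pde_integrand)
  also have "\<dots> = (\<integral>p. ?h p * mean_t \<beta> p \<partial>LS) - (\<integral>p. ?h p * mean_f \<beta> p \<partial>LS)
      + (\<Sum>j\<in>Basis. \<integral>p. ?g j p * mean_x j \<beta> p \<partial>LS) + (\<integral>p. ?h p * mean_sq (deriv \<beta>) p \<partial>LS)"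
  proof -
    note i12 = Bochner_Integration.integrable_diff[OF D1(1) D2(1)]
    note i3 = Bochner_Integration.integrable_sum[of Basis "completion M" "\<lambda>j x. ?g j (fst x) * ?c3 j (snd x)", OF D3(1)]
    have "(\<integral>x. (?h (fst x) * ?c1 (snd x) - ?h (fst x) * (?c2 (snd x) * ?F x)) + (\<Sum>j\<in>Basis. ?g j (fst x) * ?c3 j (snd x))
            + ?h (fst x) * ?c4 (snd x) \<partial>completion M)
        = (\<integral>x. ?h (fst x) * ?c1 (snd x) - ?h (fst x) * (?c2 (snd x) * ?F x) \<partial>completion M)
          + (\<integral>x. (\<Sum>j\<in>Basis. ?g j (fst x) * ?c3 j (snd x)) \<partial>completion M)
          + (\<integral>x. ?h (fst x) * ?c4 (snd x) \<partial>completion M)"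
      by (subst Bochner_Integration.integral_add[OF Bochner_Integration.integrable_add[OF i12 i3] D4(1)])
         (subst Bochner_Integration.integral_add[OF i12 i3], rule refl)
    moreover have "(\<integral>x. (\<Sum>j\<in>Basis. ?g j (fst x) * ?c3 j (snd x)) \<partial>completion M)
        = (\<Sum>j\<in>Basis. \<integral>p. ?g j p * mean_x j \<beta> p \<partial>LS)"
      by (subst Bochner_Integration.integral_sum[OF D3(1)]) (simp only: D3(3) m3)
    moreover have "(\<integral>x. ?h (fst x) * ?c1 (snd x) - ?h (fst x) * (?c2 (snd x) * ?F x) \<partial>completion M)
        = (\<integral>p. ?h p * mean_t \<beta> p \<partial>LS) - (\<integral>p. ?h p * mean_f \<beta> p \<partial>LS)"
      by (subst Bochner_Integration.integral_diff[OF D1(1) D2(1)]) (simp only: D1(3) D2(3) m1 m2)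
    ultimately show ?thesis by (simp only: D4(3) m4)
  qed
  finally have L: "(\<integral>((t, x), y, z0, z). \<phi> t * ?w x * \<beta> y * (z0 - f t x y)
        + (\<Sum>j\<in>Basis. (\<phi> t * (G x \<bullet> j) * \<beta> y + (z \<bullet> j) * (\<phi> t * ?w x * deriv \<beta> y)) * (z \<bullet> j)) \<partial>completion M)
     = (\<integral>p. ?h p * mean_t \<beta> p \<partial>LS) - (\<integral>p. ?h p * mean_f \<beta> p \<partial>LS)
      + (\<Sum>j\<in>Basis. \<integral>p. ?g j p * mean_x j \<beta> p \<partial>LS) + (\<integral>p. ?h p * mean_sq (deriv \<beta>) p \<partial>LS)" .
  have "\<beta> 0 = 0 \<or> (\<forall>x\<in>frontier \<Omega>. ?w x = 0)" using \<Omega>(1) by (auto simp: frontier_def interior_open)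
  note bz = boundary_term_zero[where \<beta>=\<beta> and w="?w", OF \<phi> this]
  have R: "(\<integral>((t, x), y, z0, z). \<phi> t * ?w x * \<beta> y * (z \<bullet> j) * (snd (outward_normal (QT T \<Omega>) (t, x)) \<bullet> j) \<partial>completion Mb) = 0" for j
    by (rule integral_eq_zero_AE, use bz in eventually_elim) (simp add: case_prod_unfold)
  have "(\<integral>p. ?h p * mean_t \<beta> p \<partial>LS) - (\<integral>p. ?h p * mean_f \<beta> p \<partial>LS)
      + (\<Sum>j\<in>Basis. \<integral>p. ?g j p * mean_x j \<beta> p \<partial>LS) + (\<integral>p. ?h p * mean_sq (deriv \<beta>) p \<partial>LS) = 0"
    using occ_pde[OF s W10_H1_trace[OF v \<Omega>(1)] \<beta>] unfolding L R by simp
  then show "(\<integral>p. (\<phi> (fst p) * v (snd p)) * mean_t \<beta> p \<partial>LS) - (\<integral>p. (\<phi> (fst p) * v (snd p)) * mean_f \<beta> p \<partial>LS)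
      + (\<Sum>j\<in>Basis. \<integral>p. (\<phi> (fst p) * (G (snd p) \<bullet> j)) * mean_x j \<beta> p \<partial>LS)
      + (\<integral>p. (\<phi> (fst p) * v (snd p)) * mean_sq (deriv \<beta>) p \<partial>LS) = 0"
    unfolding conv .
qed

abbreviation "D \<equiv> {0<..<T} \<times> \<Omega>"

lemma open_cylinder: "D \<subseteq> S" "D \<in> sets borel" "D \<in> sets lebesgue" "open D" "bounded D"
proof -
  show "open D" using \<Omega>(1) by (intro open_Times) auto
  then show "D \<in> sets borel" "D \<in> sets lebesgue" by auto
  show "D \<subseteq> S" by auto
  then show "bounded D" using bounded_S bounded_subset by blast
qed

lemma weak_gradient_mean_cylinder:
  assumes \<beta>: "\<beta> C1_differentiable_on UNIV" and \<psi>: "test_fun D \<psi>" and i: "i \<in> Basis"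
    and A: "A \<in> sets borel" "D \<subseteq> A" "A \<subseteq> S"
  shows "(\<integral>p. (grad \<psi> p \<bullet> i) * mean \<beta> p \<partial>lebesgue_on A) = - (\<integral>p. \<psi> p * (mean_grad (deriv \<beta>) p \<bullet> i) \<partial>lebesgue_on A)"
proof -
  obtain F H B C where F: "F \<in> borel_measurable borel" "integrable lborel F" "\<And>p. \<bar>F p\<bar> \<le> B"
    "\<And>p. p \<notin> S \<Longrightarrow> F p = 0" "AE p in lborel. p \<in> S \<longrightarrow> mean \<beta> p = F p"
    and H: "H \<in> borel_measurable borel" "integrable lborel H" "\<And>p. norm (H p) \<le> C" "C \<ge> 0"
    "\<And>p. p \<notin> S \<Longrightarrow> H p = 0" "AE p in lborel. p \<in> S \<longrightarrow> mean_grad (deriv \<beta>) p = H p"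
    by (rule mean_borel_versions[OF \<beta>]) (rule that)
  note [measurable] = F(1) H(1)
  have s: "smooth \<psi>" using \<psi> by (simp add: test_fun_def)
  have [measurable]: "\<psi> \<in> borel_measurable borel" "grad \<psi> \<in> borel_measurable borel"
    by (auto intro!: borel_measurable_continuous_onI smooth_continuous_on smooth_continuous_grad s)
  have "(\<integral>p. (grad \<psi> p \<bullet> i) * mean \<beta> p \<partial>lebesgue_on A) = (\<integral>p. (grad \<psi> p \<bullet> i) * F p \<partial>lborel)"
  proof (rule integral_lebesgue_on_eq_borel_version[OF A(1)])
    show "(\<lambda>p. (grad \<psi> p \<bullet> i) * F p) \<in> borel_measurable borel" by measurable
    show "(grad \<psi> p \<bullet> i) * F p = 0" if "p \<notin> A" for p
      using test_fun_grad_zero[OF \<psi>, of p] contra_subsetD[OF A(2) that] by simp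
    show "AE p in lborel. p \<in> A \<longrightarrow> (grad \<psi> p \<bullet> i) * mean \<beta> p = (grad \<psi> p \<bullet> i) * F p"
      using F(5) by eventually_elim (use A(3) in auto)
  qed
  also have "\<dots> = - (\<integral>p. \<psi> p * (H p \<bullet> i) \<partial>lborel)"
    by (rule weak_gradient_mean[OF \<beta> _ F(1,2,4,5) H(1,2,5,6) \<psi> i]) simp
  also have "(\<integral>p. \<psi> p * (H p \<bullet> i) \<partial>lborel) = (\<integral>p. \<psi> p * (mean_grad (deriv \<beta>) p \<bullet> i) \<partial>lebesgue_on A)"
  proof (rule integral_lebesgue_on_eq_borel_version[OF A(1), symmetric])
    show "(\<lambda>p. \<psi> p * (H p \<bullet> i)) \<in> borel_measurable borel" by measurable
    show "\<psi> p * (H p \<bullet> i) = 0" if "p \<notin> A" for p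
      using test_fun_zero[OF \<psi>, of p] contra_subsetD[OF A(2) that] by simp
    show "AE p in lborel. p \<in> A \<longrightarrow> \<psi> p * (mean_grad (deriv \<beta>) p \<bullet> i) = \<psi> p * (H p \<bullet> i)"
      using H(6) by eventually_elim (use A(3) in auto)
  qed
  finally show ?thesis .
qed

lemma bounded_on_cylinder_Lp:
  fixes g :: "real \<times> 'a \<Rightarrow> 'c::euclidean_space"
  assumes g: "g \<in> borel_measurable LS" "\<exists>B\<ge>0. \<forall>p\<in>S. norm (g p) \<le> B"
  shows "Lp r D g" and "\<lbrakk>compact K; K \<subseteq> D\<rbrakk> \<Longrightarrow> integrable (lebesgue_on K) g"
proof -
  obtain B where B: "B \<ge> 0" "\<forall>p\<in>S. norm (g p) \<le> B" using g(2) by blast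
  have m: "g \<in> borel_measurable (lebesgue_on A)" if "A \<subseteq> S" for A
    using g(1) that by (rule measurable_restrict_mono)
  have b: "norm (g p) \<le> B" if "p \<in> D" for p by (rule bspec[OF B(2) subsetD[OF open_cylinder(1) that]])
  have "integrable (lebesgue_on D) (\<lambda>p. norm (g p) powr r)"
  proof (rule integrable_bounded_lebesgue_on[OF open_cylinder(5,3)])
    show "(\<lambda>p. norm (g p) powr r) \<in> borel_measurable (lebesgue_on D)" using m[OF open_cylinder(1)] by measurable
    show "AE p in lebesgue_on D. norm (norm (g p) powr r) \<le> B powr r"
    proof (intro AE_I2)
      fix p assume "p \<in> space (lebesgue_on D)"
      then have "norm (g p) \<le> B" by (intro b) (simp add: space_restrict_space)
      then show "norm (norm (g p) powr r) \<le> B powr r" using r by (simp add: powr_mono2)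
    qed
  qed
  then show "Lp r D g" using m[OF open_cylinder(1)] by (simp add: Lp_def)
  assume K: "compact K" "K \<subseteq> D"
  have KL: "K \<in> sets lebesgue" using compact_imp_closed[OF K(1)] by simp
  show "integrable (lebesgue_on K) g"
  proof (rule integrable_bounded_lebesgue_on[OF compact_imp_bounded[OF K(1)] KL m[OF order_trans[OF K(2) open_cylinder(1)]]])
    show "AE p in lebesgue_on K. norm (g p) \<le> B"
    proof (intro AE_I2)
      fix p assume "p \<in> space (lebesgue_on K)"
      then show "norm (g p) \<le> B" by (intro b subsetD[OF K(2)]) (simp add: space_restrict_space)
    qed
  qed
qed

lemma mean_W1:
  assumes \<beta>: "\<beta> C1_differentiable_on UNIV"
  shows "W1 r D (mean \<beta>) (mean_grad (deriv \<beta>))"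
proof -
  note c = C1_real[OF \<beta>]
  have m: "\<exists>B\<ge>0. \<forall>p\<in>S. norm (mean \<beta> p) \<le> B" using mean_measurable_bounded(2)[OF c(1)] by simp
  note 1 = bounded_on_cylinder_Lp[OF mean_measurable_bounded(1)[OF c(1)] m]
  note 2 = bounded_on_cylinder_Lp[OF mean_measurable_bounded(3,4)[OF c(2)]]
  show ?thesis
    unfolding W1_def weak_gradient_def
    by (intro conjI allI impI 1(1) 2(1); (elim conjE)?)
       (rule 1(2) 2(2) weak_gradient_mean_cylinder[OF \<beta> _ _ open_cylinder(2) order_refl open_cylinder(1)]; assumption)+
qed

text \<open>The identity \<open>pde_identity\<close> is applied to \<open>deriv \<beta>\<close> instead of \<open>\<beta>\<close>: the means of \<open>z0\<close> and \<open>z\<close> times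
  \<open>deriv \<beta> y\<close> form the gradient of \<open>mean \<beta>\<close>, and the second derivative enters through the gradient
  of the test function. The data are those of the Lipschitz representative, which exists because
  \<open>\<beta> 0 = 0\<close>.\<close>

lemma mean_moment_equation:
  assumes \<beta>: "\<beta> C1_differentiable_on UNIV" "deriv \<beta> C1_differentiable_on UNIV" "\<beta> 0 = 0"
    and h: "\<And>p. p \<in> S \<Longrightarrow> h p = mean_f (deriv \<beta>) p - mean_sq (deriv (deriv \<beta>)) p"
  shows "moment_equation T \<Omega> r (mean \<beta>) h (\<lambda>x. \<beta> (y0 x))"
  unfolding moment_equation_def
proof (intro conjI exI[of _ "mean_grad (deriv \<beta>)"] mean_W1[OF \<beta>(1)] allI impI)
  fix v Dv \<phi> assume v\<phi>: "W10 2 \<Omega> v Dv \<and> test_fun {0<..<T} \<phi>"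
  note P = pde_identity[OF \<beta>(2) conjunct1[OF v\<phi>] conjunct2[OF v\<phi>]]
  let ?A = "\<lambda>p. (\<phi> (fst p) * v (snd p)) * mean_t (deriv \<beta>) p"
  let ?F = "\<lambda>p. (\<phi> (fst p) * v (snd p)) * mean_f (deriv \<beta>) p"
  let ?X = "\<lambda>j p. (\<phi> (fst p) * (Dv (snd p) \<bullet> j)) * mean_x j (deriv \<beta>) p"
  let ?Q = "\<lambda>p. (\<phi> (fst p) * v (snd p)) * mean_sq (deriv (deriv \<beta>)) p"
  note iX = Bochner_Integration.integrable_sum[of Basis LS ?X, OF P(3)]
  note iAF = Bochner_Integration.integrable_diff[OF P(1,2)]
  have "(\<integral>(t, x). \<phi> t * (v x * fst (mean_grad (deriv \<beta>) (t, x)) + Dv x \<bullet> snd (mean_grad (deriv \<beta>) (t, x)) - v x * h (t, x)) \<partial>LS)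
      = (\<integral>p. (?A p - ?F p) + (\<Sum>j\<in>Basis. ?X j p) + ?Q p \<partial>LS)"
  proof (rule Bochner_Integration.integral_cong[OF refl])
    fix p assume "p \<in> space LS"
    then have p: "p \<in> S" by (simp add: space_restrict_space)
    have "Dv (snd p) \<bullet> snd (mean_grad (deriv \<beta>) p) = (\<Sum>j\<in>Basis. (Dv (snd p) \<bullet> j) * mean_x j (deriv \<beta>) p)"
      by (subst euclidean_inner) (simp add: mean_grad_inner(2))
    then show "(case p of (t, x) \<Rightarrow> \<phi> t * (v x * fst (mean_grad (deriv \<beta>) (t, x)) + Dv x \<bullet> snd (mean_grad (deriv \<beta>) (t, x)) - v x * h (t, x)))
       = (?A p - ?F p) + (\<Sum>j\<in>Basis. ?X j p) + ?Q p"
      by (simp add: case_prod_unfold h[OF p] mean_grad_inner(1) algebra_simps sum_distrib_left)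
  qed
  also have "\<dots> = (\<integral>p. ?A p \<partial>LS) - (\<integral>p. ?F p \<partial>LS) + (\<Sum>j\<in>Basis. \<integral>p. ?X j p \<partial>LS) + (\<integral>p. ?Q p \<partial>LS)"
    by (simp only: Bochner_Integration.integral_add[OF Bochner_Integration.integrable_add[OF iAF iX] P(4)]
        Bochner_Integration.integral_add[OF iAF iX] Bochner_Integration.integral_diff[OF P(1,2)]
        Bochner_Integration.integral_sum[of Basis LS ?X, OF P(3)])
  also have "\<dots> = 0" by (rule P(5))
  finally show "(\<integral>(t, x). \<phi> t * (v x * fst (mean_grad (deriv \<beta>) (t, x)) + Dv x \<bullet> snd (mean_grad (deriv \<beta>) (t, x)) - v x * h (t, x)) \<partial>LS) = 0" .
next
  obtain U C where U: "C-lipschitz_on ({0..T} \<times> UNIV) U" "AE p in LS. U p = mean \<beta> p"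
    "\<And>t x. t \<in> {0..T} \<Longrightarrow> x \<in> frontier \<Omega> \<Longrightarrow> U (t, x) = 0"
    "\<And>p. p \<in> S \<Longrightarrow> norm (mean_grad (deriv \<beta>) p) \<le> C"
    by (rule mean_lipschitz_representative[OF \<beta>(1,3)]) (rule that)
  show "attains_data T \<Omega> r (mean \<beta>) (\<lambda>x. \<beta> (y0 x))"
  proof (rule lipschitz_attains_data[OF U(1) T \<Omega>(1,2,3) r U(2,3)])
    show "AE x in lebesgue_on \<Omega>. U (0, x) = \<beta> (y0 x)"
      using mean_initial_value[OF \<beta>(1) U(1,2,4)] by (intro AE_I2) (simp add: space_restrict_space)
  qed
qed

section \<open>The fibres as an energy measure-valued solution\<close>

lemma young_measure_fibers: "young_measure S (Y \<times> UNIV) \<mu>"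
  unfolding young_measure_def
proof (intro conjI ballI allI impI)
  fix p assume p: "p \<in> S"
  have "closed (Y \<times> (UNIV :: (real \<times> 'a) set))" using YZ(1) by (intro closed_Times compact_imp_closed closed_UNIV)
  then have "- (Y \<times> (UNIV :: (real \<times> 'a) set)) \<in> sets borel" by (intro borel_open open_Compl)
  then have m: "- (Y \<times> (UNIV :: (real \<times> 'a) set)) \<in> sets (\<mu> p)" by (simp only: prob(2)[OF p])
  have "AE \<xi> in \<mu> p. \<xi> \<notin> - (Y \<times> UNIV)" using AE_support[OF p]
    by eventually_elim (simp add: mem_Times_iff)
  then have "- (Y \<times> UNIV) \<in> null_sets (\<mu> p)" by (simp only: AE_iff_null_sets[OF m])
  then have "emeasure (\<mu> p) (- (Y \<times> UNIV)) = 0" by (rule null_setsD1)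
  then show "prob_measure_on (Y \<times> UNIV) (\<mu> p)"
    unfolding prob_measure_on_def
    by (intro conjI) (simp_all only: prob(2)[OF p] prob_space.emeasure_space_1[OF prob(1)[OF p], unfolded sets_eq_imp_space_eq[OF prob(2)[OF p]] space_borel])
next
  fix g :: "real \<times> real \<times> 'a \<Rightarrow> real" assume g: "continuous_on (Y \<times> UNIV) g \<and> bounded (g ` (Y \<times> UNIV))"
  have "closed (Y \<times> (UNIV :: (real \<times> 'a) set))" using YZ(1) by (intro closed_Times compact_imp_closed closed_UNIV)
  then have "(\<lambda>\<xi>. indicator (Y \<times> UNIV) \<xi> *\<^sub>R g \<xi>) \<in> borel_measurable borel"
    using g by (intro borel_measurable_continuous_on_indicator) auto
  from fiber_integral_measurable[OF measurable_compose[OF measurable_snd this]]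
  show "(\<lambda>p. \<integral>\<xi>\<in>Y \<times> UNIV. g \<xi> \<partial>\<mu> p) \<in> borel_measurable LS" by (simp add: set_lebesgue_integral_def)
qed

lemma finite_moments_fibers: "finite_moments r S \<mu>"
  unfolding finite_moments_def
proof
  have n: "(\<lambda>\<xi> :: real \<times> real \<times> 'a. norm \<xi> powr r) \<in> borel_measurable borel" by measurable
  have "(\<lambda>x :: (real \<times> 'a) \<times> real \<times> real \<times> 'a. ennreal (norm (snd x) powr r)) \<in> borel_measurable (lebesgue \<Otimes>\<^sub>M borel)"
    by (rule measurable_compose[OF measurable_snd]) (use n in measurable)
  from nn_integral_measurable[OF this]
  show "(\<lambda>q. \<integral>\<^sup>+\<xi>. ennreal (norm \<xi> powr r) \<partial>\<mu> q) \<in> borel_measurable LS" by simp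
  obtain B where B: "B \<ge> 0" "\<forall>\<xi>\<in>E. norm \<xi> \<le> B" using E_bound[OF continuous_on_id] by auto
  have "(\<integral>\<^sup>+\<xi>. ennreal (norm \<xi> powr r) \<partial>\<mu> q) \<le> ennreal (B powr r)" if q: "q \<in> S" for q
  proof -
    interpret prob_space "\<mu> q" by (rule prob(1)[OF q])
    have "(\<integral>\<^sup>+\<xi>. ennreal (norm \<xi> powr r) \<partial>\<mu> q) \<le> (\<integral>\<^sup>+\<xi>. ennreal (B powr r) \<partial>\<mu> q)"
    proof (rule nn_integral_mono_AE)
      show "AE \<xi> in \<mu> q. ennreal (norm \<xi> powr r) \<le> ennreal (B powr r)"
        using AE_support[OF q]
      proof eventually_elim
        fix \<xi> assume "\<xi> \<in> E"
        then have "norm \<xi> \<le> B" by (rule bspec[OF B(2)])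
        then show "ennreal (norm \<xi> powr r) \<le> ennreal (B powr r)" using r by (intro ennreal_leI powr_mono2) auto
      qed
    qed
    then show ?thesis by (simp add: emeasure_space_1)
  qed
  then have "(\<integral>\<^sup>+q. (\<integral>\<^sup>+\<xi>. ennreal (norm \<xi> powr r) \<partial>\<mu> q) \<partial>LS) \<le> (\<integral>\<^sup>+q. ennreal (B powr r) \<partial>LS)"
    by (intro nn_integral_mono) (simp add: space_restrict_space)
  also have "\<dots> = ennreal (B powr r) * emeasure LS (space LS)" by simp
  also have "\<dots> < \<infinity>"
    using finite_measure.emeasure_finite[OF finite_measure_lebesgue_on_bounded[OF bounded_S SL], of "space LS"]
    by (simp add: ennreal_mult_less_top top.not_eq_extremum less_top)
  finally show "(\<integral>\<^sup>+q. (\<integral>\<^sup>+\<xi>. ennreal (norm \<xi> powr r) \<partial>\<mu> q) \<partial>LS) < \<infinity>" .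
qed

lemma integration_by_parts_fibers: "integration_by_parts T \<Omega> \<mu>"
  unfolding integration_by_parts_def
proof (intro allI impI conjI ballI)
  fix \<beta> :: "real \<Rightarrow> real" and \<psi> :: "real \<times> 'a \<Rightarrow> real"
  assume b: "\<beta> C1_differentiable_on UNIV \<and> test_fun D \<psi>"
  note W = weak_gradient_mean_cylinder[OF conjunct1[OF b] conjunct2[OF b] _ S(1) open_cylinder(1) order_refl]
  have "(1, 0) \<in> (Basis :: (real \<times> 'a) set)" by (simp add: Basis_prod_def)
  from W[OF this]
  show "(\<integral>p. fst (grad \<psi> p) * (\<integral>(y, z0, z). \<beta> y \<partial>\<mu> p) \<partial>LS)
          = - (\<integral>p. \<psi> p * (\<integral>(y, z0, z). z0 * deriv \<beta> y \<partial>\<mu> p) \<partial>LS)"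
    by (simp add: inner_prod_def mean_grad_inner(1) mean_def mean_t_def)
  fix j :: 'a assume j: "j \<in> Basis"
  then have "(0, j) \<in> (Basis :: (real \<times> 'a) set)" by (simp add: Basis_prod_def)
  from W[OF this]
  show "(\<integral>p. (snd (grad \<psi> p) \<bullet> j) * (\<integral>(y, z0, z). \<beta> y \<partial>\<mu> p) \<partial>LS)
            = - (\<integral>p. \<psi> p * (\<integral>(y, z0, z). (z \<bullet> j) * deriv \<beta> y \<partial>\<mu> p) \<partial>LS)"
    by (simp add: inner_prod_def mean_grad_inner(2)[OF j] mean_def mean_x_def)
qed

text \<open>The boundary term contains \<open>\<phi>\<close> times the time component of the normal; the first factor vanishes
  at the initial and final times, the second one on the lateral boundary.\<close>

lemma energy_identity:
  assumes \<phi>: "test_fun {0<..<T} \<phi>"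
  shows "(\<integral>(t, x). \<phi> t * (\<integral>(y, z0, z). z0\<^sup>2 \<partial>\<mu> (t, x))
            - deriv \<phi> t * (\<integral>(y, z0, z). 1/2 * (norm z)\<^sup>2 \<partial>\<mu> (t, x))
            - \<phi> t * (\<integral>(y, z0, z). z0 * f t x y \<partial>\<mu> (t, x)) \<partial>LS) = 0"
proof -
  have s: "smooth \<phi>" using \<phi> by (simp add: test_fun_def)
  let ?c1 = "\<lambda>(y :: real, z0 :: real, z :: 'a). z0\<^sup>2" and ?c2 = "\<lambda>(y :: real, z0 :: real, z :: 'a). 1/2 * (norm z)\<^sup>2"
  let ?c3 = "\<lambda>(y :: real, z0 :: real, z :: 'a). z0"
  have c: "continuous_on UNIV ?c1" "continuous_on UNIV ?c2" "continuous_on UNIV ?c3"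
    unfolding case_prod_unfold by (intro continuous_intros)+
  have h: "integrable LS (\<lambda>p. \<phi> (fst p))" "integrable LS (\<lambda>p. deriv \<phi> (fst p))"
    by (intro integrable_LS_continuous continuous_on_compose2[OF smooth_continuous_on[OF s, of UNIV]]
        continuous_on_compose2[OF smooth_continuous_on[OF smooth_deriv[OF s], of UNIV]] continuous_intros subset_UNIV)+
  note D1 = integral_separated[OF c(1) h(1)] and D2 = integral_separated[OF c(2) h(2)]
    and D3 = integral_separated_rhs[OF c(3) h(1)]
  let ?F = "\<lambda>x. f (fst (fst x)) (snd (fst x)) (fst (snd x))"
  have m3: "(\<integral>\<xi>. ?c3 \<xi> * f (fst p) (snd p) (fst \<xi>) \<partial>\<mu> p) = (\<integral>(y, z0, z). z0 * f (fst p) (snd p) y \<partial>\<mu> p)" for p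
    by (intro Bochner_Integration.integral_cong refl) (simp add: case_prod_unfold)
  have "AE x in completion Mb. (case x of ((t, x), y, z0, z) \<Rightarrow> 1/2 * \<phi> t * (norm z)\<^sup>2 * fst (outward_normal (QT T \<Omega>) (t, x))) = 0"
    using AE_Mb
  proof eventually_elim
    case (elim X)
    obtain t x y z0 z where X: "X = ((t, x), y, z0, z)" by (cases X) auto
    have fr: "t \<in> {0..T} \<and> x \<in> closure \<Omega> \<and> (t = 0 \<or> t = T \<or> x \<in> frontier \<Omega>)"
      using frontier_cylinder[OF \<Omega>(1) T, of t x] elim unfolding X by simp
    show ?case
    proof (cases "t = 0 \<or> t = T")
      case True
      then have "\<phi> t = 0" using test_fun_zero[OF \<phi>, of t] by auto
      then show ?thesis unfolding X by simp
    next
      case False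
      then have "0 < t" "t < T" using fr by auto
      then show ?thesis unfolding X using outward_normal_lateral[of t T x \<Omega>] fr by simp
    qed
  qed
  note bz = this
  have R: "(\<integral>((t, x), y, z0, z). 1/2 * \<phi> t * (norm z)\<^sup>2 * fst (outward_normal (QT T \<Omega>) (t, x)) \<partial>completion Mb) = 0"
    by (rule integral_eq_zero_AE, use bz in eventually_elim) (simp add: case_prod_unfold)
  have "(\<integral>((t, x), y, z0, z). \<phi> t * z0\<^sup>2 - 1/2 * deriv \<phi> t * (norm z)\<^sup>2 - \<phi> t * z0 * f t x y \<partial>completion M) = 0"
    using occ[unfolded occupation_identities_def Let_def, THEN conjunct2, THEN conjunct1, rule_format, OF s] unfolding R by simp
  also have "(\<integral>((t, x), y, z0, z). \<phi> t * z0\<^sup>2 - 1/2 * deriv \<phi> t * (norm z)\<^sup>2 - \<phi> t * z0 * f t x y \<partial>completion M)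
      = (\<integral>x. \<phi> (fst (fst x)) * ?c1 (snd x) - deriv \<phi> (fst (fst x)) * ?c2 (snd x) - \<phi> (fst (fst x)) * (?c3 (snd x) * ?F x) \<partial>completion M)"
    by (intro Bochner_Integration.integral_cong refl) (simp add: case_prod_unfold mult_ac)
  also have "\<dots> = (\<integral>p. \<phi> (fst p) * (\<integral>\<xi>. ?c1 \<xi> \<partial>\<mu> p) \<partial>LS) - (\<integral>p. deriv \<phi> (fst p) * (\<integral>\<xi>. ?c2 \<xi> \<partial>\<mu> p) \<partial>LS)
      - (\<integral>p. \<phi> (fst p) * (\<integral>\<xi>. ?c3 \<xi> * f (fst p) (snd p) (fst \<xi>) \<partial>\<mu> p) \<partial>LS)"
    by (simp only: Bochner_Integration.integral_diff[OF Bochner_Integration.integrable_diff[OF D1(1) D2(1)] D3(1)]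
        Bochner_Integration.integral_diff[OF D1(1) D2(1)] D1(3) D2(3) D3(3))
  also have "\<dots> = (\<integral>p. \<phi> (fst p) * (\<integral>\<xi>. ?c1 \<xi> \<partial>\<mu> p) - deriv \<phi> (fst p) * (\<integral>\<xi>. ?c2 \<xi> \<partial>\<mu> p)
      - \<phi> (fst p) * (\<integral>\<xi>. ?c3 \<xi> * f (fst p) (snd p) (fst \<xi>) \<partial>\<mu> p) \<partial>LS)"
    by (simp only: Bochner_Integration.integral_diff[OF Bochner_Integration.integrable_diff[OF D1(2) D2(2)] D3(2)]
        Bochner_Integration.integral_diff[OF D1(2) D2(2)])
  also have "\<dots> = (\<integral>(t, x). \<phi> t * (\<integral>(y, z0, z). z0\<^sup>2 \<partial>\<mu> (t, x))
            - deriv \<phi> t * (\<integral>(y, z0, z). 1/2 * (norm z)\<^sup>2 \<partial>\<mu> (t, x))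
            - \<phi> t * (\<integral>(y, z0, z). z0 * f t x y \<partial>\<mu> (t, x)) \<partial>LS)"
    unfolding m3 by (intro Bochner_Integration.integral_cong refl) (simp add: case_prod_unfold)
  finally show ?thesis .
qed

theorem emv_solution_fibers: "emv_solution T \<Omega> r Y f y0 \<mu>"
  unfolding emv_solution_def
proof (intro conjI young_measure_fibers finite_moments_fibers integration_by_parts_fibers allI impI energy_identity)
  have "moment_equation T \<Omega> r (mean (\<lambda>y. y)) (\<lambda>(t, x). \<integral>(y, z0, z). f t x y \<partial>\<mu> (t, x)) (\<lambda>x. y0 x)"
  proof (rule mean_moment_equation[OF C1_id(1)])
    show "deriv (\<lambda>y::real. y) C1_differentiable_on UNIV" unfolding C1_id(2) by (rule C1_const(1))
    show "(case p of (t, x) \<Rightarrow> \<integral>(y, z0, z). f t x y \<partial>\<mu> (t, x)) = mean_f (deriv (\<lambda>y. y)) p - mean_sq (deriv (deriv (\<lambda>y. y))) p" for p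
      unfolding C1_id(2) C1_const(2) mean_f_def mean_sq_def by (simp add: case_prod_unfold)
  qed simp
  then show "moment_equation T \<Omega> r (\<lambda>p. \<integral>(y, z0, z). y \<partial>\<mu> p) (\<lambda>(t, x). \<integral>(y, z0, z). f t x y \<partial>\<mu> (t, x)) y0"
    by (simp add: mean_def[abs_def])
  have "moment_equation T \<Omega> r (mean (\<lambda>y. y\<^sup>2))
       (\<lambda>(t, x). 2 * (\<integral>(y, z0, z). y * f t x y \<partial>\<mu> (t, x)) - 2 * (\<integral>(y, z0, z). (norm z)\<^sup>2 \<partial>\<mu> (t, x))) (\<lambda>x. (y0 x)\<^sup>2)"
  proof (rule mean_moment_equation[OF C1_square(1)])
    show "deriv (\<lambda>y::real. y\<^sup>2) C1_differentiable_on UNIV" unfolding C1_square(2) by (rule C1_scaled(1))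
    show "(case p of (t, x) \<Rightarrow> 2 * (\<integral>(y, z0, z). y * f t x y \<partial>\<mu> (t, x)) - 2 * (\<integral>(y, z0, z). (norm z)\<^sup>2 \<partial>\<mu> (t, x)))
        = mean_f (deriv (\<lambda>y. y\<^sup>2)) p - mean_sq (deriv (deriv (\<lambda>y. y\<^sup>2))) p" for p
      unfolding C1_square(2) C1_scaled(2) mean_f_def mean_sq_def
      by (simp add: case_prod_unfold mult.assoc flip: integral_mult_right_zero)
  qed simp
  then show "moment_equation T \<Omega> r (\<lambda>p. \<integral>(y, z0, z). y\<^sup>2 \<partial>\<mu> p)
       (\<lambda>(t, x). 2 * (\<integral>(y, z0, z). y * f t x y \<partial>\<mu> (t, x)) - 2 * (\<integral>(y, z0, z). (norm z)\<^sup>2 \<partial>\<mu> (t, x))) (\<lambda>x. (y0 x)\<^sup>2)"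
    by (simp add: mean_def[abs_def])
qed

end

theorem proposition8:
  fixes T r :: real
    and \<Omega> :: "'a::euclidean_space set"
    and f :: "real \<Rightarrow> 'a \<Rightarrow> real \<Rightarrow> real"
    and y0 :: "'a \<Rightarrow> real"
    and ystar :: "real \<times> 'a \<Rightarrow> real"
    and Dystar :: "real \<times> 'a \<Rightarrow> real \<times> 'a"
    and Y :: "real set"
    and Z :: "(real \<times> 'a) set"
    and M Mb :: "((real \<times> 'a) \<times> real \<times> real \<times> 'a) measure"
    and \<mu> :: "real \<times> 'a \<Rightarrow> (real \<times> real \<times> 'a) measure"
  assumes "T > 0"
    and "open \<Omega>" "connected \<Omega>" "\<Omega> \<noteq> {}" "bounded \<Omega>" "lipschitz_boundary \<Omega>"
    and "r \<ge> 2" "r > real DIM('a)"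
    and "\<exists>G. W10 r \<Omega> y0 G"
    and "admissible_rhs T \<Omega> f"
    and "weak_solution T \<Omega> r f y0 ystar Dystar"
    and "\<exists>C. AE p in lebesgue_on ({0..T} \<times> \<Omega>). norm (Dystar p) \<le> C"
    and "compact Y" "ystar ` QT T \<Omega> \<subseteq> Y"
    and "compact Z" "AE p in lebesgue_on ({0..T} \<times> \<Omega>). Dystar p \<in> Z"
    and "finite_borel_measure_on (QT T \<Omega> \<times> Y \<times> Z) M"
    and "finite_borel_measure_on (frontier (QT T \<Omega>) \<times> Y \<times> Z) Mb"
    and "occupation_identities T \<Omega> f y0 M Mb"
    and "disintegration ({0..T} \<times> \<Omega>) (Y \<times> Z) M \<mu>"
  shows "emv_solution T \<Omega> r Y f y0 \<mu>"
proof -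
  have X: "continuous_on (QT T \<Omega>) ystar" and y0: "\<forall>x\<in>\<Omega>. ystar (0, x) = y0 x"
    using assms(11) by (simp_all add: weak_solution_def X_space_def)
  have mem: "(0, x) \<in> QT T \<Omega>" if "x \<in> \<Omega>" for x
    using that assms(1) subsetD[OF closure_subset that] by (intro SigmaI) auto
  have "continuous_on \<Omega> (\<lambda>x. ystar (0, x))"
    by (rule continuous_on_compose2[OF X]) (use mem in \<open>auto intro!: continuous_intros\<close>)
  then have cont: "continuous_on \<Omega> y0" using y0 by (simp cong: continuous_on_cong)
  have "y0 x \<in> Y" if "x \<in> \<Omega>" for x
    using y0 that subsetD[OF assms(14) imageI[OF mem[OF that]]] by simp
  then have bdd: "bounded (y0 ` \<Omega>)"
    by (intro bounded_subset[OF compact_imp_bounded[OF assms(13)]]) (rule image_subsetI)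
  have "r > 0" using assms(7) by simp
  interpret occupation_setting T r \<Omega> f y0 Y Z M Mb \<mu>
    by (rule occupation_setting.intro) fact+
  show ?thesis by (rule emv_solution_fibers)
qed

end
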